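(* Let $G=\mathrm{Isom}_e\mathrm{Sol}=\mathrm{Sol}$, let $M$ be a connected closed oriented $3$-manifold, let $\rho\colon\pi_1(M)\to G$ be a representation, and let $p=p_c$ with $c\in\mathbb R$. For the auxiliary connection $\omega^s$ associated with any section $s\colon M\to P_\rho$, we have $$\mathrm{CS}_p(\omega^s,\omega_\rho)=2c\,s^*\mathrm{vol}_\rho\in\mathcal A^3(M;\mathbb R).$$
   Context: Manifolds, bundles and maps are smooth. $\mathcal A^3(M;\mathbb R)$ denotes real $3$-forms on $M$. $P_\rho=\widetilde M\times_\rho G$ with its flat connection $\omega_\rho$. $\mathrm{Sol}=\mathbb R^3$, $(x,y,z)$ corresponding to $\begin{pmatrix}e^{-z}&0&x\\0&e^z&y\\0&0&1\end{pmatrix}$ under matrix multiplication; $\mathfrak g=\mathrm{Lie}(G)$ has basis $X,Y,Z$ (the left-invariant frame $e^{-z}\partial_x,e^z\partial_y,\partial_z$) with nontrivial brackets $[X,Z]=X$, $[Y,Z]=-Y$. $p_c=\langle\cdot,\cdot\rangle$ is the $\mathrm{Ad}(G)$-invariant symmetric bilinear form whose only possibly nonzero component is $\langle Z,Z\rangle=c$. For $\mathfrak g$-valued forms, $[\alpha\otimes\xi,\beta\otimes\eta]=(\alpha\wedge\beta)\otimes[\xi,\eta]$ and $\langle\alpha\otimes\xi,\beta\otimes\eta\rangle=(\alpha\wedge\beta)\langle\xi,\eta\rangle$. For connections $\omega_1,\omega_0$ with $a=\omega_1-\omega_0$ (an $\mathrm{ad}P$-valued $1$-form on $M$), $\Omega_0=d\omega_0+\frac12[\omega_0,\omega_0]$,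 $d_{\omega_0}a=da+[\omega_0,a]$, set $\mathrm{CS}_p(\omega_1,\omega_0)=\langle a,d_{\omega_0}a\rangle+\frac13\langle a,[a,a]\rangle+2\langle a,\Omega_0\rangle$. Let $\mathrm{vol}_G=X^*\wedge Y^*\wedge Z^*=dx\wedge dy\wedge dz$ be the left-invariant volume form on $G$; $\mathrm{pr}_2^*\mathrm{vol}_G$ on $\widetilde M\times G$ descends to a closed $3$-form $\mathrm{vol}_\rho$ on $P_\rho$. For a section $s\colon M\to P_\rho$ write $s^*\omega_\rho=\alpha X+\beta Y+\gamma Z$ with $\alpha,\beta,\gamma$ real $1$-forms on $M$; $\omega^s$ is the unique connection on $P_\rho$ with $s^*\omega^s=(\alpha+\beta)Z$. *)

theory Defs
  imports "HOL-Analysis.Analysis" "HOL-Algebra.Group"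
begin

type_synonym vec3 = "real^3"


section \<open>Smooth manifolds given by atlases\<close>

text \<open>
  A chart is a pair of its domain and its coordinate map. An atlas is a set of charts and
  determines the underlying point set. Atlases are not required to be maximal: smoothness of
  maps and the forms below depend only on the smooth structure generated by the atlas.
\<close>

primrec Ck_on :: "nat \<Rightarrow> 'e::real_normed_vector set \<Rightarrow> ('e \<Rightarrow> 'f::real_normed_vector) \<Rightarrow> bool" where
  "Ck_on 0 S f \<longleftrightarrow> continuous_on S f"
| "Ck_on (Suc n) S f \<longleftrightarrow>
     (\<forall>y\<in>S. f differentiable (at y)) \<and> (\<forall>v. Ck_on n S (\<lambda>y. frechet_derivative f (at y) v))"

text \<open>To be used for open sets in finite-dimensional spaces.\<close>

definition smooth_on :: "'e::real_normed_vector set \<Rightarrow> ('e \<Rightarrow> 'f::real_normed_vector) \<Rightarrow> bool" where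
  "smooth_on S f \<longleftrightarrow> (\<forall>n. Ck_on n S f)"

type_synonym ('a, 'e) chart = "'a set \<times> ('a \<Rightarrow> 'e)"
type_synonym ('a, 'e) atlas = "('a, 'e) chart set"

definition cdom :: "('a, 'e) chart \<Rightarrow> 'a set" where
  "cdom c = fst c"

definition coord :: "('a, 'e) chart \<Rightarrow> 'a \<Rightarrow> 'e" where
  "coord c = snd c"

definition cimg :: "('a, 'e) chart \<Rightarrow> 'e set" where
  "cimg c = coord c ` cdom c"

definition param :: "('a, 'e) chart \<Rightarrow> 'e \<Rightarrow> 'a" where
  "param c = inv_into (cdom c) (coord c)"

definition pts :: "('a, 'e) atlas \<Rightarrow> 'a set" where
  "pts A = (\<Union>c\<in>A. cdom c)"

definition smooth_map ::
  "('a, 'e::euclidean_space) atlas \<Rightarrow> ('b, 'f::euclidean_space) atlas \<Rightarrow> ('a \<Rightarrow> 'b) \<Rightarrow> bool" where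
  "smooth_map A B f \<longleftrightarrow>
     (\<forall>p\<in>pts A. \<exists>c\<in>A. \<exists>b\<in>B. \<exists>O'. open O' \<and> p \<in> cdom c \<and> coord c p \<in> O' \<and> O' \<subseteq> cimg c \<and>
        f ` param c ` O' \<subseteq> cdom b \<and> smooth_on O' (coord b \<circ> f \<circ> param c))"

definition prod_atlas :: "('a, 'e) atlas \<Rightarrow> ('b, 'f) atlas \<Rightarrow> ('a \<times> 'b, 'e \<times> 'f) atlas" where
  "prod_atlas A B = (\<lambda>(c, b). (cdom c \<times> cdom b, map_prod (coord c) (coord b))) ` (A \<times> B)"

text \<open>
  The smooth structure on a quotient for which the projection \<open>q\<close> is a local
  diffeomorphism: its charts are the local inverses of \<open>q\<close> followed by charts upstairs.
\<close>

definition quotient_atlas :: "('a, 'e) atlas \<Rightarrow> ('a \<Rightarrow> 'b) \<Rightarrow> ('b, 'e) atlas" where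
  "quotient_atlas A q =
     {(q ` cdom c, coord c \<circ> inv_into (cdom c) q) | c. c \<in> A \<and> inj_on q (cdom c)}"

text \<open>
  A closed oriented 3-manifold: the underlying space \<open>pts A\<close> carries the subspace topology
  of the ambient type, the orientation is the one for which all charts in the (oriented) atlas
  are positive. Charts have open images, so there is no boundary.
\<close>

definition closed_oriented_3manifold :: "('m::topological_space, vec3) atlas \<Rightarrow> bool" where
  "closed_oriented_3manifold A \<longleftrightarrow>
     compact (pts A) \<and>
     Hausdorff_space (top_of_set (pts A)) \<and> second_countable (top_of_set (pts A)) \<and>
     (\<forall>c\<in>A. openin (top_of_set (pts A)) (cdom c) \<and> open (cimg c) \<and>
        homeomorphism (cdom c) (cimg c) (coord c) (param c)) \<and>
     (\<forall>c\<in>A. \<forall>b\<in>A. smooth_on (coord c ` (cdom c \<inter> cdom b)) (coord b \<circ> param c)) \<and>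
     (\<forall>c\<in>A. \<forall>b\<in>A. \<forall>p\<in>cdom c \<inter> cdom b.
        det (matrix (frechet_derivative (coord b \<circ> param c) (at (coord c p)))) > 0)"


section \<open>Vector-valued differential forms\<close>

text \<open>
  A \<open>k\<close>-form is a family of \<open>k\<close>-forms on the images of the charts which is compatible with
  pullback along the transition maps. A tuple of vectors is a function on \<open>nat\<close> of which only
  the values at \<open>0, ..., k - 1\<close> matter. The value \<open>0\<close> outside the chart images makes equality of forms
  agree with equality of functions.
\<close>

type_synonym ('a, 'e, 'v) form = "('a, 'e) chart \<Rightarrow> 'e \<Rightarrow> (nat \<Rightarrow> 'e) \<Rightarrow> 'v"

definition alternating_multilinear ::
  "nat \<Rightarrow> ((nat \<Rightarrow> 'e::real_vector) \<Rightarrow> 'v::real_vector) \<Rightarrow> bool" where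
  "alternating_multilinear k \<theta> \<longleftrightarrow>
     (\<forall>v w. (\<forall>i<k. v i = w i) \<longrightarrow> \<theta> v = \<theta> w) \<and>
     (\<forall>i<k. \<forall>v. linear (\<lambda>x. \<theta> (v(i := x)))) \<and>
     (\<forall>i<k. \<forall>j<k. \<forall>v. i \<noteq> j \<and> v i = v j \<longrightarrow> \<theta> v = 0)"

definition forms ::
  "('a, 'e::euclidean_space) atlas \<Rightarrow> nat \<Rightarrow> ('a, 'e, 'v::real_normed_vector) form set" where
  "forms A k = {\<omega>.
     (\<forall>c\<in>A. \<forall>y\<in>cimg c. alternating_multilinear k (\<omega> c y)) \<and>
     (\<forall>c\<in>A. \<forall>v. smooth_on (cimg c) (\<lambda>y. \<omega> c y v)) \<and>
     (\<forall>c\<in>A. \<forall>b\<in>A. \<forall>p\<in>cdom c \<inter> cdom b. \<forall>v.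
        \<omega> c (coord c p) v =
        \<omega> b (coord b p) (\<lambda>i. frechet_derivative (coord b \<circ> param c) (at (coord c p)) (v i))) \<and>
     (\<forall>c y v. \<not> (c \<in> A \<and> y \<in> cimg c) \<longrightarrow> \<omega> c y v = 0)}"

text \<open>
  The chart \<open>b\<close> around the image point is arbitrary; by compatibility the value does not depend on it.
\<close>

definition pullback ::
  "('a, 'e::euclidean_space) atlas \<Rightarrow> ('b, 'f::euclidean_space) atlas \<Rightarrow> ('a \<Rightarrow> 'b) \<Rightarrow>
   ('b, 'f, 'v::real_normed_vector) form \<Rightarrow> ('a, 'e, 'v) form" where
  "pullback A B f \<omega> = (\<lambda>c y v.
     if c \<in> A \<and> y \<in> cimg c then
       (let p = f (param c y); b = (SOME b. b \<in> B \<and> p \<in> cdom b) in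
        \<omega> b (coord b p) (\<lambda>i. frechet_derivative (coord b \<circ> f \<circ> param c) (at y) (v i)))
     else 0)"

text \<open>The exterior derivative of a \<open>k\<close>-form.\<close>

definition ext_d ::
  "('a, 'e::euclidean_space) atlas \<Rightarrow> nat \<Rightarrow> ('a, 'e, 'v::real_normed_vector) form \<Rightarrow>
   ('a, 'e, 'v) form" where
  "ext_d A k \<omega> = (\<lambda>c y v.
     if c \<in> A \<and> y \<in> cimg c then
       (\<Sum>i\<le>k. (-1) ^ i *\<^sub>R
          frechet_derivative (\<lambda>z. \<omega> c z (\<lambda>j. if j < i then v j else v (Suc j))) (at y) (v i))
     else 0)"

text \<open>
  The wedge product of a \<open>k\<close>-form and an \<open>l\<close>-form along a bilinear map \<open>B\<close> on the values. It is
  the bilinear extension of \<open>(\<alpha> \<otimes> \<xi>, \<beta> \<otimes> \<eta>) \<mapsto> (\<alpha> \<and> \<beta>) \<otimes> B \<xi> \<eta>\<close>, normalised such that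
  \<open>(\<alpha> \<and> \<beta>)(v, w) = \<alpha> v * \<beta> w - \<alpha> w * \<beta> v\<close> for 1-forms.
\<close>

definition wedge_by ::
  "('u \<Rightarrow> 'v \<Rightarrow> 'w::real_vector) \<Rightarrow> nat \<Rightarrow> nat \<Rightarrow>
   ('a, 'e, 'u) form \<Rightarrow> ('a, 'e, 'v) form \<Rightarrow> ('a, 'e, 'w) form" where
  "wedge_by B k l \<alpha> \<beta> = (\<lambda>c y v.
     (1 / (fact k * fact l)) *\<^sub>R
       (\<Sum>\<sigma> | \<sigma> permutes {..<k + l}.
          of_int (sign \<sigma>) *\<^sub>R B (\<alpha> c y (\<lambda>i. v (\<sigma> i))) (\<beta> c y (\<lambda>j. v (\<sigma> (k + j))))))"


section \<open>The Lie group Sol\<close>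

definition sol_mat :: "vec3 \<Rightarrow> real^3^3" where
  "sol_mat g = vector [vector [exp (- (g$3)), 0, g$1], vector [0, exp (g$3), g$2], vector [0, 0, 1]]"

definition sol_mult :: "vec3 \<Rightarrow> vec3 \<Rightarrow> vec3" where
  "sol_mult g h = vector [g$1 + exp (- (g$3)) * h$1, g$2 + exp (g$3) * h$2, g$3 + h$3]"

lemma sol_mat_mult: "sol_mat (sol_mult g h) = sol_mat g ** sol_mat h"
proof -
  have "exp (- (a + b)) = exp (- a) * exp (- b)" for a b :: real
    using exp_add [of "- a" "- b"] by simp
  then show ?thesis
    by (simp add: sol_mat_def sol_mult_def matrix_matrix_mult_def vec_eq_iff forall_3 sum_3 exp_add)
qed

definition Sol :: "vec3 monoid" where
  "Sol = \<lparr>carrier = UNIV, mult = sol_mult, one = 0\<rparr>"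

lemma group_Sol: "group Sol"
proof (rule groupI)
  fix g assume "g \<in> carrier Sol"
  have "sol_mult (vector [- exp (g$3) * g$1, - exp (- (g$3)) * g$2, - (g$3)]) g = 0"
    by (simp add: sol_mult_def vec_eq_iff forall_3)
  then show "\<exists>h\<in>carrier Sol. h \<otimes>\<^bsub>Sol\<^esub> g = \<one>\<^bsub>Sol\<^esub>"
    unfolding Sol_def by auto
next
  fix g h k
  have "exp (- (a + b)) = exp (- a) * exp (- b)" for a b :: real
    using exp_add [of "- a" "- b"] by simp
  then show "g \<otimes>\<^bsub>Sol\<^esub> h \<otimes>\<^bsub>Sol\<^esub> k = g \<otimes>\<^bsub>Sol\<^esub> (h \<otimes>\<^bsub>Sol\<^esub> k)"
    by (simp add: Sol_def sol_mult_def vec_eq_iff forall_3 exp_add distrib_left)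
qed (simp_all add: Sol_def sol_mult_def vec_eq_iff forall_3)

definition Sol_atlas :: "(vec3, vec3) atlas" where
  "Sol_atlas = {(UNIV, id)}"

text \<open>
  The Lie algebra is the tangent space \<open>vec3\<close> at the identity \<open>0\<close>; the values there of the
  left-invariant fields \<open>X, Y, Z\<close> are the coordinate vectors.
\<close>

definition X_sol :: "vec3" where "X_sol = axis 1 1"
definition Y_sol :: "vec3" where "Y_sol = axis 2 1"
definition Z_sol :: "vec3" where "Z_sol = axis 3 1"

text \<open>The bracket with \<open>[X, Z] = X\<close>, \<open>[Y, Z] = -Y\<close> and \<open>[X, Y] = 0\<close>.\<close>

definition lie_bracket :: "vec3 \<Rightarrow> vec3 \<Rightarrow> vec3" where
  "lie_bracket \<xi> \<eta> =
     (\<xi>$1 * \<eta>$3 - \<xi>$3 * \<eta>$1) *\<^sub>R X_sol - (\<xi>$2 * \<eta>$3 - \<xi>$3 * \<eta>$2) *\<^sub>R Y_sol"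

definition p_form :: "real \<Rightarrow> vec3 \<Rightarrow> vec3 \<Rightarrow> real" where
  "p_form c \<xi> \<eta> = c * (\<xi>$3 * \<eta>$3)"

definition Ad :: "vec3 \<Rightarrow> vec3 \<Rightarrow> vec3" where
  "Ad g = frechet_derivative (\<lambda>h. sol_mult (sol_mult g h) (m_inv Sol g)) (at 0)"

text \<open>The left-invariant Maurer--Cartan form; its value at \<open>g\<close> is the derivative of left translation by the
  inverse of \<open>g\<close>.\<close>

definition mc_form :: "(vec3, vec3, vec3) form" where
  "mc_form = (\<lambda>c g v.
     if c \<in> Sol_atlas then frechet_derivative (sol_mult (m_inv Sol g)) (at g) (v 0) else 0)"

text \<open>\<open>X\<^sup>* \<and> Y\<^sup>* \<and> Z\<^sup>*\<close>, where the dual left-invariant coframe consists of the components of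
  the Maurer--Cartan form.\<close>

definition vol_Sol :: "(vec3, vec3, real) form" where
  "vol_Sol =
     wedge_by (*) 2 1
       (wedge_by (*) 1 1 (\<lambda>c g v. mc_form c g v $ 1) (\<lambda>c g v. mc_form c g v $ 2))
       (\<lambda>c g v. mc_form c g v $ 3)"


section \<open>Fundamental group and universal covering\<close>

definition path_class :: "'m::topological_space set \<Rightarrow> (real \<Rightarrow> 'm) \<Rightarrow> (real \<Rightarrow> 'm) set" where
  "path_class S a = {d. homotopic_paths S a d}"

definition class_join ::
  "'m::topological_space set \<Rightarrow> (real \<Rightarrow> 'm) set \<Rightarrow> (real \<Rightarrow> 'm) set \<Rightarrow> (real \<Rightarrow> 'm) set" where
  "class_join S \<gamma> \<delta> = {d. \<exists>a\<in>\<gamma>. \<exists>b\<in>\<delta>. homotopic_paths S (a +++ b) d}"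

definition fundamental_group :: "'m::topological_space set \<Rightarrow> 'm \<Rightarrow> (real \<Rightarrow> 'm) set monoid" where
  "fundamental_group S x0 =
     \<lparr>carrier = path_class S `
        {a. path a \<and> path_image a \<subseteq> S \<and> pathstart a = x0 \<and> pathfinish a = x0},
      mult = class_join S,
      one = path_class S (\<lambda>_. x0)\<rparr>"

text \<open>
  Points of the universal covering are homotopy classes of paths that start at \<open>x0\<close>. The
  fundamental group acts on them from the left by \<open>class_join S\<close>.
\<close>

definition endpoint :: "(real \<Rightarrow> 'm::topological_space) set \<Rightarrow> 'm" where
  "endpoint x = the_elem (pathfinish ` x)"

text \<open>The sheet through \<open>x\<close> over \<open>W\<close>: all continuations of \<open>x\<close> by paths in \<open>W\<close>.\<close>

definition sheet ::
  "'m::topological_space set \<Rightarrow> 'm set \<Rightarrow> (real \<Rightarrow> 'm) set \<Rightarrow> (real \<Rightarrow> 'm) set set" where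
  "sheet S W x =
     {path_class S (a +++ d) | a d.
        a \<in> x \<and> path d \<and> path_image d \<subseteq> W \<and> pathstart d = pathfinish a}"

text \<open>
  The charts of the universal covering are the charts of the base, lifted to the sheets over coordinate
  balls. Its points (\<open>pts\<close> of this atlas) are all homotopy classes of paths from \<open>x0\<close>.
\<close>

definition cover_atlas ::
  "('m::topological_space, 'e::euclidean_space) atlas \<Rightarrow> 'm \<Rightarrow> ((real \<Rightarrow> 'm) set, 'e) atlas" where
  "cover_atlas A x0 =
     {(sheet (pts A) W (path_class (pts A) a), coord c \<circ> endpoint) | c y r W a.
        c \<in> A \<and> r > 0 \<and> ball y r \<subseteq> cimg c \<and> W = {p\<in>cdom c. coord c p \<in> ball y r} \<and>
        path a \<and> path_image a \<subseteq> pts A \<and> pathstart a = x0 \<and> pathfinish a \<in> W}"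


section \<open>The flat bundle associated with a representation\<close>

type_synonym 'm cover_pt = "(real \<Rightarrow> 'm) set"
type_synonym 'm bundle_pt = "('m cover_pt \<times> vec3) set"

text \<open>The trivial bundle \<open>M~ \<times> G\<close> over the universal covering.\<close>

definition cover_bundle ::
  "('m::topological_space, vec3) atlas \<Rightarrow> 'm \<Rightarrow> ('m cover_pt \<times> vec3, vec3 \<times> vec3) atlas" where
  "cover_bundle A x0 = prod_atlas (cover_atlas A x0) Sol_atlas"

text \<open>The orbit relation of the action \<open>\<gamma> \<cdot> (x, g) = (\<gamma> \<cdot> x, \<rho> \<gamma> g)\<close>, and the quotient map.\<close>

definition bundle_rel ::
  "('m::topological_space, vec3) atlas \<Rightarrow> 'm \<Rightarrow> ('m cover_pt \<Rightarrow> vec3) \<Rightarrow>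
   ('m cover_pt \<times> vec3) rel" where
  "bundle_rel A x0 \<rho> =
     {((x, g), (class_join (pts A) \<gamma> x, sol_mult (\<rho> \<gamma>) g)) | x g \<gamma>.
        x \<in> pts (cover_atlas A x0) \<and> \<gamma> \<in> carrier (fundamental_group (pts A) x0)}"

definition bundle_quot ::
  "('m::topological_space, vec3) atlas \<Rightarrow> 'm \<Rightarrow> ('m cover_pt \<Rightarrow> vec3) \<Rightarrow>
   'm cover_pt \<times> vec3 \<Rightarrow> 'm bundle_pt" where
  "bundle_quot A x0 \<rho> z = bundle_rel A x0 \<rho> `` {z}"

definition flat_bundle ::
  "('m::topological_space, vec3) atlas \<Rightarrow> 'm \<Rightarrow> ('m cover_pt \<Rightarrow> vec3) \<Rightarrow>
   ('m bundle_pt, vec3 \<times> vec3) atlas" where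
  "flat_bundle A x0 \<rho> = quotient_atlas (cover_bundle A x0) (bundle_quot A x0 \<rho>)"

definition bundle_proj :: "'m::topological_space bundle_pt \<Rightarrow> 'm" where
  "bundle_proj P = the_elem ((\<lambda>(x, g). endpoint x) ` P)"

text \<open>The principal right action \<open>[x, g] \<cdot> h = [x, g h]\<close>.\<close>

definition right_act :: "vec3 \<Rightarrow> 'm::topological_space bundle_pt \<Rightarrow> 'm bundle_pt" where
  "right_act h P = (\<lambda>(x, g). (x, sol_mult g h)) ` P"

definition smooth_section ::
  "('m::topological_space, vec3) atlas \<Rightarrow> 'm \<Rightarrow> ('m cover_pt \<Rightarrow> vec3) \<Rightarrow> ('m \<Rightarrow> 'm bundle_pt) \<Rightarrow> bool"
  where
  "smooth_section A x0 \<rho> s \<longleftrightarrow>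
     smooth_map A (flat_bundle A x0 \<rho>) s \<and> (\<forall>p\<in>pts A. bundle_proj (s p) = p)"

text \<open>
  Connections are Lie algebra valued 1-forms on the total space. The last condition says that \<open>\<omega>\<close> sends
  the fundamental vector of \<open>\<xi>\<close> at \<open>P\<close>, which is the image of \<open>\<xi>\<close> under the derivative at the
  identity \<open>0\<close> of the orbit map \<open>h \<mapsto> P \<cdot> h\<close>, to \<open>\<xi>\<close>.
\<close>

definition is_connection ::
  "('m::topological_space, vec3) atlas \<Rightarrow> 'm \<Rightarrow> ('m cover_pt \<Rightarrow> vec3) \<Rightarrow>
   ('m bundle_pt, vec3 \<times> vec3, vec3) form \<Rightarrow> bool" where
  "is_connection A x0 \<rho> \<omega> \<longleftrightarrow>
     \<omega> \<in> forms (flat_bundle A x0 \<rho>) 1 \<and>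
     (\<forall>h. pullback (flat_bundle A x0 \<rho>) (flat_bundle A x0 \<rho>) (right_act h) \<omega> =
          (\<lambda>c y v. Ad (m_inv Sol h) (\<omega> c y v))) \<and>
     (\<forall>P\<in>pts (flat_bundle A x0 \<rho>). \<forall>\<xi>.
          pullback Sol_atlas (flat_bundle A x0 \<rho>) (\<lambda>h. right_act h P) \<omega> (UNIV, id) 0 (\<lambda>_. \<xi>) = \<xi>)"

text \<open>The form on the flat bundle obtained from a form on \<open>M~ \<times> G\<close> by descent.\<close>

definition descend ::
  "('m::topological_space, vec3) atlas \<Rightarrow> 'm \<Rightarrow> ('m cover_pt \<Rightarrow> vec3) \<Rightarrow> nat \<Rightarrow>
   ('m cover_pt \<times> vec3, vec3 \<times> vec3, 'v::real_normed_vector) form \<Rightarrow>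
   ('m bundle_pt, vec3 \<times> vec3, 'v) form" where
  "descend A x0 \<rho> k \<theta> =
     (THE \<eta>. \<eta> \<in> forms (flat_bundle A x0 \<rho>) k \<and>
        pullback (cover_bundle A x0) (flat_bundle A x0 \<rho>) (bundle_quot A x0 \<rho>) \<eta> = \<theta>)"

definition flat_connection ::
  "('m::topological_space, vec3) atlas \<Rightarrow> 'm \<Rightarrow> ('m cover_pt \<Rightarrow> vec3) \<Rightarrow>
   ('m bundle_pt, vec3 \<times> vec3, vec3) form" where
  "flat_connection A x0 \<rho> =
     descend A x0 \<rho> 1 (pullback (cover_bundle A x0) Sol_atlas snd mc_form)"

definition vol_bundle ::
  "('m::topological_space, vec3) atlas \<Rightarrow> 'm \<Rightarrow> ('m cover_pt \<Rightarrow> vec3) \<Rightarrow>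
   ('m bundle_pt, vec3 \<times> vec3, real) form" where
  "vol_bundle A x0 \<rho> =
     descend A x0 \<rho> 3 (pullback (cover_bundle A x0) Sol_atlas snd vol_Sol)"

text \<open>The connection \<open>\<omega>\<^sup>s\<close> with \<open>s\<^sup>*\<omega>\<^sup>s = (\<alpha> + \<beta>) Z\<close>, where
  \<open>s\<^sup>*\<omega>\<^sub>\<rho> = \<alpha> X + \<beta> Y + \<gamma> Z\<close>.\<close>

definition is_aux_connection ::
  "('m::topological_space, vec3) atlas \<Rightarrow> 'm \<Rightarrow> ('m cover_pt \<Rightarrow> vec3) \<Rightarrow> ('m \<Rightarrow> 'm bundle_pt) \<Rightarrow>
   ('m bundle_pt, vec3 \<times> vec3, vec3) form \<Rightarrow> bool" where
  "is_aux_connection A x0 \<rho> s \<omega> \<longleftrightarrow>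
     is_connection A x0 \<rho> \<omega> \<and>
     (\<exists>\<alpha>\<in>forms A 1. \<exists>\<beta>\<in>forms A 1. \<exists>\<gamma>\<in>forms A 1.
        pullback A (flat_bundle A x0 \<rho>) s (flat_connection A x0 \<rho>) =
          (\<lambda>c y v. \<alpha> c y v *\<^sub>R X_sol + \<beta> c y v *\<^sub>R Y_sol + \<gamma> c y v *\<^sub>R Z_sol) \<and>
        pullback A (flat_bundle A x0 \<rho>) s \<omega> = (\<lambda>c y v. (\<alpha> c y v + \<beta> c y v) *\<^sub>R Z_sol))"


section \<open>The Chern--Simons form of a pair of connections\<close>

text \<open>
  A form on \<open>M\<close> with values in the adjoint bundle is a horizontal equivariant Lie algebra
  valued form on the total space. Accordingly the defining expression is formed on the total space, where it is
  basic, and the Chern--Simons form is the form on \<open>M\<close> whose pullback it is.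
\<close>

definition curvature ::
  "('a, 'e::euclidean_space) atlas \<Rightarrow> ('a, 'e, vec3) form \<Rightarrow> ('a, 'e, vec3) form" where
  "curvature P \<omega> = (\<lambda>c y v.
     ext_d P 1 \<omega> c y v + (1/2) *\<^sub>R wedge_by lie_bracket 1 1 \<omega> \<omega> c y v)"

definition CS_total ::
  "('a, 'e::euclidean_space) atlas \<Rightarrow> (vec3 \<Rightarrow> vec3 \<Rightarrow> real) \<Rightarrow>
   ('a, 'e, vec3) form \<Rightarrow> ('a, 'e, vec3) form \<Rightarrow> ('a, 'e, real) form" where
  "CS_total P p \<omega>1 \<omega>0 =
     (let a = (\<lambda>c y v. \<omega>1 c y v - \<omega>0 c y v);
          da = (\<lambda>c y v. ext_d P 1 a c y v + wedge_by lie_bracket 1 1 \<omega>0 a c y v)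
      in (\<lambda>c y v.
            wedge_by p 1 2 a da c y v
            + (1/3) * wedge_by p 1 2 a (wedge_by lie_bracket 1 1 a a) c y v
            + 2 * wedge_by p 1 2 a (curvature P \<omega>0) c y v))"

definition CS ::
  "('m::topological_space, vec3) atlas \<Rightarrow> 'm \<Rightarrow> ('m cover_pt \<Rightarrow> vec3) \<Rightarrow>
   (vec3 \<Rightarrow> vec3 \<Rightarrow> real) \<Rightarrow>
   ('m bundle_pt, vec3 \<times> vec3, vec3) form \<Rightarrow>
   ('m bundle_pt, vec3 \<times> vec3, vec3) form \<Rightarrow> ('m, vec3, real) form" where
  "CS A x0 \<rho> p \<omega>1 \<omega>0 =
     (THE \<eta>. \<eta> \<in> forms A 3 \<and>
        pullback (flat_bundle A x0 \<rho>) A bundle_proj \<eta> = CS_total (flat_bundle A x0 \<rho>) p \<omega>1 \<omega>0)"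

end

theory Submission
  imports Defs
begin

text \<open>
  The form \<open>p\<^sub>c\<close> sees only the \<open>Z\<close>-components, and these are simple: a bracket has none, \<open>Ad\<close> preserves
  them, and that of \<open>\<omega>\<^sub>\<rho>\<close> is closed. Hence \<open>CS(\<omega>\<^sup>s, \<omega>\<^sub>\<rho>) = c \<delta> \<and> d\<delta>\<close>, where \<open>\<delta> = \<alpha> + \<beta> - \<gamma>\<close> is
  the \<open>Z\<close>-component of \<open>s\<^sup>*(\<omega>\<^sup>s - \<omega>\<^sub>\<rho>)\<close>. Flatness of \<open>\<omega>\<^sub>\<rho>\<close> gives \<open>d\<alpha> = - \<alpha> \<and> \<gamma>\<close>, \<open>d\<beta> = \<beta> \<and> \<gamma>\<close> and
  \<open>d\<gamma> = 0\<close>, so that \<open>\<delta> \<and> d\<delta> = 2 \<alpha> \<and> \<beta> \<and> \<gamma> = 2 s\<^sup>*vol\<^sub>\<rho>\<close>.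

  In the charts of the flat bundle, which are a coordinate ball of the base times Sol, the transition maps
  are a transition map of the base times a left translation. Left-invariant forms on Sol therefore define
  forms on the bundle.
\<close>


section \<open>Homotopy classes of paths and sheets\<close>

text \<open>Both \<open>descend\<close> and \<open>CS\<close> are definite descriptions, so each of
  them needs two arguments: an explicit form satisfies the defining condition, and the condition
  leaves no other choice. Both are settled chart by chart, which is why the charts of the quotient
  bundle are made explicit first. Local triviality rests on convexity of coordinate balls: two paths
  inside a ball with the same ends are homotopic.

  In a chart the section is the graph of a map G into Sol, and \<alpha> = exp(G3) dG1, \<beta> =
  exp(-G3) dG2, \<gamma> = dG3. The structure equations thereby reduce to the symmetry of second
  derivatives. Only first derivatives of G are taken from the section; the second ones come from the
  smoothness of \<alpha>, \<beta>, \<gamma>.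

  The factor 2 comes from the sum \<alpha> + \<beta>: d\<alpha> and d\<beta> carry opposite signs,
  so \<alpha> \<and> d\<beta> and \<beta> \<and> d\<alpha> do not cancel but are both equal to
  \<alpha> \<and> \<beta> \<and> \<gamma>. All other terms of \<delta> \<and> d\<delta> contain a
  repeated factor.\<close>

definition based_path :: "'m::topological_space set \<Rightarrow> 'm \<Rightarrow> (real \<Rightarrow> 'm) \<Rightarrow> bool" where
  "based_path S x a \<longleftrightarrow> path a \<and> path_image a \<subseteq> S \<and> pathstart a = x"

text \<open>The interval [0, 1] is convex, so \<open>f\<close> and \<open>g\<close> are joined by
  the straight-line homotopy, which \<open>p\<close> carries into \<open>S\<close>. The unit and
  inverse laws below are instances with piecewise linear \<open>f\<close> and \<open>g\<close>, and
  so hold in every topological space.\<close>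

lemma homotopic_paths_compose_unit_interval:
  fixes p :: "real \<Rightarrow> 'm::topological_space" and f g :: "real \<Rightarrow> real"
  assumes p: "path p" "path_image p \<subseteq> S"
    and f: "path f" "path_image f \<subseteq> {0..1}" and g: "path g" "path_image g \<subseteq> {0..1}"
    and "pathstart f = pathstart g" "pathfinish f = pathfinish g"
  shows "homotopic_paths S (p \<circ> f) (p \<circ> g)"
proof (rule homotopic_paths_continuous_image)
  have "f t \<in> {0..1}" "g t \<in> {0..1}" if "t \<in> {0..1}" for t
    using that f g unfolding path_image_def by blast+
  then show "homotopic_paths {0..1} f g"
    using assms by (intro homotopic_paths_linear closed_segment_subset) auto
  show "continuous_on {0..1} p" using p by (simp add: path_def)
  show "p \<in> {0..1} \<rightarrow> S" using p by (auto simp: path_image_def)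
qed

lemma homotopic_paths_const_right:
  fixes p :: "real \<Rightarrow> 'm::topological_space"
  assumes p: "path p" "path_image p \<subseteq> S"
  shows "homotopic_paths S (p +++ (\<lambda>_. pathfinish p)) p"
proof -
  have "homotopic_paths S (p \<circ> (linepath 0 1 +++ linepath 1 1)) (p \<circ> linepath 0 1)"
    using p by (intro homotopic_paths_compose_unit_interval)
      (auto simp: path_image_join closed_segment_eq_real_ivl)
  moreover have "p \<circ> linepath 0 1 = p" by (auto simp: linepath_def)
  moreover have "p \<circ> linepath 1 1 = (\<lambda>_. pathfinish p)"
    by (auto simp: linepath_def pathfinish_def)
  ultimately show ?thesis by (simp add: path_compose_join)
qed

lemma homotopic_paths_reverse_right:
  fixes p :: "real \<Rightarrow> 'm::topological_space"
  assumes p: "path p" "path_image p \<subseteq> S"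
  shows "homotopic_paths S (p +++ reversepath p) (\<lambda>_. pathstart p)"
proof -
  \<comment> \<open>Out along \<open>p\<close> and back: the parameter runs from 0 to 1 to 0 and
    contracts inside the interval to the constant 0.\<close>
  have "homotopic_paths S (p \<circ> (linepath 0 1 +++ linepath 1 0)) (p \<circ> linepath 0 0)"
    using p by (intro homotopic_paths_compose_unit_interval)
      (auto simp: path_image_join closed_segment_eq_real_ivl)
  moreover have "p \<circ> linepath 0 1 = p" "p \<circ> linepath 1 0 = reversepath p"
    by (auto simp: linepath_def reversepath_def)
  moreover have "p \<circ> linepath 0 0 = (\<lambda>_. pathstart p)"
    by (auto simp: linepath_def pathstart_def)
  ultimately show ?thesis by (simp add: path_compose_join)
qed

lemma homotopic_paths_reverse_left:
  fixes p :: "real \<Rightarrow> 'm::topological_space"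
  assumes "path p" "path_image p \<subseteq> S"
  shows "homotopic_paths S (reversepath p +++ p) (\<lambda>_. pathfinish p)"
  using homotopic_paths_reverse_right [of "reversepath p" S] assms by simp

lemma homotopic_paths_const_left:
  fixes p :: "real \<Rightarrow> 'm::topological_space"
  assumes p: "path p" "path_image p \<subseteq> S"
  shows "homotopic_paths S ((\<lambda>_. pathstart p) +++ p) p"
proof -
  have "homotopic_paths S (p \<circ> (linepath 0 0 +++ linepath 0 1)) (p \<circ> linepath 0 1)"
    using p by (intro homotopic_paths_compose_unit_interval)
      (auto simp: path_image_join closed_segment_eq_real_ivl)
  moreover have "p \<circ> linepath 0 1 = p" by (auto simp: linepath_def)
  moreover have "p \<circ> linepath 0 0 = (\<lambda>_. pathstart p)"
    by (auto simp: linepath_def pathstart_def)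
  ultimately show ?thesis by (simp add: path_compose_join)
qed

lemma path_const_fun: "path (\<lambda>_. x)" by (simp add: path_def)

lemma path_ends_const_fun [simp]: "pathstart (\<lambda>_. x) = x" "pathfinish (\<lambda>_. x) = x"
  by (simp_all add: pathstart_def pathfinish_def)

text \<open>The class of a function that is not a path in \<open>S\<close> is empty; the hypotheses
  put \<open>a\<close> into its own class.\<close>

lemma path_class_eq_iff:
  assumes "path a" "path_image a \<subseteq> S"
  shows "path_class S a = path_class S b \<longleftrightarrow> homotopic_paths S a b"
proof
  assume "path_class S a = path_class S b"
  moreover have "a \<in> path_class S a" using assms by (simp add: path_class_def)
  ultimately show "homotopic_paths S a b"
    by (simp add: path_class_def homotopic_paths_sym)
next
  assume h: "homotopic_paths S a b"
  show "path_class S a = path_class S b"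
    unfolding path_class_def
    using homotopic_paths_trans [OF h] homotopic_paths_trans [OF homotopic_paths_sym [OF h]] by blast
qed

lemma path_class_self: "path a \<Longrightarrow> path_image a \<subseteq> S \<Longrightarrow> a \<in> path_class S a"
  by (simp add: path_class_def)

lemma endpoint_path_class:
  assumes "path a" "path_image a \<subseteq> S"
  shows "endpoint (path_class S a) = pathfinish a"
proof -
  have "pathfinish ` path_class S a = {pathfinish a}"
    using path_class_self [OF assms]
    by (auto simp: path_class_def dest: homotopic_paths_imp_pathfinish)
  then show ?thesis by (simp add: endpoint_def)
qed

lemma path_class_join_cong:
  assumes "homotopic_paths S a a'" "homotopic_paths S b b'" "pathfinish a = pathstart b"
  shows "path_class S (a +++ b) = path_class S (a' +++ b')"
proof -
  have h: "homotopic_paths S (a +++ b) (a' +++ b')"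
    using assms by (rule homotopic_paths_join)
  then show ?thesis
    using path_class_eq_iff homotopic_paths_imp_path homotopic_paths_imp_subset by metis
qed

lemma class_join_path_class:
  assumes a: "path a" "path_image a \<subseteq> S" and b: "path b" "path_image b \<subseteq> S"
    and "pathfinish a = pathstart b"
  shows "class_join S (path_class S a) (path_class S b) = path_class S (a +++ b)"
proof -
  have "homotopic_paths S (a +++ b) d"
    if "homotopic_paths S a a'" "homotopic_paths S b b'" "homotopic_paths S (a' +++ b') d" for a' b' d
    using homotopic_paths_join [OF that(1,2) assms(5)] that(3) by (rule homotopic_paths_trans)
  moreover have "homotopic_paths S a a" "homotopic_paths S b b" using a b by simp_all
  ultimately show ?thesis
    unfolding class_join_def path_class_def by blast
qed

lemma path_class_join_assoc:
  assumes "path a" "path_image a \<subseteq> S" "path b" "path_image b \<subseteq> S" "path d" "path_image d \<subseteq> S"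
    and "pathfinish a = pathstart b" "pathfinish b = pathstart d"
  shows "path_class S ((a +++ b) +++ d) = path_class S (a +++ (b +++ d))"
  using assms homotopic_paths_sym [OF homotopic_paths_assoc [of a S b d]]
  by (subst path_class_eq_iff) (auto simp: subset_path_image_join)

text \<open>The definition of \<open>sheet\<close> continues every representative of the class.
  Homotopic representatives have the same end and the same continuations up to homotopy, so one
  representative can be fixed.\<close>

lemma sheet_path_class:
  assumes a: "path a" "path_image a \<subseteq> S" and W: "W \<subseteq> S"
  shows "sheet S W (path_class S a) =
    {path_class S (a +++ d) | d. path d \<and> path_image d \<subseteq> W \<and> pathstart d = pathfinish a}"
proof -
  have "path_class S (a' +++ d) = path_class S (a +++ d)" "pathfinish a' = pathfinish a"
    if "a' \<in> path_class S a" "path d" "path_image d \<subseteq> W" "pathstart d = pathfinish a'" for a' d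
  proof -
    have h: "homotopic_paths S a' a"
      using that by (simp add: path_class_def homotopic_paths_sym)
    show "path_class S (a' +++ d) = path_class S (a +++ d)"
      by (rule path_class_join_cong) (use h that W in auto)
    show "pathfinish a' = pathfinish a" using h by (rule homotopic_paths_imp_pathfinish)
  qed
  then show ?thesis
    unfolding sheet_def using path_class_self [OF a] by (intro Collect_cong) metis
qed


section \<open>The group structure of Sol\<close>

lemma sol_mult_assoc: "sol_mult (sol_mult g h) k = sol_mult g (sol_mult h k)"
  using monoid.m_assoc [OF group.is_monoid [OF group_Sol], of g h k] by (simp add: Sol_def)

lemma sol_mult_0 [simp]: "sol_mult 0 g = g" "sol_mult g 0 = g"
  by (simp_all add: sol_mult_def vec_eq_iff forall_3)

lemma sol_inv_mult: "sol_mult (m_inv Sol g) g = 0" "sol_mult g (m_inv Sol g) = 0"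
  using group.l_inv [OF group_Sol, of g] group.r_inv [OF group_Sol, of g]
  by (simp_all add: Sol_def)

text \<open>Membership in \<open>hom\<close> gives multiplicativity only; that \<rho> sends the
  trivial class to 0 follows because its value there is idempotent.\<close>

lemma sol_mult_idem:
  assumes "sol_mult g g = g" shows "g = 0"
proof -
  have "sol_mult (m_inv Sol g) (sol_mult g g) = 0" using assms sol_inv_mult by simp
  then show ?thesis by (simp add: sol_mult_assoc [symmetric] sol_inv_mult)
qed

section \<open>Charts of the flat bundle\<close>

locale flat_data =
  fixes A :: "('m::topological_space, vec3) atlas"
    and x0 :: 'm
    and \<rho> :: "'m cover_pt \<Rightarrow> vec3"
  assumes manifold: "closed_oriented_3manifold A"
    and base_point: "x0 \<in> pts A"
    and hom: "\<rho> \<in> hom (fundamental_group (pts A) x0) Sol"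
begin

abbreviation cls :: "(real \<Rightarrow> 'm) \<Rightarrow> 'm cover_pt" where "cls \<equiv> path_class (pts A)"
abbreviation based :: "(real \<Rightarrow> 'm) \<Rightarrow> bool" where "based \<equiv> based_path (pts A) x0"
abbreviation loop :: "(real \<Rightarrow> 'm) \<Rightarrow> bool" where "loop l \<equiv> based l \<and> pathfinish l = x0"
abbreviation q :: "'m cover_pt \<times> vec3 \<Rightarrow> 'm bundle_pt" where "q \<equiv> bundle_quot A x0 \<rho>"
abbreviation P :: "('m bundle_pt, vec3 \<times> vec3) atlas" where "P \<equiv> flat_bundle A x0 \<rho>"

section \<open>Charts of the base manifold\<close>

lemma manifold_chart:
  assumes "d \<in> A"
  shows open_cimg: "open (cimg d)"
    and openin_cdom: "openin (top_of_set (pts A)) (cdom d)"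
    and homeo: "homeomorphism (cdom d) (cimg d) (coord d) (param d)"
  using manifold assms unfolding closed_oriented_3manifold_def by blast+

lemma param_coord [simp]: "d \<in> A \<Longrightarrow> p \<in> cdom d \<Longrightarrow> param d (coord d p) = p"
  and coord_param [simp]: "d \<in> A \<Longrightarrow> u \<in> cimg d \<Longrightarrow> coord d (param d u) = u"
  and param_in [simp]: "d \<in> A \<Longrightarrow> u \<in> cimg d \<Longrightarrow> param d u \<in> cdom d"
  and coord_in: "d \<in> A \<Longrightarrow> p \<in> cdom d \<Longrightarrow> coord d p \<in> cimg d"
  and continuous_param: "d \<in> A \<Longrightarrow> continuous_on (cimg d) (param d)"
  and continuous_coord: "d \<in> A \<Longrightarrow> continuous_on (cdom d) (coord d)"
  using homeo [of d] unfolding homeomorphism_def by blast+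

lemma cdom_subset: "d \<in> A \<Longrightarrow> cdom d \<subseteq> pts A"
  by (auto simp: pts_def)

lemma param_image:
  assumes "d \<in> A" "B \<subseteq> cimg d"
  shows "param d ` B = {p \<in> cdom d. coord d p \<in> B}"
proof
  show "{p \<in> cdom d. coord d p \<in> B} \<subseteq> param d ` B"
    using assms by (clarsimp simp: image_iff) (metis param_coord)
qed (use assms in auto)

text \<open>Chart domains are open relative to \<open>pts A\<close> only. The chart, a homeomorphism
  onto an open set, turns this into openness in \<open>vec3\<close>, where derivatives are
  taken.\<close>

lemma open_overlap:
  assumes "d \<in> A" "e \<in> A"
  shows "open (coord d ` (cdom d \<inter> cdom e))"
proof -
  have "openin (top_of_set (pts A)) (cdom d \<inter> cdom e)"
    using assms by (intro openin_Int openin_cdom)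
  then have "openin (top_of_set (cdom d)) (cdom d \<inter> cdom e)"
    using cdom_subset [OF assms(1)] by (meson inf_le1 openin_subset_trans)
  then have "openin (top_of_set (cimg d)) (coord d ` (cdom d \<inter> cdom e))"
    using homeo [OF assms(1)] homeomorphism_imp_open_map by blast
  then show ?thesis using open_cimg [OF assms(1)] by (rule openin_open_trans)
qed

section \<open>Based paths and the orbits of the fundamental group\<close>

lemma based_cls:
  assumes "based b"
  shows "endpoint (cls b) = pathfinish b" "b \<in> cls b"
  using assms by (auto simp: based_path_def endpoint_path_class path_class_self)

lemma cls_eq_iff: "based a \<Longrightarrow> cls a = cls b \<longleftrightarrow> homotopic_paths (pts A) a b"
  by (simp add: based_path_def path_class_eq_iff)

lemma based_join:
  assumes "based a" "path d" "path_image d \<subseteq> pts A" "pathstart d = pathfinish a"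
  shows "based (a +++ d)"
  using assms by (auto simp: based_path_def path_image_join)

lemma loop_const: "loop (\<lambda>_. x0)"
  using base_point by (auto simp: based_path_def path_const_fun path_image_def)

lemma loop_reverse: "loop l \<Longrightarrow> loop (reversepath l)"
  by (auto simp: based_path_def)

lemma carrier_fundamental_group: "carrier (fundamental_group (pts A) x0) = cls ` {l. loop l}"
  by (auto simp: fundamental_group_def based_path_def)

lemma rho_join:
  assumes "loop l" "loop m"
  shows "\<rho> (cls (l +++ m)) = sol_mult (\<rho> (cls l)) (\<rho> (cls m))"
proof -
  have "cls l \<in> carrier (fundamental_group (pts A) x0)" "cls m \<in> carrier (fundamental_group (pts A) x0)"
    unfolding carrier_fundamental_group using assms by blast+
  then have "\<rho> (class_join (pts A) (cls l) (cls m)) = sol_mult (\<rho> (cls l)) (\<rho> (cls m))"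
    using hom_mult [OF hom] by (simp add: fundamental_group_def Sol_def)
  then show ?thesis using assms by (simp add: class_join_path_class based_path_def)
qed

lemma rho_const: "\<rho> (cls (\<lambda>_. x0)) = 0"
proof (rule sol_mult_idem)
  have "cls ((\<lambda>_. x0) +++ (\<lambda>_. x0)) = cls (\<lambda>_. x0)"
    using homotopic_paths_const_right [of "\<lambda>_. x0" "pts A"] loop_const
    by (subst cls_eq_iff) (auto simp: based_path_def path_const_fun path_image_join)
  then show "sol_mult (\<rho> (cls (\<lambda>_. x0))) (\<rho> (cls (\<lambda>_. x0))) = \<rho> (cls (\<lambda>_. x0))"
    using rho_join [OF loop_const loop_const] by simp
qed

lemma cls_join_assoc:
  assumes "loop l" "based b" "path d" "path_image d \<subseteq> pts A" "pathstart d = pathfinish b"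
  shows "cls ((l +++ b) +++ d) = cls (l +++ (b +++ d))"
  using assms by (intro path_class_join_assoc) (auto simp: based_path_def)

lemma cls_join_cong:
  assumes "based b" "cls b = cls b'" "path d" "path_image d \<subseteq> pts A" "pathstart d = pathfinish b"
  shows "cls (b +++ d) = cls (b' +++ d)"
  using assms by (intro path_class_join_cong) (auto simp: cls_eq_iff based_path_def)

lemma cls_join_cong_right:
  assumes "loop l" "based b" "cls b = cls b'"
  shows "cls (l +++ b) = cls (l +++ b')"
  using assms by (intro path_class_join_cong) (auto simp: cls_eq_iff based_path_def)

lemma cls_reverse_left:
  assumes "loop l" "based b"
  shows "cls (reversepath l +++ (l +++ b)) = cls b"
proof -
  have "cls (reversepath l +++ (l +++ b)) = cls ((reversepath l +++ l) +++ b)"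
    using assms by (intro cls_join_assoc [symmetric] loop_reverse) (auto simp: based_path_def)
  also have "\<dots> = cls ((\<lambda>_. x0) +++ b)"
    using assms homotopic_paths_reverse_left [of l "pts A"]
    by (intro path_class_join_cong) (auto simp: based_path_def)
  also have "\<dots> = cls b"
    using assms homotopic_paths_const_left [of b "pts A"]
    by (metis based_path_def homotopic_paths_sym path_class_eq_iff)
  finally show ?thesis .
qed

lemma bundle_quot_cls:
  assumes b: "based b"
  shows "q (cls b, g) = {(cls (l +++ b), sol_mult (\<rho> (cls l)) g) | l. loop l}"
proof -
  \<comment> \<open>\<open>bundle_rel\<close> relates only points of the cover atlas, so a sheet
    through \<open>cls b\<close> is needed: the one over a small ball around the endpoint, which
    contains \<open>cls b\<close> by way of the constant continuation.\<close>
  have U: "cls b \<in> pts (cover_atlas A x0)"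
  proof -
    have "pathfinish b \<in> pts A" using b by (auto simp: based_path_def)
    then obtain d where d: "d \<in> A" "pathfinish b \<in> cdom d" by (auto simp: pts_def)
    then obtain r where r: "r > 0" "ball (coord d (pathfinish b)) r \<subseteq> cimg d"
      using open_cimg coord_in openE by metis
    define W where "W = {p \<in> cdom d. coord d p \<in> ball (coord d (pathfinish b)) r}"
    have W: "W \<subseteq> pts A" "pathfinish b \<in> W" using d r cdom_subset [of d] by (auto simp: W_def)
    have "cls (b +++ (\<lambda>_. pathfinish b)) \<in> sheet (pts A) W (cls b)"
      using W b by (subst sheet_path_class)
        (auto simp: based_path_def path_image_def intro!: path_const_fun exI [of _ "\<lambda>_. pathfinish b"])
    moreover have "cls (b +++ (\<lambda>_. pathfinish b)) = cls b"
      using homotopic_paths_const_right [of b "pts A"] b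
      by (metis based_path_def homotopic_paths_sym path_class_eq_iff)
    moreover have "(sheet (pts A) W (cls b), coord d \<circ> endpoint) \<in> cover_atlas A x0"
      using d r W b unfolding cover_atlas_def W_def based_path_def by blast
    ultimately show ?thesis unfolding pts_def cdom_def by force
  qed
  have "class_join (pts A) (cls l) (cls b) = cls (l +++ b)" if "loop l" for l
    using that b by (simp add: class_join_path_class based_path_def)
  then show ?thesis
    unfolding bundle_quot_def bundle_rel_def carrier_fundamental_group
    using U by (auto simp: Image_def) 
qed

lemma bundle_quot_self:
  assumes "based b"
  shows "(cls b, g) \<in> q (cls b, g)"
proof -
  have "cls ((\<lambda>_. x0) +++ b) = cls b"
    using assms homotopic_paths_const_left [of b "pts A"]
    by (metis based_path_def homotopic_paths_sym path_class_eq_iff)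
  then show ?thesis
    unfolding bundle_quot_cls [OF assms]
    by (auto simp: rho_const loop_const intro!: exI [of _ "\<lambda>_. x0"])
qed

text \<open>One inclusion is enough: the other one is the same statement for
  \<open>reversepath l\<close> with \<open>b\<close> and \<open>b'\<close> exchanged. For this
  exchange \<open>b'\<close> is an arbitrary representative and not literally
  \<open>l +++ b\<close>.\<close>

lemma bundle_quot_act_subset:
  assumes l: "loop l" and b: "based b" and b': "based b'" "cls b' = cls (l +++ b)"
  shows "q (cls b', sol_mult (\<rho> (cls l)) g) \<subseteq> q (cls b, g)"
proof -
  have "cls (m +++ b') = cls ((m +++ l) +++ b)"
    "sol_mult (\<rho> (cls m)) (sol_mult (\<rho> (cls l)) g) = sol_mult (\<rho> (cls (m +++ l))) g"
    "loop (m +++ l)" if m: "loop m" for m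
  proof -
    have "cls ((m +++ l) +++ b) = cls (m +++ (l +++ b))"
      using m l b by (intro cls_join_assoc) (auto simp: based_path_def)
    then show "cls (m +++ b') = cls ((m +++ l) +++ b)"
      using cls_join_cong_right [OF m b'] by simp
    show "sol_mult (\<rho> (cls m)) (sol_mult (\<rho> (cls l)) g) = sol_mult (\<rho> (cls (m +++ l))) g"
      using m l by (simp add: rho_join sol_mult_assoc)
    show "loop (m +++ l)" using m l by (auto simp: based_path_def path_image_join)
  qed
  then show ?thesis
    unfolding bundle_quot_cls [OF b] bundle_quot_cls [OF b'(1)] by blast
qed

lemma bundle_quot_eq_iff:
  assumes b: "based b" and b': "based b'"
  shows "q (cls b, g) = q (cls b', g') \<longleftrightarrow>
    (\<exists>l. loop l \<and> cls b' = cls (l +++ b) \<and> g' = sol_mult (\<rho> (cls l)) g)"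
proof
  assume "q (cls b, g) = q (cls b', g')"
  then have "(cls b', g') \<in> q (cls b, g)" using bundle_quot_self [OF b'] by blast
  then show "\<exists>l. loop l \<and> cls b' = cls (l +++ b) \<and> g' = sol_mult (\<rho> (cls l)) g"
    unfolding bundle_quot_cls [OF b] by auto
next
  assume "\<exists>l. loop l \<and> cls b' = cls (l +++ b) \<and> g' = sol_mult (\<rho> (cls l)) g"
  then obtain l where l: "loop l" and e: "cls b' = cls (l +++ b)" and g': "g' = sol_mult (\<rho> (cls l)) g"
    by blast
  have "cls (reversepath l +++ b') = cls (reversepath l +++ (l +++ b))"
    using loop_reverse [OF l] b' e by (rule cls_join_cong_right)
  then have e': "cls b = cls (reversepath l +++ b')" using cls_reverse_left [OF l b] by simp
  have "cls (reversepath l +++ l) = cls (\<lambda>_. x0)"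
    using l homotopic_paths_reverse_left [of l "pts A"]
    by (metis based_path_def homotopic_paths_sym path_class_eq_iff
        homotopic_paths_imp_path homotopic_paths_imp_subset)
  then have "sol_mult (\<rho> (cls (reversepath l))) (\<rho> (cls l)) = 0"
    using rho_join [OF loop_reverse [OF l] l] rho_const by simp
  then have g: "g = sol_mult (\<rho> (cls (reversepath l))) g'"
    unfolding g' sol_mult_assoc [symmetric] by simp
  show "q (cls b, g) = q (cls b', g')"
  proof
    show "q (cls b, g) \<subseteq> q (cls b', g')"
      using bundle_quot_act_subset [OF loop_reverse [OF l] b' b e', of g'] unfolding g [symmetric] .
    show "q (cls b', g') \<subseteq> q (cls b, g)"
      using bundle_quot_act_subset [OF l b b' e, of g] unfolding g' [symmetric] .
  qed
qed

text \<open>Prepending a loop does not move the end of a path, so the endpoints over one orbit form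
  a singleton and \<open>the_elem\<close> is meaningful.\<close>

lemma bundle_proj_quot:
  assumes "based b" shows "bundle_proj (q (cls b, g)) = pathfinish b"
proof -
  have "endpoint (cls (l +++ b)) = pathfinish b" if "loop l" for l
    using that assms by (subst based_cls) (auto simp: based_path_def path_image_join)
  then have "endpoint (fst z) = pathfinish b" if "z \<in> q (cls b, g)" for z
    using that unfolding bundle_quot_cls [OF assms] by auto
  then have "(\<lambda>(x, g). endpoint x) ` q (cls b, g) = {pathfinish b}"
    using bundle_quot_self [OF assms, of g] by (force simp: image_iff)
  then show ?thesis by (simp add: bundle_proj_def)
qed

lemma right_act_quot:
  assumes "based b" shows "right_act h (q (cls b, g)) = q (cls b, sol_mult g h)"
  unfolding right_act_def bundle_quot_cls [OF assms]
  by (force simp: sol_mult_assoc image_iff)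

text \<open>The data \<open>d\<close>, \<open>B\<close>, \<open>X\<close> are the chart of the base, the coordinate ball and the sheet.\<close>

definition bundle_sheet :: "('m, vec3) chart \<Rightarrow> vec3 set \<Rightarrow> 'm cover_pt set \<Rightarrow> bool" where
  "bundle_sheet d B X \<longleftrightarrow> d \<in> A \<and> B \<subseteq> cimg d \<and> (\<exists>y r. r > 0 \<and> B = ball y r) \<and>
     (\<exists>a. based a \<and> pathfinish a \<in> param d ` B \<and> X = sheet (pts A) (param d ` B) (cls a))"

definition bundle_chart ::
  "('m bundle_pt, vec3 \<times> vec3) chart \<Rightarrow> ('m, vec3) chart \<Rightarrow> vec3 set \<Rightarrow> 'm cover_pt set \<Rightarrow> bool" where
  "bundle_chart c d B X \<longleftrightarrow> bundle_sheet d B X \<and>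
     c = (q ` (X \<times> UNIV), map_prod (coord d \<circ> endpoint) id \<circ> inv_into (X \<times> UNIV) q)"

section \<open>Sheets over coordinate balls\<close>

lemma bundle_sheetD:
  assumes "bundle_sheet d B X"
  shows "d \<in> A" "B \<subseteq> cimg d" "open B" "convex B" "param d ` B \<subseteq> cdom d"
    "param d ` B = {p \<in> cdom d. coord d p \<in> B}" "param d ` B \<subseteq> pts A"
proof -
  show d: "d \<in> A" "B \<subseteq> cimg d" "open B" "convex B"
    using assms unfolding bundle_sheet_def by auto
  show "param d ` B = {p \<in> cdom d. coord d p \<in> B}" using param_image d by blast
  then show "param d ` B \<subseteq> cdom d" by blast
  then show "param d ` B \<subseteq> pts A" using cdom_subset [OF d(1)] by blast
qed

text \<open>In coordinates both paths lie in a convex set, where the straight-line homotopy joins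
  them; \<open>param d\<close> brings it back to the manifold. This is why the charts of the cover
  are taken over balls.\<close>

lemma homotopic_in_ball:
  assumes B: "bundle_sheet d B X"
    and e: "path e" "path_image e \<subseteq> param d ` B" and f: "path f" "path_image f \<subseteq> param d ` B"
    and "pathstart e = pathstart f" "pathfinish e = pathfinish f"
  shows "homotopic_paths (pts A) e f"
proof -
  note D = bundle_sheetD [OF B]
  have c: "path (coord d \<circ> k)" "path_image (coord d \<circ> k) \<subseteq> B" "\<And>t. t \<in> {0..1} \<Longrightarrow> coord d (k t) \<in> B"
     "\<And>t. t \<in> {0..1} \<Longrightarrow> (param d \<circ> (coord d \<circ> k)) t = k t"
    if "path k" "path_image k \<subseteq> param d ` B" for k
  proof -
    show *: "coord d (k t) \<in> B" if "t \<in> {0..1}" for t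
      using \<open>path_image k \<subseteq> _\<close> that D by (force simp: path_image_def)
    show "(param d \<circ> (coord d \<circ> k)) t = k t" if "t \<in> {0..1}" for t
      using \<open>path_image k \<subseteq> _\<close> that D by (force simp: path_image_def)
    show "path_image (coord d \<circ> k) \<subseteq> B" using * by (auto simp: path_image_def)
    show "path (coord d \<circ> k)"
      using that D(1,5) continuous_coord
      by (intro path_continuous_image continuous_on_subset [OF continuous_coord]) auto
  qed
  have "homotopic_paths B (coord d \<circ> e) (coord d \<circ> f)"
    using c [OF e] c [OF f] D(4) assms(6,7)
    by (intro homotopic_paths_linear closed_segment_subset) (auto simp: pathstart_def pathfinish_def)
  then have "homotopic_paths (pts A) (param d \<circ> (coord d \<circ> e)) (param d \<circ> (coord d \<circ> f))"
    using continuous_on_subset [OF continuous_param D(2)] D(1,7)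
    by (intro homotopic_paths_continuous_image [where S = B]) auto
  \<comment> \<open>The round trip through the coordinates returns \<open>e\<close> on [0, 1] only,
    not as a function on the reals, hence a homotopy in place of an equation.\<close>
  moreover have "homotopic_paths (pts A) e (param d \<circ> (coord d \<circ> e))"
    using e D(7) c(4) [OF e] by (intro homotopic_paths_eq) auto
  moreover have "homotopic_paths (pts A) f (param d \<circ> (coord d \<circ> f))"
    using f D(7) c(4) [OF f] by (intro homotopic_paths_eq) auto
  ultimately show ?thesis by (meson homotopic_paths_sym homotopic_paths_trans)
qed

lemma sheet_cases:
  assumes X: "bundle_sheet d B X" and "x \<in> X"
  obtains b where "based b" "x = cls b" "pathfinish b \<in> param d ` B"
proof -
  note D = bundle_sheetD [OF X]
  obtain a where a: "based a" "X = sheet (pts A) (param d ` B) (cls a)"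
    using X unfolding bundle_sheet_def by blast
  then obtain e where e: "x = cls (a +++ e)" "path e" "path_image e \<subseteq> param d ` B" "pathstart e = pathfinish a"
    using \<open>x \<in> X\<close> D by (auto simp: sheet_path_class based_path_def)
  show ?thesis
  proof
    show "based (a +++ e)" using a(1) e D(7) by (intro based_join) auto
    show "pathfinish (a +++ e) \<in> param d ` B" using e pathfinish_in_path_image [of e] by auto
  qed (fact e)
qed

text \<open>A point of the sheet is already a continuation of the centre path inside the ball, and
  two such continuations concatenate.\<close>

lemma sheet_continue:
  assumes X: "bundle_sheet d B X" and b: "based b" "cls b \<in> X"
    and e: "path e" "path_image e \<subseteq> param d ` B" "pathstart e = pathfinish b"
  shows "cls (b +++ e) \<in> X"
proof -
  note D = bundle_sheetD [OF X]
  obtain a where a: "based a" "X = sheet (pts A) (param d ` B) (cls a)"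
    using X unfolding bundle_sheet_def by blast
  then have Xeq: "X = {cls (a +++ f) | f. path f \<and> path_image f \<subseteq> param d ` B \<and> pathstart f = pathfinish a}"
    using D(7) by (simp add: sheet_path_class based_path_def)
  then obtain f where f: "cls b = cls (a +++ f)" "path f" "path_image f \<subseteq> param d ` B" "pathstart f = pathfinish a"
    using b by blast
  have fb: "pathfinish f = pathfinish b"
    using f(1) cls_eq_iff [OF b(1)] homotopic_paths_imp_pathfinish by fastforce
  have "cls (b +++ e) = cls ((a +++ f) +++ e)"
    using b f e D by (intro cls_join_cong) auto
  also have "\<dots> = cls (a +++ (f +++ e))"
    using a f e D fb by (intro path_class_join_assoc) (auto simp: based_path_def)
  finally have eq: "cls (b +++ e) = cls (a +++ (f +++ e))" .
  have "path (f +++ e)" "path_image (f +++ e) \<subseteq> param d ` B" "pathstart (f +++ e) = pathfinish a"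
    using f e fb by (simp_all add: path_image_join)
  then show ?thesis unfolding Xeq eq by blast
qed

text \<open>Injectivity of \<open>endpoint\<close> on a sheet: two continuations inside the ball
  with a common end are homotopic by \<open>homotopic_in_ball\<close>.\<close>

lemma sheet_eqI:
  assumes X: "bundle_sheet d B X" and "cls b \<in> X" "cls b' \<in> X" "based b" "based b'"
    and p: "pathfinish b = pathfinish b'"
  shows "cls b = cls b'"
proof -
  note D = bundle_sheetD [OF X]
  obtain a where a: "based a" "X = sheet (pts A) (param d ` B) (cls a)"
    using X unfolding bundle_sheet_def by blast
  have *: "\<exists>f. cls b = cls (a +++ f) \<and> path f \<and> path_image f \<subseteq> param d ` B \<and> pathstart f = pathfinish a
     \<and> pathfinish f = pathfinish b" if b: "cls b \<in> X" "based b" for b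
  proof -
    have "X = {cls (a +++ f) | f. path f \<and> path_image f \<subseteq> param d ` B \<and> pathstart f = pathfinish a}"
      using a D(7) by (simp add: sheet_path_class based_path_def)
    then obtain f where f: "cls b = cls (a +++ f)" "path f" "path_image f \<subseteq> param d ` B" "pathstart f = pathfinish a"
      using b by blast
    then show ?thesis
      using cls_eq_iff [OF b(2)] homotopic_paths_imp_pathfinish by fastforce
  qed
  obtain f where f: "cls b = cls (a +++ f)" "path f" "path_image f \<subseteq> param d ` B" "pathstart f = pathfinish a"
     "pathfinish f = pathfinish b" using * assms by metis
  obtain f' where f': "cls b' = cls (a +++ f')" "path f'" "path_image f' \<subseteq> param d ` B" "pathstart f' = pathfinish a"
     "pathfinish f' = pathfinish b'" using * assms by metis
  have "homotopic_paths (pts A) f f'"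
    by (rule homotopic_in_ball [OF X]) (use f f' p in auto)
  then show ?thesis
    unfolding f f' using a f by (intro path_class_join_cong) (auto simp: based_path_def)
qed

text \<open>Surjectivity of \<open>endpoint\<close> onto the ball: the centre path is continued
  along a coordinate segment.\<close>

lemma sheet_over:
  assumes X: "bundle_sheet d B X" and u: "u \<in> B"
  obtains b where "based b" "cls b \<in> X" "pathfinish b = param d u"
proof -
  note D = bundle_sheetD [OF X]
  obtain a where a: "based a" "pathfinish a \<in> param d ` B" "X = sheet (pts A) (param d ` B) (cls a)"
    using X unfolding bundle_sheet_def by blast
  then obtain v where v: "v \<in> B" "pathfinish a = param d v" by blast
  define e where "e = param d \<circ> linepath v u"
  have seg: "closed_segment v u \<subseteq> B" using D u v by (simp add: closed_segment_subset)
  have e: "path e" "path_image e \<subseteq> param d ` B" "pathstart e = pathfinish a" "pathfinish e = param d u"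
    using seg D v unfolding e_def
    by (auto simp: path_image_compose pathstart_compose pathfinish_compose
        intro!: path_continuous_image continuous_on_subset [OF continuous_param])
  show ?thesis
  proof
    show "based (a +++ e)" using a(1) e D(7) by (intro based_join) auto
    show "cls (a +++ e) \<in> X" using a e D by (auto simp: sheet_path_class based_path_def)
    show "pathfinish (a +++ e) = param d u" using e by simp
  qed
qed

section \<open>The action of the fundamental group on the cover is free and transitive on
  fibres\<close>

lemma fibre_transitive:
  assumes b: "based b" and b': "based b'" and p: "pathfinish b = pathfinish b'"
  obtains l where "loop l" "cls b' = cls (l +++ b)"
proof
  \<comment> \<open>The witness runs out along \<open>b'\<close> and returns to the base point along
    \<open>b\<close>.\<close>
  show "loop (b' +++ reversepath b)"
    using assms by (auto simp: based_path_def path_image_join)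
  have "cls ((b' +++ reversepath b) +++ b) = cls (b' +++ (reversepath b +++ b))"
    using assms by (intro path_class_join_assoc) (auto simp: based_path_def)
  also have "\<dots> = cls (b' +++ (\<lambda>_. pathfinish b'))"
    using assms homotopic_paths_reverse_left [of b "pts A"]
    by (intro path_class_join_cong) (auto simp: based_path_def)
  also have "\<dots> = cls b'"
    using b' homotopic_paths_const_right [of b' "pts A"]
    by (metis based_path_def homotopic_paths_sym path_class_eq_iff)
  finally show "cls b' = cls ((b' +++ reversepath b) +++ b)" by simp
qed

text \<open>Freeness of the action: appending \<open>reversepath b\<close> to both sides cancels
  \<open>b\<close>.\<close>

lemma deck_fixed_point:
  assumes l: "loop l" and b: "based b" and e: "cls (l +++ b) = cls b"
  shows "cls l = cls (\<lambda>_. x0)"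
proof -
  have lb: "based (l +++ b)" using l b by (auto simp: based_path_def path_image_join)
  have "cls (l +++ (b +++ reversepath b)) = cls ((l +++ b) +++ reversepath b)"
    using l b by (intro cls_join_assoc [symmetric]) (auto simp: based_path_def)
  also have "\<dots> = cls (b +++ reversepath b)"
    using l b lb e by (intro cls_join_cong) (auto simp: based_path_def)
  also have "\<dots> = cls (\<lambda>_. x0)"
    using b homotopic_paths_reverse_right [of b "pts A"]
    by (subst cls_eq_iff) (auto simp: based_path_def path_image_join)
  also have "cls (l +++ (b +++ reversepath b)) = cls (l +++ (\<lambda>_. x0))"
    using l b homotopic_paths_reverse_right [of b "pts A"]
    by (intro path_class_join_cong) (auto simp: based_path_def)
  also have "\<dots> = cls l"
    using l homotopic_paths_const_right [of l "pts A"]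
    by (metis based_path_def homotopic_paths_sym path_class_eq_iff)
  finally show ?thesis .
qed

text \<open>Two points in one orbit differ by a loop and have the same projection, so their first
  components agree by \<open>sheet_eqI\<close>. The loop then fixes a point, is trivial by
  \<open>deck_fixed_point\<close>, and leaves the Sol component unchanged too.\<close>

lemma inj_on_sheet:
  assumes X: "bundle_sheet d B X"
  shows "inj_on q (X \<times> UNIV)"
proof (rule inj_onI; clarify)
  fix x g x' g'
  assume x: "x \<in> X" "x' \<in> X" and e: "q (x, g) = q (x', g')"
  obtain b where b: "based b" "x = cls b" using sheet_cases [OF X x(1)] .
  obtain b' where b': "based b'" "x' = cls b'" using sheet_cases [OF X x(2)] .
  obtain l where l: "loop l" "x' = cls (l +++ b)" "g' = sol_mult (\<rho> (cls l)) g"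
    using e bundle_quot_eq_iff [OF b(1) b'(1)] b' b by auto
  have "pathfinish b = pathfinish b'"
    using e bundle_proj_quot [OF b(1)] bundle_proj_quot [OF b'(1)] b b' by metis
  then have xx: "x' = x" using sheet_eqI [OF X] x b b' by metis
  then have "cls l = cls (\<lambda>_. x0)" using deck_fixed_point [OF l(1) b(1)] l b by simp
  then show "x = x' \<and> g = g'" using xx l rho_const by simp
qed

section \<open>Bundle charts in coordinates\<close>

lemma bundle_chart_coord:
  assumes c: "bundle_chart c d B X" and b: "based b" "cls b \<in> X"
  shows "coord c (q (cls b, g)) = (coord d (pathfinish b), g)"
proof -
  have X: "bundle_sheet d B X" using c by (simp add: bundle_chart_def)
  have "inv_into (X \<times> UNIV) q (q (cls b, g)) = (cls b, g)"
    using inj_on_sheet [OF X] b by (intro inv_into_f_f) auto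
  then show ?thesis using c b by (simp add: bundle_chart_def coord_def based_cls)
qed

lemma bundle_chart_cdom: "bundle_chart c d B X \<Longrightarrow> cdom c = q ` (X \<times> UNIV)"
  by (simp add: bundle_chart_def cdom_def)

lemma bundle_chart_cimg:
  assumes c: "bundle_chart c d B X"
  shows "cimg c = B \<times> UNIV"
proof -
  have X: "bundle_sheet d B X" using c by (simp add: bundle_chart_def)
  note D = bundle_sheetD [OF X]
  have "coord c (q (x, g)) \<in> B \<times> UNIV" if x: "x \<in> X" for x g
  proof -
    obtain b where "based b" "x = cls b" "pathfinish b \<in> param d ` B" using sheet_cases [OF X x] .
    then show ?thesis using bundle_chart_coord [OF c, of b g] x D(6) by simp
  qed
  moreover have "(u, g) \<in> coord c ` q ` (X \<times> UNIV)" if u: "u \<in> B" for u g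
  proof -
    obtain b where b: "based b" "cls b \<in> X" "pathfinish b = param d u" using sheet_over [OF X u] .
    then have "coord c (q (cls b, g)) = (u, g)"
      using bundle_chart_coord [OF c b(1,2)] D(1) subsetD [OF D(2) u] by simp
    moreover have "(cls b, g) \<in> X \<times> UNIV" using b(2) by simp
    ultimately show ?thesis by (metis image_eqI)
  qed
  ultimately have "\<forall>z\<in>X \<times> UNIV. coord c (q z) \<in> B \<times> UNIV" "\<forall>z\<in>B \<times> UNIV. z \<in> coord c ` q ` (X \<times> UNIV)"
    by (simp_all only: split_paired_Ball_Sigma) auto
  then show ?thesis
    unfolding cimg_def bundle_chart_cdom [OF c] by blast
qed

text \<open>\<open>param\<close> is a chosen inverse, so it can be evaluated only after
  \<open>coord c\<close> is known to be injective on the domain of the chart.\<close>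

lemma bundle_chart_param:
  assumes c: "bundle_chart c d B X" and b: "based b" "cls b \<in> X" and u: "pathfinish b = param d u" "u \<in> B"
  shows "param c (u, g) = q (cls b, g)"
proof -
  have X: "bundle_sheet d B X" using c by (simp add: bundle_chart_def)
  note D = bundle_sheetD [OF X]
  have "inj_on (coord c) (cdom c)"
  proof (rule inj_onI)
    fix p p' assume p: "p \<in> cdom c" "p' \<in> cdom c" and e: "coord c p = coord c p'"
    obtain x g where x: "x \<in> X" "p = q (x, g)" using p bundle_chart_cdom [OF c] by auto
    obtain x' g' where x': "x' \<in> X" "p' = q (x', g')" using p bundle_chart_cdom [OF c] by auto
    obtain b where b: "based b" "x = cls b" "pathfinish b \<in> param d ` B" using sheet_cases [OF X x(1)] .
    obtain b' where b': "based b'" "x' = cls b'" "pathfinish b' \<in> param d ` B" using sheet_cases [OF X x'(1)] .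
    have "coord d (pathfinish b) = coord d (pathfinish b')" "g = g'"
      using e bundle_chart_coord [OF c b(1)] bundle_chart_coord [OF c b'(1)] b(2) b'(2) x x' by simp_all
    then have "pathfinish b = pathfinish b'" using D(1,6) b(3) b'(3) param_coord by (metis (lifting) mem_Collect_eq)
    then have "x = x'" using sheet_eqI [OF X] x x' b b' by metis
    then show "p = p'" using x x' \<open>g = g'\<close> by simp
  qed
  moreover have "q (cls b, g) \<in> cdom c" using b bundle_chart_cdom [OF c] by auto
  moreover have "coord c (q (cls b, g)) = (u, g)"
    using bundle_chart_coord [OF c b] u D(1) subsetD [OF D(2) u(2)] by simp
  ultimately show ?thesis unfolding param_def by (metis inv_into_f_f)
qed

lemma coord_bundle_param:
  assumes "bundle_chart c d B X" "u \<in> B"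
  shows "coord c (param c (u, g)) = (u, g)" "param c (u, g) \<in> cdom c"
proof -
  have "(u, g) \<in> coord c ` cdom c" using bundle_chart_cimg assms by (fastforce simp: cimg_def)
  then show "coord c (param c (u, g)) = (u, g)" "param c (u, g) \<in> cdom c"
    unfolding param_def by (auto simp: f_inv_into_f inv_into_into)
qed

text \<open>The domain of a bundle chart is everything over its ball, whatever sheet was chosen: a
  loop moves any lift into the sheet \<open>X\<close>, at the cost of a left translation in
  Sol.\<close>

lemma bundle_chart_mem:
  assumes c: "bundle_chart c d B X" and b: "based b" "pathfinish b \<in> param d ` B"
  shows "q (cls b, g) \<in> cdom c"
proof -
  have X: "bundle_sheet d B X" using c by (simp add: bundle_chart_def)
  obtain u where u: "u \<in> B" "pathfinish b = param d u" using b by auto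
  obtain b' where b': "based b'" "cls b' \<in> X" "pathfinish b' = param d u" using sheet_over [OF X u(1)] .
  obtain l where l: "loop l" "cls b' = cls (l +++ b)" using fibre_transitive [OF b(1) b'(1)] u b' by metis
  have "q (cls b, g) = q (cls b', sol_mult (\<rho> (cls l)) g)"
    using bundle_quot_eq_iff [OF b(1) b'(1)] l by blast
  then show ?thesis using b' bundle_chart_cdom [OF c] by auto
qed

lemma bundle_chart_proj:
  assumes c: "bundle_chart c d B X" and u: "u \<in> B"
  shows "bundle_proj (param c (u, g)) = param d u"
proof -
  have X: "bundle_sheet d B X" using c by (simp add: bundle_chart_def)
  obtain b where b: "based b" "cls b \<in> X" "pathfinish b = param d u" using sheet_over [OF X u] .
  then show ?thesis using bundle_chart_param [OF c b u] bundle_proj_quot by simp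
qed

lemma bundle_chart_right_act:
  assumes c: "bundle_chart c d B X" and u: "u \<in> B"
  shows "right_act h (param c (u, g)) = param c (u, sol_mult g h)"
proof -
  have X: "bundle_sheet d B X" using c by (simp add: bundle_chart_def)
  obtain b where b: "based b" "cls b \<in> X" "pathfinish b = param d u" using sheet_over [OF X u] .
  then show ?thesis using bundle_chart_param [OF c b u] right_act_quot by simp
qed

text \<open>A single loop carries the sheet \<open>X\<close> to \<open>X'\<close> above
  \<open>u\<close>, and the same loop still does so above nearby points because both lifts continue
  along the same path. Hence the translation \<open>h\<close>, the holonomy of that loop, does not
  depend on \<open>v\<close>: this is the flatness of the bundle.\<close>

lemma bundle_chart_transition:
  assumes c: "bundle_chart c d B X" and c': "bundle_chart c' d' B' X'"
    and u: "u \<in> B" and m: "param c (u, g) \<in> cdom c'"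
  obtains h N where "open N" "u \<in> N" "N \<subseteq> B" "\<And>v. v \<in> N \<Longrightarrow> param d v \<in> cdom d'"
    "\<And>v k. v \<in> N \<Longrightarrow> param c (v, k) \<in> cdom c'"
    "\<And>v k. v \<in> N \<Longrightarrow> coord c' (param c (v, k)) = (coord d' (param d v), sol_mult h k)"
proof -
  have X: "bundle_sheet d B X" using c by (simp add: bundle_chart_def)
  have X': "bundle_sheet d' B' X'" using c' by (simp add: bundle_chart_def)
  note D = bundle_sheetD [OF X] note D' = bundle_sheetD [OF X']
  obtain b where b: "based b" "cls b \<in> X" "pathfinish b = param d u" using sheet_over [OF X u] .
  have pq: "param c (u, g) = q (cls b, g)" using bundle_chart_param [OF c b u] .
  obtain x' g' where x': "x' \<in> X'" "q (cls b, g) = q (x', g')"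
    using m pq bundle_chart_cdom [OF c'] by auto
  obtain b' where b': "based b'" "x' = cls b'" "pathfinish b' \<in> param d' ` B'" using sheet_cases [OF X' x'(1)] .
  obtain l where l: "loop l" "cls b' = cls (l +++ b)"
    using x' b' bundle_quot_eq_iff [OF b(1) b'(1)] by auto
  have "pathfinish b' = pathfinish b"
    using x' b' bundle_proj_quot [OF b(1)] bundle_proj_quot [OF b'(1)] by metis
  then have uB': "param d u \<in> param d' ` B'" using b b' by simp
  \<comment> \<open>The points of \<open>B\<close> that the transition map of the base sends into
    \<open>B'\<close>; a ball inside this set keeps segments over both coordinate balls.\<close>
  have "open (B \<inter> (coord d ` (cdom d \<inter> cdom d') \<inter> (coord d' \<circ> param d) -` B'))"
  proof (rule open_Int [OF D(3)], rule continuous_open_preimage)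
    show "continuous_on (coord d ` (cdom d \<inter> cdom d')) (coord d' \<circ> param d)"
      using D(1) D'(1) coord_in [OF D(1)]
      by (intro continuous_on_compose continuous_on_subset [OF continuous_param]
            continuous_on_subset [OF continuous_coord]) auto
  qed (use D(1) D'(1,3) open_overlap in auto)
  moreover have "u \<in> B \<inter> (coord d ` (cdom d \<inter> cdom d') \<inter> (coord d' \<circ> param d) -` B')"
  proof -
    have "param d u \<in> cdom d" "param d u \<in> cdom d'" "coord d' (param d u) \<in> B'" "u = coord d (param d u)"
      using u uB' D(1) subsetD [OF D(2) u] D'(1,6) by auto
    then show ?thesis using u by force
  qed
  ultimately obtain r where r: "r > 0"
    "ball u r \<subseteq> B \<inter> (coord d ` (cdom d \<inter> cdom d') \<inter> (coord d' \<circ> param d) -` B')"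
    by (meson openE)
  have N: "param d v \<in> cdom d'" "param d v \<in> param d' ` B'" "v \<in> B" "param d v \<in> param d ` B"
    if "v \<in> ball u r" for v
  proof -
    have v: "v \<in> B" "v \<in> coord d ` (cdom d \<inter> cdom d')" "coord d' (param d v) \<in> B'"
      using r(2) that by (auto simp del: mem_ball)
    then show *: "param d v \<in> cdom d'" "v \<in> B" using D(1) by auto
    show "param d v \<in> param d' ` B'" using v(3) *(1) D'(6) by simp
    show "param d v \<in> param d ` B" using v by blast
  qed
  have main: "param c (v, k) \<in> cdom c'"
    "coord c' (param c (v, k)) = (coord d' (param d v), sol_mult (\<rho> (cls l)) k)" if v: "v \<in> ball u r" for v k
  proof -
    \<comment> \<open>Seen from the manifold, the coordinate segment from \<open>u\<close> to
      \<open>v\<close> runs inside both balls, so it continues \<open>b\<close> within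
      \<open>X\<close> and \<open>l +++ b\<close> within \<open>X'\<close>.\<close>
    define e where "e = param d \<circ> linepath u v"
    have seg: "closed_segment u v \<subseteq> ball u r" using r(1) v by (intro closed_segment_subset) auto
    have "closed_segment u v \<subseteq> cimg d" using seg N(3) D(2) by blast
    then have e: "path e" "pathstart e = param d u" "pathfinish e = param d v"
       "path_image e \<subseteq> param d ` B" "path_image e \<subseteq> param d' ` B'"
    proof -
      show "path e" unfolding e_def
        using \<open>closed_segment u v \<subseteq> cimg d\<close> D(1)
        by (intro path_continuous_image continuous_on_subset [OF continuous_param]) auto
      show "path_image e \<subseteq> param d ` B" "path_image e \<subseteq> param d' ` B'"
        using seg N unfolding e_def path_image_compose by auto
    qed (auto simp: e_def pathstart_compose pathfinish_compose)
    have eS: "path_image e \<subseteq> pts A" using e(4) D(7) by (rule subset_trans)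
    have be: "based (b +++ e)" "cls (b +++ e) \<in> X" "pathfinish (b +++ e) = param d v"
      using b e(1-3) based_join [OF b(1) e(1) eS] sheet_continue [OF X b(1,2) e(1,4)] by simp_all
    have lb: "based (l +++ b)" "pathfinish (l +++ b) = param d u"
      using l b by (auto simp: based_path_def path_image_join)
    have lX: "cls (l +++ b) \<in> X'" using x' l b' by simp
    have lbe: "based ((l +++ b) +++ e)" "cls ((l +++ b) +++ e) \<in> X'" "pathfinish ((l +++ b) +++ e) = param d v"
      using lb e(2,3) based_join [OF lb(1) e(1) eS] sheet_continue [OF X' lb(1) lX e(1,5)] by simp_all
    have "cls ((l +++ b) +++ e) = cls (l +++ (b +++ e))"
      using l b e(1,2) eS by (intro cls_join_assoc) simp_all
    then have eq: "param c (v, k) = q (cls ((l +++ b) +++ e), sol_mult (\<rho> (cls l)) k)"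
      using bundle_chart_param [OF c be N(3) [OF v]] bundle_quot_eq_iff [OF be(1) lbe(1)] l(1) by metis
    show "param c (v, k) \<in> cdom c'" using eq lbe bundle_chart_cdom [OF c'] by auto
    show "coord c' (param c (v, k)) = (coord d' (param d v), sol_mult (\<rho> (cls l)) k)"
      using bundle_chart_coord [OF c' lbe(1,2)] lbe(3) eq by simp
  qed
  show ?thesis
    by (rule that [of "ball u r" "\<rho> (cls l)"]) (use r N main in auto)
qed

section \<open>The atlases of the cover and of the flat bundle\<close>

lemma cover_bundle_iff:
  "e \<in> cover_bundle A x0 \<longleftrightarrow>
    (\<exists>d B X. bundle_sheet d B X \<and> e = (X \<times> UNIV, map_prod (coord d \<circ> endpoint) id))"
proof -
  have W: "{p \<in> cdom d. coord d p \<in> ball y r} = param d ` ball y r"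
    if "d \<in> A" "ball y r \<subseteq> cimg d" for d y r
    using param_image [OF that] by simp
  have "e \<in> cover_atlas A x0 \<longleftrightarrow> (\<exists>d B X. bundle_sheet d B X \<and> e = (X, coord d \<circ> endpoint))" for e
  proof
    assume "e \<in> cover_atlas A x0"
    then obtain d y r W a where *: "d \<in> A" "r > 0" "ball y r \<subseteq> cimg d" "W = {p \<in> cdom d. coord d p \<in> ball y r}"
      "path a" "path_image a \<subseteq> pts A" "pathstart a = x0" "pathfinish a \<in> W"
      "e = (sheet (pts A) W (cls a), coord d \<circ> endpoint)"
      unfolding cover_atlas_def by blast
    have "bundle_sheet d (ball y r) (sheet (pts A) W (cls a))"
      unfolding bundle_sheet_def based_path_def W [OF *(1,3), symmetric] using * by blast
    then show "\<exists>d B X. bundle_sheet d B X \<and> e = (X, coord d \<circ> endpoint)" using * by blast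
  next
    assume "\<exists>d B X. bundle_sheet d B X \<and> e = (X, coord d \<circ> endpoint)"
    then obtain d B X where X: "bundle_sheet d B X" "e = (X, coord d \<circ> endpoint)" by blast
    then obtain y r a where *: "d \<in> A" "B \<subseteq> cimg d" "r > 0" "B = ball y r" "based a"
      "pathfinish a \<in> param d ` B" "X = sheet (pts A) (param d ` B) (cls a)"
      unfolding bundle_sheet_def by blast
    then show "e \<in> cover_atlas A x0"
      unfolding cover_atlas_def X(2) based_path_def using W by blast
  qed
  then have "cover_atlas A x0 = {(X, coord d \<circ> endpoint) | d B X. bundle_sheet d B X}" by blast
  moreover have "cover_bundle A x0 = (\<lambda>e. (fst e \<times> UNIV, map_prod (snd e) id)) ` cover_atlas A x0"
    unfolding cover_bundle_def prod_atlas_def Sol_atlas_def cdom_def coord_def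
    by (simp add: image_image case_prod_unfold Times_insert_right)
  ultimately have "cover_bundle A x0 =
      (\<lambda>e. (fst e \<times> UNIV, map_prod (snd e) id)) ` {(X, coord d \<circ> endpoint) | d B X. bundle_sheet d B X}"
    by simp
  also have "\<dots> = {(X \<times> UNIV, map_prod (coord d \<circ> endpoint) id) | d B X. bundle_sheet d B X}"
    by (simp add: image_Collect) (use fst_conv snd_conv in blast)
  finally show ?thesis by blast
qed

text \<open>By \<open>inj_on_sheet\<close> each chart of the cover bundle satisfies the injectivity
  condition of \<open>quotient_atlas\<close>, so each of them yields a chart of the
  quotient.\<close>

lemma flat_bundle_iff: "c \<in> P \<longleftrightarrow> (\<exists>d B X. bundle_chart c d B X)"
proof
  assume "c \<in> P"
  then obtain e where e: "e \<in> cover_bundle A x0" "c = (q ` cdom e, coord e \<circ> inv_into (cdom e) q)"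
    unfolding flat_bundle_def quotient_atlas_def by blast
  then show "\<exists>d B X. bundle_chart c d B X"
    unfolding cover_bundle_iff bundle_chart_def cdom_def coord_def by fastforce
next
  assume "\<exists>d B X. bundle_chart c d B X"
  then obtain d B X where c: "bundle_chart c d B X" by blast
  define e :: "('m cover_pt \<times> vec3, vec3 \<times> vec3) chart"
    where "e = (X \<times> UNIV, map_prod (coord d \<circ> endpoint) id)"
  have "e \<in> cover_bundle A x0" "inj_on q (cdom e)"
    using c inj_on_sheet unfolding cover_bundle_iff bundle_chart_def e_def cdom_def fst_conv by blast+
  moreover have "c = (q ` cdom e, coord e \<circ> inv_into (cdom e) q)"
    using c unfolding bundle_chart_def e_def cdom_def coord_def by simp
  ultimately show "c \<in> P" unfolding flat_bundle_def quotient_atlas_def by blast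
qed

lemma bundle_chart_over:
  assumes d: "d \<in> A" "u \<in> cimg d" and b: "based b" "pathfinish b = param d u"
  obtains c B X where "bundle_chart c d B X" "u \<in> B"
proof -
  obtain r where "r > 0" "ball u r \<subseteq> cimg d" using d open_cimg openE by metis
  then have "bundle_sheet d (ball u r) (sheet (pts A) (param d ` ball u r) (cls b))"
    unfolding bundle_sheet_def using d b by (auto intro!: exI [of _ b] imageI)
  then show ?thesis using that \<open>r > 0\<close> unfolding bundle_chart_def by (meson centre_in_ball)
qed

lemma bundle_pts_cases:
  assumes "p \<in> pts P"
  obtains b g where "based b" "p = q (cls b, g)"
proof -
  obtain c d B X where c: "bundle_chart c d B X" "p \<in> cdom c"
    using assms flat_bundle_iff by (auto simp: pts_def)
  then have X: "bundle_sheet d B X" by (simp add: bundle_chart_def)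
  obtain x g where "x \<in> X" "p = q (x, g)" using c bundle_chart_cdom [OF c(1)] by auto
  then show ?thesis using that sheet_cases [OF X] by metis
qed

end

section \<open>Smooth functions\<close>

lemma Ck_on_cong:
  assumes S: "open S" and "\<And>x. x \<in> S \<Longrightarrow> f x = g x" and "Ck_on n S f"
  shows "Ck_on n S g"
  using assms(2,3)
proof (induction n arbitrary: f g)
  case 0
  then show ?case using continuous_on_cong [of S S f g] by simp
next
  case (Suc n)
  have f: "f differentiable (at y)" if "y \<in> S" for y using Suc.prems that by simp
  have "g differentiable (at y)" if "y \<in> S" for y
    using f [OF that] Suc.prems(1) S that unfolding differentiable_def
    by (meson has_derivative_transform_within_open)
  moreover have "Ck_on n S (\<lambda>y. frechet_derivative g (at y) v)" for v
  proof (rule Suc.IH)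
    show "frechet_derivative f (at y) v = frechet_derivative g (at y) v" if "y \<in> S" for y
      using frechet_derivative_transform_within_open [OF f [OF that] S that Suc.prems(1)] by simp
    show "Ck_on n S (\<lambda>y. frechet_derivative f (at y) v)" using Suc.prems by simp
  qed
  ultimately show ?case by simp
qed

lemma Ck_on_Suc_imp: "Ck_on (Suc n) S f \<Longrightarrow> Ck_on n S f"
proof (induction n arbitrary: f)
  case 0
  then show ?case
    by (auto intro!: differentiable_imp_continuous_on differentiable_at_imp_differentiable_on)
next
  case (Suc n)
  then show ?case by (auto simp del: Ck_on.simps simp: Ck_on.simps(2) [of "Suc n"] Ck_on.simps(2) [of n])
qed

lemma Ck_on_const: "Ck_on n S (\<lambda>_. a)"
  by (induction n arbitrary: a) auto

lemma Ck_on_add: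
  assumes "open S" "Ck_on n S f" "Ck_on n S g"
  shows "Ck_on n S (\<lambda>x. f x + g x)"
  using assms(2,3)
proof (induction n arbitrary: f g)
  case 0
  then show ?case by (simp add: continuous_on_add)
next
  case (Suc n)
  have "frechet_derivative (\<lambda>x. f x + g x) (at y) v =
      frechet_derivative f (at y) v + frechet_derivative g (at y) v" if "y \<in> S" for y v
  proof -
    have "((\<lambda>x. f x + g x) has_derivative
      (\<lambda>v. frechet_derivative f (at y) v + frechet_derivative g (at y) v)) (at y)"
      using Suc.prems that by (intro has_derivative_add) (auto simp: frechet_derivative_works)
    then show ?thesis by (metis frechet_derivative_at)
  qed
  note deriv = this
  have s: "Ck_on n S (\<lambda>y. frechet_derivative f (at y) v + frechet_derivative g (at y) v)" for v
    using Suc.prems by (intro Suc.IH) simp_all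
  have "Ck_on n S (\<lambda>y. frechet_derivative (\<lambda>x. f x + g x) (at y) v)" for v
    by (rule Ck_on_cong [OF assms(1) _ s [of v]]) (simp add: deriv)
  then show ?case using Suc.prems by (auto intro: differentiable_add)
qed

lemma Ck_on_mult:
  fixes f g :: "'e::real_normed_vector \<Rightarrow> real"
  assumes "open S" "Ck_on n S f" "Ck_on n S g"
  shows "Ck_on n S (\<lambda>x. f x * g x)"
  using assms(2,3)
proof (induction n arbitrary: f g)
  case 0
  then show ?case by (simp add: continuous_on_mult)
next
  case (Suc n)
  have "frechet_derivative (\<lambda>x. f x * g x) (at y) v =
      f y * frechet_derivative g (at y) v + frechet_derivative f (at y) v * g y" if "y \<in> S" for y v
  proof -
    have "((\<lambda>x. f x * g x) has_derivative
      (\<lambda>v. f y * frechet_derivative g (at y) v + frechet_derivative f (at y) v * g y)) (at y)"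
      using Suc.prems that by (intro has_derivative_mult) (auto simp: frechet_derivative_works)
    then show ?thesis by (metis frechet_derivative_at)
  qed
  note deriv = this
  have fg: "Ck_on n S f" "Ck_on n S g" using Suc.prems Ck_on_Suc_imp by blast+
  have s: "Ck_on n S (\<lambda>y. f y * frechet_derivative g (at y) v + frechet_derivative f (at y) v * g y)" for v
    using Suc.prems fg by (intro Ck_on_add Suc.IH assms(1)) simp_all
  have "Ck_on n S (\<lambda>y. frechet_derivative (\<lambda>x. f x * g x) (at y) v)" for v
    by (rule Ck_on_cong [OF assms(1) _ s [of v]]) (simp add: deriv)
  then show ?case using Suc.prems by (auto intro: differentiable_mult)
qed

text \<open>The derivative in direction \<open>v\<close> has the same shape with \<open>a\<close>
  replaced by \<open>L v *\<^sub>R a\<close>; so the induction generalises over \<open>a\<close>.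
  These functions are the coefficients of the Maurer--Cartan form.\<close>

lemma Ck_on_exp_linear:
  assumes L: "bounded_linear L"
  shows "Ck_on n S (\<lambda>x. exp (L x) *\<^sub>R a)"
proof (induction n arbitrary: a)
  case 0
  show ?case
    using linear_continuous_on [OF L] by (auto intro!: continuous_intros)
next
  case (Suc n)
  have d: "((\<lambda>x. exp (L x) *\<^sub>R a) has_derivative (\<lambda>v. exp (L y) *\<^sub>R (L v *\<^sub>R a))) (at y)" for y
    by (auto intro!: derivative_eq_intros bounded_linear_imp_has_derivative [OF L])
  then have "frechet_derivative (\<lambda>x. exp (L x) *\<^sub>R a) (at y) v = exp (L y) *\<^sub>R (L v *\<^sub>R a)" for y v
    by (metis frechet_derivative_at)
  moreover have "(\<lambda>x. exp (L x) *\<^sub>R a) differentiable (at y)" for y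
    using d [of y] unfolding differentiable_def by blast
  ultimately show ?case using Suc [of "L v *\<^sub>R a" for v] by simp
qed

lemma smooth_on_add: "open S \<Longrightarrow> smooth_on S f \<Longrightarrow> smooth_on S g \<Longrightarrow> smooth_on S (\<lambda>x. f x + g x)"
  by (simp add: smooth_on_def Ck_on_add)

lemma smooth_on_mult:
  fixes f g :: "'e::real_normed_vector \<Rightarrow> real"
  shows "open S \<Longrightarrow> smooth_on S f \<Longrightarrow> smooth_on S g \<Longrightarrow> smooth_on S (\<lambda>x. f x * g x)"
  by (simp add: smooth_on_def Ck_on_mult)

lemma smooth_on_const: "smooth_on S (\<lambda>_. a)"
  by (simp add: smooth_on_def Ck_on_const)

lemma smooth_on_diff:
  fixes f g :: "'e::real_normed_vector \<Rightarrow> real"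
  assumes "open S" "smooth_on S f" "smooth_on S g"
  shows "smooth_on S (\<lambda>x. f x - g x)"
  using smooth_on_add [OF assms(1,2) smooth_on_mult [OF assms(1) smooth_on_const assms(3), of "-1"]]
  by simp

lemma smooth_on_differentiable:
  assumes "smooth_on S f" "y \<in> S" shows "f differentiable (at y)"
  using assms Ck_on.simps(2) [of 0 S f] unfolding smooth_on_def by blast


section \<open>Symmetry of second derivatives and the structure equations\<close>

text \<open>The mean value theorem in direction \<open>v\<close> reduces the second difference to a
  difference of values of \<open>Df _ v\<close>, and differentiability of this function at the
  single point \<open>u\<close> does the rest. No continuity of second derivatives enters.\<close>

lemma second_difference_quotient:
  fixes f :: "'a::real_normed_vector \<Rightarrow> real"
  assumes S: "open S" "u \<in> S"
    and f: "\<And>x. x \<in> S \<Longrightarrow> (f has_derivative Df x) (at x)"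
    and H: "((\<lambda>x. Df x v) has_derivative H) (at u)"
    and "e > 0"
  shows "\<exists>d>0. \<forall>t. 0 < t \<and> t < d \<longrightarrow>
    \<bar>(f (u + t *\<^sub>R v + t *\<^sub>R w) - f (u + t *\<^sub>R v) - f (u + t *\<^sub>R w) + f u) / t\<^sup>2 - H w\<bar> \<le> e"
proof -
  \<comment> \<open>Increments with coefficients in [0, t] have norm at most t K; the summand 1
    keeps K positive when both vectors are 0.\<close>
  define K where "K = norm v + norm w + 1"
  have K: "K > 0" by (simp add: K_def add_nonneg_pos)
  obtain r where r: "r > 0" "ball u r \<subseteq> S" using S openE by blast
  \<comment> \<open>There will be two remainders, at the points \<open>x1\<close> and
    \<open>x2\<close>. Each is at most e / (2 K) times t K, so together they stay below e t.\<close>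
  have "e / (2 * K) > 0" using \<open>e > 0\<close> K by simp
  then obtain d1 where d1: "d1 > 0"
    "\<And>x. norm (x - u) < d1 \<Longrightarrow> norm (Df x v - Df u v - H (x - u)) \<le> e / (2 * K) * norm (x - u)"
    using H unfolding has_derivative_at_alt by metis
  have lin: "linear H" using H has_derivative_linear by blast
  define d where "d = min r d1 / K"
  have "d > 0" using r d1 K by (simp add: d_def)
  moreover have "\<bar>(f (u + t *\<^sub>R v + t *\<^sub>R w) - f (u + t *\<^sub>R v) - f (u + t *\<^sub>R w) + f u) / t\<^sup>2 - H w\<bar> \<le> e"
    if t: "0 < t" "t < d" for t
  proof -
    have tK: "t * K < r" "t * K < d1" using t K by (auto simp: d_def field_simps)
    have bound: "norm (s *\<^sub>R v + t' *\<^sub>R w) \<le> t * K" if "0 \<le> s" "s \<le> t" "0 \<le> t'" "t' \<le> t" for s t'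
    proof -
      have "norm (s *\<^sub>R v + t' *\<^sub>R w) \<le> s * norm v + t' * norm w"
        using that norm_triangle_ineq [of "s *\<^sub>R v" "t' *\<^sub>R w"] by simp
      also have "\<dots> \<le> t * norm v + t * norm w"
        using that by (intro add_mono mult_right_mono) auto
      also have "\<dots> \<le> t * K" using t by (simp add: K_def algebra_simps)
      finally show ?thesis .
    qed
    have inS: "u + (s *\<^sub>R v + t' *\<^sub>R w) \<in> S" if "0 \<le> s" "s \<le> t" "0 \<le> t'" "t' \<le> t" for s t'
    proof (rule subsetD [OF r(2)])
      have "dist u (u + (s *\<^sub>R v + t' *\<^sub>R w)) = norm (s *\<^sub>R v + t' *\<^sub>R w)"
        by (metis add_diff_cancel_left' dist_commute dist_norm)
      then show "u + (s *\<^sub>R v + t' *\<^sub>R w) \<in> ball u r" using bound [OF that] tK by simp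
    qed
    define \<phi> where "\<phi> s = f (u + (s *\<^sub>R v + t *\<^sub>R w)) - f (u + (s *\<^sub>R v + 0 *\<^sub>R w))" for s
    define \<phi>' where "\<phi>' s = Df (u + (s *\<^sub>R v + t *\<^sub>R w)) v - Df (u + (s *\<^sub>R v + 0 *\<^sub>R w)) v" for s
    have der: "(\<phi> has_derivative (\<lambda>h. h * \<phi>' s)) (at s)" if "0 \<le> s" "s \<le> t" for s
    proof -
      have *: "((\<lambda>s. f (u + (s *\<^sub>R v + t' *\<^sub>R w))) has_derivative (\<lambda>h. h * Df (u + (s *\<^sub>R v + t' *\<^sub>R w)) v)) (at s)"
        if t': "0 \<le> t'" "t' \<le> t" for t'
      proof -
        have F: "(f has_derivative Df (u + (s *\<^sub>R v + t' *\<^sub>R w))) (at (u + (s *\<^sub>R v + t' *\<^sub>R w)))"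
          using f inS \<open>0 \<le> s\<close> \<open>s \<le> t\<close> t' by blast
        have "((\<lambda>s. u + (s *\<^sub>R v + t' *\<^sub>R w)) has_derivative (\<lambda>h. h *\<^sub>R v)) (at s)"
          by (auto intro!: derivative_eq_intros)
        from has_derivative_compose [OF this F] show ?thesis
          using linear_scale [OF has_derivative_linear [OF F]] by simp
      qed
      show ?thesis
        unfolding \<phi>_def \<phi>'_def using has_derivative_diff [OF * [of t] * [of 0]] t
        by (simp add: algebra_simps)
    qed
    have "\<exists>s\<in>{0<..<t}. \<phi> t - \<phi> 0 = (t - 0) * \<phi>' s"
      using mvt_simple [OF t(1), of \<phi> "\<lambda>s h. h * \<phi>' s"] has_derivative_at_withinI [OF der] by simp
    then obtain s where s: "0 < s" "s < t" "\<phi> t - \<phi> 0 = t * \<phi>' s" by auto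
    define x1 where "x1 = u + (s *\<^sub>R v + t *\<^sub>R w)"
    define x2 where "x2 = u + (s *\<^sub>R v + 0 *\<^sub>R w)"
    have n: "norm (x1 - u) \<le> t * K" "norm (x2 - u) \<le> t * K"
      unfolding x1_def x2_def using bound [of s t] bound [of s 0] s t by auto
    have "norm (Df x1 v - Df u v - H (x1 - u)) \<le> e / (2 * K) * norm (x1 - u)"
      "norm (Df x2 v - Df u v - H (x2 - u)) \<le> e / (2 * K) * norm (x2 - u)"
      using d1(2) n tK by auto
    moreover have "e / (2 * K) * norm (x1 - u) \<le> e / (2 * K) * (t * K)"
      "e / (2 * K) * norm (x2 - u) \<le> e / (2 * K) * (t * K)"
      using mult_left_mono [OF n(1), of "e / (2 * K)"] mult_left_mono [OF n(2), of "e / (2 * K)"]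
        \<open>e > 0\<close> K by simp_all
    moreover have "e / (2 * K) * (t * K) = e * t / 2" using K by (simp add: field_simps)
    moreover have "H (x1 - u) - H (x2 - u) = t * H w"
      unfolding x1_def x2_def using lin by (simp add: linear_add linear_scale)
    ultimately have "\<bar>\<phi>' s - t * H w\<bar> \<le> e * t"
      unfolding \<phi>'_def x1_def [symmetric] x2_def [symmetric] by (simp add: abs_le_iff)
    then have "t * \<bar>\<phi>' s - t * H w\<bar> \<le> t * (e * t)" using t by (intro mult_left_mono) auto
    moreover have "(\<phi> t - \<phi> 0) / t\<^sup>2 - H w = t * (\<phi>' s - t * H w) / t\<^sup>2"
      unfolding s(3) using t by (simp add: field_simps power2_eq_square)
    ultimately have "\<bar>(\<phi> t - \<phi> 0) / t\<^sup>2 - H w\<bar> \<le> e"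
      using t by (simp add: abs_mult pos_divide_le_eq power2_eq_square mult_ac)
    moreover have "\<phi> t - \<phi> 0 = f (u + t *\<^sub>R v + t *\<^sub>R w) - f (u + t *\<^sub>R v) - f (u + t *\<^sub>R w) + f u"
      by (simp add: \<phi>_def add.assoc)
    ultimately show ?thesis by simp
  qed
  ultimately show ?thesis by blast
qed

text \<open>The second difference is unchanged when \<open>v\<close> and \<open>w\<close> are
  exchanged, and its quotient tends to both values. If these differed, an error of one third of
  their distance on either side could not bridge the gap.\<close>

lemma second_derivative_symmetric:
  fixes f :: "'a::real_normed_vector \<Rightarrow> real"
  assumes S: "open S" "u \<in> S"
    and f: "\<And>x. x \<in> S \<Longrightarrow> (f has_derivative Df x) (at x)"
    and H: "((\<lambda>x. Df x v) has_derivative H) (at u)" "((\<lambda>x. Df x w) has_derivative H') (at u)"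
  shows "H w = H' v"
proof (rule ccontr)
  assume "H w \<noteq> H' v"
  then have e: "\<bar>H w - H' v\<bar> / 3 > 0" by simp
  define Q where "Q t = (f (u + t *\<^sub>R v + t *\<^sub>R w) - f (u + t *\<^sub>R v) - f (u + t *\<^sub>R w) + f u) / t\<^sup>2" for t
  have Q: "Q t = (f (u + t *\<^sub>R w + t *\<^sub>R v) - f (u + t *\<^sub>R w) - f (u + t *\<^sub>R v) + f u) / t\<^sup>2" for t
    by (simp add: Q_def algebra_simps)
  obtain d where d: "d > 0" "\<And>t. 0 < t \<and> t < d \<Longrightarrow> \<bar>Q t - H w\<bar> \<le> \<bar>H w - H' v\<bar> / 3"
    using second_difference_quotient [OF S f H(1) e, of w] unfolding Q_def by blast
  obtain d' where d': "d' > 0" "\<And>t. 0 < t \<and> t < d' \<Longrightarrow> \<bar>Q t - H' v\<bar> \<le> \<bar>H w - H' v\<bar> / 3"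
    using second_difference_quotient [OF S f H(2) e, of v] unfolding Q by blast
  define t where "t = min d d' / 2"
  have "0 < t" "t < d" "t < d'" using d d' by (auto simp: t_def)
  then have "\<bar>Q t - H w\<bar> \<le> \<bar>H w - H' v\<bar> / 3" "\<bar>Q t - H' v\<bar> \<le> \<bar>H w - H' v\<bar> / 3"
    using d d' by auto
  moreover have "\<bar>H w - H' v\<bar> \<le> \<bar>Q t - H w\<bar> + \<bar>Q t - H' v\<bar>" by linarith
  ultimately have "\<bar>H w - H' v\<bar> \<le> \<bar>H w - H' v\<bar> / 3 + \<bar>H w - H' v\<bar> / 3" by (meson add_mono order_trans)
  then show False using e by (simp add: field_simps)
qed

text \<open>No second derivative of \<open>f\<close> is assumed: it exists because \<open>Df = exp (- k z) a\<close>.\<close>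

lemma exterior_derivative_exp_mult:
  fixes f z :: "'a::real_normed_vector \<Rightarrow> real"
  assumes S: "open S" "u \<in> S"
    and f: "\<And>x. x \<in> S \<Longrightarrow> (f has_derivative Df x) (at x)"
    and z: "(z has_derivative Dz) (at u)"
    and a: "\<And>x w. x \<in> S \<Longrightarrow> a x w = exp (k * z x) * Df x w"
    and da: "\<And>w. (\<lambda>x. a x w) differentiable (at u)"
  shows "frechet_derivative (\<lambda>x. a x w) (at u) v - frechet_derivative (\<lambda>x. a x v) (at u) w =
    k * (Dz v * a u w - Dz w * a u v)"
proof -
  define Da where "Da w = frechet_derivative (\<lambda>x. a x w) (at u)" for w
  have Da: "((\<lambda>x. a x w) has_derivative Da w) (at u)" for w
    using da unfolding Da_def frechet_derivative_works by blast
  have H: "((\<lambda>x. Df x w) has_derivative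
      (\<lambda>h. exp (- k * z u) * Da w h + exp (- k * z u) * (- k * Dz h) * a u w)) (at u)" for w
  proof -
    have e: "((\<lambda>x. exp (- k * z x)) has_derivative (\<lambda>h. exp (- k * z u) * (- k * Dz h))) (at u)"
      by (auto intro!: derivative_eq_intros z)
    have "((\<lambda>x. exp (- k * z x) * a x w) has_derivative
      (\<lambda>h. exp (- k * z u) * Da w h + exp (- k * z u) * (- k * Dz h) * a u w)) (at u)"
      by (rule has_derivative_mult [OF e Da])
    then show ?thesis
    proof (rule has_derivative_transform_within_open [OF _ S])
      show "exp (- k * z x) * a x w = Df x w" if "x \<in> S" for x
        using a [OF that] by (simp add: exp_minus)
    qed
  qed
  \<comment> \<open>Symmetry for \<open>f\<close>, written in terms of \<open>a\<close>. Cancelling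
    the common exponential leaves da = k dz \<and> a.\<close>
  have "exp (- k * z u) * Da w v + exp (- k * z u) * (- k * Dz v) * a u w =
      exp (- k * z u) * Da v w + exp (- k * z u) * (- k * Dz w) * a u v"
    using second_derivative_symmetric [OF S f H [of w] H [of v]] by simp
  then have "exp (- k * z u) * (Da w v - k * Dz v * a u w) = exp (- k * z u) * (Da v w - k * Dz w * a u v)"
    by (simp add: algebra_simps)
  then have "Da w v - k * Dz v * a u w = Da v w - k * Dz w * a u v" by simp
  then show ?thesis unfolding Da_def by (simp add: algebra_simps)
qed


section \<open>Wedge products in low degree\<close>

lemma sum_permutes_2:
  "(\<Sum>\<sigma> | \<sigma> permutes {..<2::nat}. f \<sigma>) = f id + f (Transposition.transpose 0 1)"
proof -
  have S: "{..<2::nat} = insert 0 {1}" by auto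
  show ?thesis unfolding S
    by (subst sum_over_permutations_insert) (simp_all add: permutes_sing)
qed

lemma sum_permutes_3:
  "(\<Sum>\<sigma> | \<sigma> permutes {..<3::nat}. f \<sigma>) =
     f id + f (Transposition.transpose 1 2) + f (Transposition.transpose 0 1) + f (Transposition.transpose 0 1 \<circ> Transposition.transpose 1 2)
     + f (Transposition.transpose 0 2) + f (Transposition.transpose 0 2 \<circ> Transposition.transpose 1 2)"
proof -
  have S: "{..<3::nat} = insert 0 (insert 1 {2})" by auto
  show ?thesis unfolding S
    by (subst sum_over_permutations_insert, simp, simp, subst sum_over_permutations_insert)
      (simp_all add: permutes_sing add.assoc)
qed

lemma wedge_by_1_1:
  assumes "\<And>w. \<alpha> c y w = a (w 0)" "\<And>w. \<beta> c y w = b (w 0)"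
  shows "wedge_by B 1 1 \<alpha> \<beta> c y v = B (a (v 0)) (b (v 1)) - B (a (v 1)) (b (v 0))"
proof -
  have n: "(1::nat) + 1 = 2" by simp
  show ?thesis
    unfolding wedge_by_def assms n sum_permutes_2
    by (simp add: sign_swap_id sign_id)
qed

text \<open>\<open>b\<close> is not assumed antisymmetric, so all six permutations remain; the
  division by 2 is the normalisation 1 / (1! 2!).\<close>

lemma wedge_by_1_2:
  fixes B :: "'u \<Rightarrow> 'v \<Rightarrow> real"
  assumes "\<And>w. \<alpha> c y w = a (w 0)" "\<And>w. \<beta> c y w = b (w 0) (w 1)"
  shows "wedge_by B 1 2 \<alpha> \<beta> c y v =
    (B (a (v 0)) (b (v 1) (v 2)) - B (a (v 0)) (b (v 2) (v 1))
     - B (a (v 1)) (b (v 0) (v 2)) + B (a (v 1)) (b (v 2) (v 0))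
     - B (a (v 2)) (b (v 1) (v 0)) + B (a (v 2)) (b (v 0) (v 1))) / 2"
proof -
  have n: "(1::nat) + 2 = 3" by simp
  show ?thesis
    unfolding wedge_by_def assms n sum_permutes_3
    by (simp add: sign_swap_id sign_id sign_compose permutation_swap_id Transposition.transpose_def numeral_2_eq_2)
qed

lemma wedge_by_2_1:
  fixes B :: "'u \<Rightarrow> 'v \<Rightarrow> real"
  assumes "\<And>w. \<alpha> c y w = a (w 0) (w 1)" "\<And>w. \<beta> c y w = b (w 0)"
  shows "wedge_by B 2 1 \<alpha> \<beta> c y v =
    (B (a (v 0) (v 1)) (b (v 2)) - B (a (v 0) (v 2)) (b (v 1))
     - B (a (v 1) (v 0)) (b (v 2)) + B (a (v 1) (v 2)) (b (v 0))
     - B (a (v 2) (v 1)) (b (v 0)) + B (a (v 2) (v 0)) (b (v 1))) / 2"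
proof -
  have n: "(2::nat) + 1 = 3" by simp
  show ?thesis
    unfolding wedge_by_def assms n sum_permutes_3
    by (simp add: sign_swap_id sign_id sign_compose permutation_swap_id Transposition.transpose_def numeral_2_eq_2)
qed


section \<open>Pullbacks\<close>

text \<open>Only entry 0 of the tuple matters for a 1-form. The constant tuple is the normal form
  used from here on, and in it linearity becomes that of an ordinary map of vectors.\<close>

lemma alternating_multilinear_1D:
  assumes "alternating_multilinear 1 \<theta>"
  shows "\<theta> w = \<theta> (\<lambda>_. w 0)" "linear (\<lambda>x. \<theta> (\<lambda>_. x))"
proof -
  have "\<forall>v w. (\<forall>i<1. v i = w i) \<longrightarrow> \<theta> v = \<theta> w"
    using assms unfolding alternating_multilinear_def by blast
  then have *: "\<theta> v = \<theta> w" if "v 0 = w 0" for v w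
    using that by (metis less_one)
  show "\<theta> w = \<theta> (\<lambda>_. w 0)" by (rule *) simp
  have "linear (\<lambda>x. \<theta> ((\<lambda>_. 0)(0 := x)))"
    using assms unfolding alternating_multilinear_def by (blast intro: zero_less_one)
  moreover have "\<theta> ((\<lambda>_. 0)(0 := x)) = \<theta> (\<lambda>_. x)" for x by (rule *) simp
  ultimately show "linear (\<lambda>x. \<theta> (\<lambda>_. x))" by simp
qed

lemma alternating_multilinear_1I:
  assumes "\<And>v. \<theta> v = f (v 0)" "linear f"
  shows "alternating_multilinear 1 \<theta>"
  using assms unfolding alternating_multilinear_def by simp

lemma formsD:
  assumes "\<omega> \<in> forms A k"
  shows "c \<in> A \<Longrightarrow> y \<in> cimg c \<Longrightarrow> alternating_multilinear k (\<omega> c y)"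
    and "c \<in> A \<Longrightarrow> smooth_on (cimg c) (\<lambda>y. \<omega> c y v)"
    and "c \<in> A \<Longrightarrow> b \<in> A \<Longrightarrow> p \<in> cdom c \<Longrightarrow> p \<in> cdom b \<Longrightarrow> \<omega> c (coord c p) v =
        \<omega> b (coord b p) (\<lambda>i. frechet_derivative (coord b \<circ> param c) (at (coord c p)) (v i))"
    and "\<not> (c \<in> A \<and> y \<in> cimg c) \<Longrightarrow> \<omega> c y v = 0"
  using assms unfolding forms_def by blast+

text \<open>\<open>pullback\<close> evaluates in a chart picked by \<open>SOME\<close>; this moves
  the evaluation to any preferred chart \<open>b\<close>. The chain rule inserts the transition map
  from \<open>b\<close> to the picked chart, and compatibility of \<open>\<omega>\<close> removes it
  again. Membership in \<open>forms\<close> says nothing on differentiability of transition maps,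
  hence the hypothesis \<open>trans\<close>.\<close>

lemma pullback_chart:
  assumes \<omega>: "\<omega> \<in> forms B k" and c: "c \<in> A" "y \<in> cimg c"
    and b: "b \<in> B" "f (param c y) \<in> cdom b"
    and f: "((\<lambda>y. coord b (f (param c y))) has_derivative D) (at y)"
    and N: "open N" "y \<in> N" "\<And>y'. y' \<in> N \<Longrightarrow> param b (coord b (f (param c y'))) = f (param c y')"
    and trans: "\<And>b'. b' \<in> B \<Longrightarrow> f (param c y) \<in> cdom b' \<Longrightarrow>
      (coord b' \<circ> param b) differentiable (at (coord b (f (param c y))))"
  shows "pullback A B f \<omega> c y v = \<omega> b (coord b (f (param c y))) (\<lambda>i. D (v i))"
proof -
  define p where "p = f (param c y)"
  define b' where "b' = (SOME b. b \<in> B \<and> p \<in> cdom b)"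
  have b': "b' \<in> B" "p \<in> cdom b'"
    unfolding b'_def using someI [of "\<lambda>b. b \<in> B \<and> p \<in> cdom b"] b by (auto simp: p_def)
  define T where "T = frechet_derivative (coord b' \<circ> param b) (at (coord b p))"
  have T: "((coord b' \<circ> param b) has_derivative T) (at (coord b p))"
    unfolding T_def frechet_derivative_works [symmetric] p_def
    using trans b' by (simp add: p_def)
  have "((\<lambda>y. (coord b' \<circ> param b) (coord b (f (param c y)))) has_derivative (\<lambda>v. T (D v))) (at y)"
    using has_derivative_compose [OF f] T unfolding p_def by blast
  then have "((coord b' \<circ> f \<circ> param c) has_derivative (\<lambda>v. T (D v))) (at y)"
    by (rule has_derivative_transform_within_open [OF _ N(1,2)]) (simp add: N(3))
  then have fd: "frechet_derivative (coord b' \<circ> f \<circ> param c) (at y) = (\<lambda>v. T (D v))"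
    by (metis frechet_derivative_at)
  have "pullback A B f \<omega> c y v = \<omega> b' (coord b' p) (\<lambda>i. T (D (v i)))"
    unfolding pullback_def using c by (simp add: Let_def flip: p_def b'_def) (simp add: fd)
  also have "\<dots> = \<omega> b (coord b p) (\<lambda>i. D (v i))"
    unfolding T_def using formsD(3) [OF \<omega> b(1) b'(1) _ b'(2)] b(2) by (simp add: p_def)
  finally show ?thesis by (simp add: p_def)
qed


section \<open>Translations and the Maurer--Cartan form of Sol\<close>

text \<open>The linear part of a left translation, which is an affine map:
  \<open>sol_mult g h = g + sol_diag (g $ 3) h\<close>. It is therefore also the derivative of the
  translation, at every point.\<close>

definition sol_diag :: "real \<Rightarrow> vec3 \<Rightarrow> vec3" where
  "sol_diag t w = vector [exp (- t) * w $ 1, exp t * w $ 2, w $ 3]"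

lemma sol_diag_nth [simp]:
  "sol_diag t w $ 1 = exp (- t) * w $ 1" "sol_diag t w $ 2 = exp t * w $ 2" "sol_diag t w $ 3 = w $ 3"
  by (simp_all add: sol_diag_def)

lemma sol_diag_inverse [simp]: "sol_diag t (sol_diag (- t) w) = w" "sol_diag (- t) (sol_diag t w) = w"
  by (simp_all add: vec_eq_iff forall_3 mult.assoc [symmetric] flip: exp_add)

lemma sol_diag_add: "sol_diag t (sol_diag s w) = sol_diag (t + s) w"
  by (simp add: vec_eq_iff forall_3 mult.assoc [symmetric] flip: exp_add)

lemma linear_sol_diag: "linear (sol_diag t)"
  by (rule linearI) (simp_all add: vec_eq_iff forall_3 algebra_simps)

lemma bounded_linear_sol_diag: "bounded_linear (sol_diag t)"
  using linear_sol_diag linear_conv_bounded_linear by blast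

lemma sol_mult_eq: "sol_mult g h = g + sol_diag (g $ 3) h"
  by (simp add: sol_mult_def vec_eq_iff forall_3)

lemma sol_mult_nth3 [simp]: "sol_mult g h $ 3 = g $ 3 + h $ 3"
  by (simp add: sol_mult_def)

lemma left_translation_has_derivative: "(sol_mult g has_derivative sol_diag (g $ 3)) F"
  unfolding sol_mult_eq [abs_def]
  using bounded_linear_imp_has_derivative [OF bounded_linear_sol_diag]
  by (auto intro!: derivative_eq_intros)

lemma m_inv_Sol_nth3: "m_inv Sol g $ 3 = - (g $ 3)"
proof -
  have "sol_mult (m_inv Sol g) g $ 3 = 0" by (simp add: sol_inv_mult)
  then show ?thesis by simp
qed

text \<open>Exponentials times fixed vectors: the shape covered by
  \<open>Ck_on_exp_linear\<close>.\<close>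

lemma sol_diag_eq: "sol_diag t w =
    exp (- t) *\<^sub>R (w $ 1 *\<^sub>R X_sol) + exp t *\<^sub>R (w $ 2 *\<^sub>R Y_sol) + w $ 3 *\<^sub>R Z_sol"
  by (simp add: vec_eq_iff forall_3 X_sol_def Y_sol_def Z_sol_def axis_def)

lemma right_translation_differentiable: "(\<lambda>g. sol_mult g h) differentiable (at g)"
  unfolding sol_mult_eq sol_diag_eq
  by (intro derivative_intros differentiable_add differentiable_scaleR differentiable_const) 
    (auto intro!: differentiable_chain_at simp: differentiable_def
       intro!: exI bounded_linear_imp_has_derivative derivative_eq_intros bounded_linear_vec_nth)

lemma mc_form_eq: "mc_form (UNIV, id) g v = sol_diag (- (g $ 3)) (v 0)"
proof -
  have "frechet_derivative (sol_mult (m_inv Sol g)) (at g) = sol_diag (- (g $ 3))"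
    using left_translation_has_derivative [of "m_inv Sol g" "at g"]
    by (metis frechet_derivative_at m_inv_Sol_nth3)
  then show ?thesis by (simp add: mc_form_def Sol_atlas_def)
qed

text \<open>The weights exp(z) and exp(-z) of the first two coframe members cancel, so the volume
  form has constant coefficients: it is the determinant of the coordinates.\<close>

lemma vol_Sol_eq: "vol_Sol (UNIV, id) g v =
    (v 0 $ 1 * v 1 $ 2 - v 1 $ 1 * v 0 $ 2) * v 2 $ 3
    - (v 0 $ 1 * v 2 $ 2 - v 2 $ 1 * v 0 $ 2) * v 1 $ 3
    + (v 1 $ 1 * v 2 $ 2 - v 2 $ 1 * v 1 $ 2) * v 0 $ 3"
proof -
  have e: "exp (g $ 3) * x * (exp (- (g $ 3)) * y) = x * y" for x y :: real
    by (simp add: exp_minus)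
  have "wedge_by (*) 1 1 (\<lambda>c g v. mc_form c g v $ 1) (\<lambda>c g v. mc_form c g v $ 2) (UNIV, id) g w =
      w 0 $ 1 * w 1 $ 2 - w 1 $ 1 * w 0 $ 2" for w
    by (subst wedge_by_1_1 [where a = "\<lambda>x. sol_diag (- (g $ 3)) x $ 1" and b = "\<lambda>x. sol_diag (- (g $ 3)) x $ 2"])
      (simp_all add: mc_form_eq e)
  note w = this
  show ?thesis
    unfolding vol_Sol_def
    by (subst wedge_by_2_1 [where a = "\<lambda>x y. x $ 1 * y $ 2 - y $ 1 * x $ 2" and b = "\<lambda>x. x $ 3"])
      (simp only: w, simp only: mc_form_eq sol_diag_nth, simp add: field_simps)
qed

text \<open>The third coordinate is a homomorphism onto an abelian group and so is invariant under
  conjugation. No other entry of \<open>Ad\<close> has to be computed.\<close>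

lemma Ad_nth3: "Ad g \<xi> $ 3 = \<xi> $ 3"
proof -
  define F where "F h = sol_mult (sol_mult g h) (m_inv Sol g)" for h
  have "F differentiable (at 0)"
    unfolding F_def
    by (rule differentiable_compose [OF right_translation_differentiable])
      (use left_translation_has_derivative in \<open>auto simp: differentiable_def\<close>)
  then have "(F has_derivative Ad g) (at 0)"
    unfolding Ad_def F_def frechet_derivative_works .
  then have "((\<lambda>h. F h $ 3) has_derivative (\<lambda>\<xi>. Ad g \<xi> $ 3)) (at 0)"
    by (rule bounded_linear.has_derivative [OF bounded_linear_vec_nth])
  moreover have "((\<lambda>h. F h $ 3) has_derivative (\<lambda>\<xi>. \<xi> $ 3)) (at 0)"
    unfolding F_def sol_mult_nth3 m_inv_Sol_nth3
    by (auto intro!: derivative_eq_intros bounded_linear_imp_has_derivative bounded_linear_vec_nth)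
  ultimately show ?thesis using has_derivative_unique by metis
qed

section \<open>Forms on the flat bundle\<close>

lemma has_derivative_prod_split:
  fixes f :: "'a::real_normed_vector \<Rightarrow> 'b::real_normed_vector"
    and g :: "'c::real_normed_vector \<Rightarrow> 'd::real_normed_vector"
  assumes f: "(f has_derivative f') (at (fst z))" and g: "(g has_derivative g') (at (snd z))"
  shows "((\<lambda>y. (f (fst y), g (snd y))) has_derivative (\<lambda>v. (f' (fst v), g' (snd v)))) (at z)"
  by (intro has_derivative_Pair has_derivative_compose [OF has_derivative_fst [OF has_derivative_ident] f]
      has_derivative_compose [OF has_derivative_snd [OF has_derivative_ident] g])

lemma alternating_multilinear_cong:
  assumes "alternating_multilinear k \<theta>" "\<And>i. i < k \<Longrightarrow> v i = w i"
  shows "\<theta> v = \<theta> w"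
proof -
  have "\<forall>v w. (\<forall>i<k. v i = w i) \<longrightarrow> \<theta> v = \<theta> w"
    using assms(1) unfolding alternating_multilinear_def by (rule conjunct1)
  then show ?thesis using assms(2) by (elim allE [of _ v] allE [of _ w] mp) simp
qed

lemma alternating_multilinear_eq_0:
  assumes "alternating_multilinear k \<theta>" "i < k" "j < k" "i \<noteq> j" "v i = v j"
  shows "\<theta> v = 0"
proof -
  have "\<forall>i<k. \<forall>j<k. \<forall>v. i \<noteq> j \<and> v i = v j \<longrightarrow> \<theta> v = 0"
    using assms(1) unfolding alternating_multilinear_def by (elim conjE)
  then show ?thesis using assms(2-5) by auto
qed

lemma alternating_multilinearI:
  assumes "\<And>v w. \<forall>i<k. v i = w i \<Longrightarrow> \<theta> v = \<theta> w"
    and "\<And>i v. i < k \<Longrightarrow> linear (\<lambda>x. \<theta> (v(i := x)))"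
    and "\<And>i j v. i < k \<Longrightarrow> j < k \<Longrightarrow> i \<noteq> j \<Longrightarrow> v i = v j \<Longrightarrow> \<theta> v = 0"
  shows "alternating_multilinear k \<theta>"
  unfolding alternating_multilinear_def
proof (intro conjI allI impI)
  show "\<theta> v = \<theta> w" if "\<forall>i<k. v i = w i" for v w using that by (rule assms(1))
  show "linear (\<lambda>x. \<theta> (v(i := x)))" if "i < k" for i v using that by (rule assms(2))
  show "\<theta> v = 0" if "i < k" "j < k" "i \<noteq> j \<and> v i = v j" for i j v
    using that by (elim conjE) (rule assms(3))
qed

context flat_data
begin

section \<open>Transition maps and pullbacks in bundle charts\<close>

lemma transition_differentiable:
  assumes d: "d \<in> A" "d' \<in> A" and p: "p \<in> cdom d" "p \<in> cdom d'"
  shows "(coord d' \<circ> param d) differentiable (at (coord d p))"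
proof (rule smooth_on_differentiable)
  show "smooth_on (coord d ` (cdom d \<inter> cdom d')) (coord d' \<circ> param d)"
    using manifold d unfolding closed_oriented_3manifold_def by blast
qed (use p in blast)

lemma bundle_chartD:
  assumes c: "bundle_chart c d B X"
  shows "c \<in> P" "d \<in> A" "open B" "B \<subseteq> cimg d" "cimg c = B \<times> UNIV"
    "\<And>u. u \<in> B \<Longrightarrow> param d u \<in> cdom d" "\<And>u. u \<in> B \<Longrightarrow> coord d (param d u) = u"
proof -
  have X: "bundle_sheet d B X" using c by (simp add: bundle_chart_def)
  note D = bundle_sheetD [OF X]
  show "c \<in> P" using c flat_bundle_iff by blast
  show "cimg c = B \<times> UNIV" by (rule bundle_chart_cimg [OF c])
  show "d \<in> A" "open B" "B \<subseteq> cimg d" by (fact D)+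
  then show "param d u \<in> cdom d" "coord d (param d u) = u" if "u \<in> B" for u
    using that by auto
qed

lemma bundle_param_coord:
  assumes c: "bundle_chart c d B X" and p: "p \<in> cdom c"
  shows "param c (coord c p) = p" "fst (coord c p) \<in> B"
proof -
  have X: "bundle_sheet d B X" using c by (simp add: bundle_chart_def)
  obtain x g where x: "x \<in> X" "p = q (x, g)" using p bundle_chart_cdom [OF c] by auto
  obtain b where b: "based b" "x = cls b" "pathfinish b \<in> param d ` B" using sheet_cases [OF X x(1)] .
  obtain u where u: "u \<in> B" "pathfinish b = param d u" using b(3) by blast
  have bX: "cls b \<in> X" using x b by simp
  have "coord c p = (u, g)"
    using bundle_chart_coord [OF c b(1) bX, of g] u bundle_chartD(7) [OF c u(1)] x b by simp
  moreover have "param c (u, g) = p" using bundle_chart_param [OF c b(1) bX u(2,1)] x b by simp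
  ultimately show "param c (coord c p) = p" "fst (coord c p) \<in> B" using u by simp_all
qed

text \<open>The derivative is block diagonal because the translation \<open>h\<close> is constant
  near \<open>u\<close>: base directions contribute nothing to the fibre component.\<close>

lemma bundle_transition_derivative:
  assumes c: "bundle_chart c d B X" and c': "bundle_chart c' d' B' X'"
    and u: "u \<in> B" and m: "param c (u, g) \<in> cdom c'"
  obtains h T where "coord c' (param c (u, g)) = (coord d' (param d u), sol_mult h g)"
    "((coord c' \<circ> param c) has_derivative (\<lambda>w. (T (fst w), sol_diag (h $ 3) (snd w)))) (at (u, g))"
proof -
  obtain h N where N: "open N" "u \<in> N" "N \<subseteq> B" "\<And>v. v \<in> N \<Longrightarrow> param d v \<in> cdom d'"
    "\<And>v k. v \<in> N \<Longrightarrow> coord c' (param c (v, k)) = (coord d' (param d v), sol_mult h k)"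
    using bundle_chart_transition [OF c c' u m] by metis
  have "(coord d' \<circ> param d) differentiable (at (coord d (param d u)))"
    using bundle_chartD(2,6) [OF c] bundle_chartD(2) [OF c'] u N(2,4)
    by (intro transition_differentiable) auto
  then obtain T where T: "((coord d' \<circ> param d) has_derivative T) (at (fst (u, g)))"
    unfolding differentiable_def using bundle_chartD(7) [OF c u] by auto
  have "((\<lambda>y. ((coord d' \<circ> param d) (fst y), sol_mult h (snd y))) has_derivative
      (\<lambda>w. (T (fst w), sol_diag (h $ 3) (snd w)))) (at (u, g))"
    by (rule has_derivative_prod_split [OF T left_translation_has_derivative])
  then have "((coord c' \<circ> param c) has_derivative (\<lambda>w. (T (fst w), sol_diag (h $ 3) (snd w)))) (at (u, g))"
  proof (rule has_derivative_transform_within_open)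
    show "open (N \<times> (UNIV :: vec3 set))" using N(1) by (simp add: open_Times)
    show "(u, g) \<in> N \<times> UNIV" using N(2) by simp
    show "((coord d' \<circ> param d) (fst y), sol_mult h (snd y)) = (coord c' \<circ> param c) y"
      if "y \<in> N \<times> UNIV" for y
      using that N(5) by (cases y) simp
  qed
  then show ?thesis using that N by blast
qed

lemma bundle_transition_differentiable:
  assumes c: "bundle_chart c d B X" and "c' \<in> P" and p: "p \<in> cdom c" "p \<in> cdom c'"
  shows "(coord c' \<circ> param c) differentiable (at (coord c p))"
proof -
  obtain d' B' X' where c': "bundle_chart c' d' B' X'" using \<open>c' \<in> P\<close> flat_bundle_iff by blast
  obtain u g where ug: "coord c p = (u, g)" by (cases "coord c p")
  have u: "u \<in> B" using bundle_param_coord(2) [OF c p(1)] ug by simp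
  have "param c (u, g) \<in> cdom c'" using bundle_param_coord(1) [OF c p(1)] ug p(2) by simp
  from bundle_transition_derivative [OF c c' u this] show ?thesis
    unfolding ug differentiable_def by metis
qed

lemma pullback_bundle_chart:
  assumes \<omega>: "\<omega> \<in> forms P k" and e: "e \<in> E" "y \<in> cimg e"
    and c: "bundle_chart c d B X"
    and N: "open N" "y \<in> N" "\<And>y'. y' \<in> N \<Longrightarrow> f (param e y') \<in> cdom c"
    and f: "((\<lambda>y. coord c (f (param e y))) has_derivative D) (at y)"
  shows "pullback E P f \<omega> e y v = \<omega> c (coord c (f (param e y))) (\<lambda>i. D (v i))"
  using N by (intro pullback_chart [OF \<omega> e _ _ f N(1,2)] bundle_chartD(1) [OF c]
      bundle_param_coord(1) [OF c] bundle_transition_differentiable [OF c]) auto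

lemma pullback_bundle_proj:
  assumes \<eta>: "\<eta> \<in> forms A k" and c: "bundle_chart c d B X" and u: "u \<in> B"
  shows "pullback P A bundle_proj \<eta> c (u, g) v = \<eta> d u (\<lambda>i. fst (v i))"
proof -
  have N: "open (B \<times> (UNIV :: vec3 set))" "(u, g) \<in> B \<times> UNIV"
    using bundle_chartD(3) [OF c] u by (simp_all add: open_Times)
  have pr: "bundle_proj (param c y) = param d (fst y)" "coord d (bundle_proj (param c y)) = fst y"
    "bundle_proj (param c y) \<in> cdom d" if "y \<in> B \<times> UNIV" for y
    using that bundle_chart_proj [OF c, of "fst y" "snd y"] bundle_chartD(6,7) [OF c] by auto
  have der: "((\<lambda>y. coord d (bundle_proj (param c y))) has_derivative fst) (at (u, g))"
    by (rule has_derivative_transform_within_open [OF has_derivative_fst [OF has_derivative_ident] N])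
      (rule pr(2) [symmetric])
  have "pullback P A bundle_proj \<eta> c (u, g) v =
      \<eta> d (coord d (bundle_proj (param c (u, g)))) (\<lambda>i. fst (v i))"
  proof (rule pullback_chart [OF \<eta> _ _ _ _ der N])
    show "c \<in> P" "d \<in> A" "(u, g) \<in> cimg c" "bundle_proj (param c (u, g)) \<in> cdom d"
      using bundle_chartD [OF c] u pr [OF N(2)] by simp_all
    show "param d (coord d (bundle_proj (param c y))) = bundle_proj (param c y)" if "y \<in> B \<times> UNIV" for y
      using pr [OF that] bundle_chartD(2) [OF c] by simp
    show "(coord b' \<circ> param d) differentiable (at (coord d (bundle_proj (param c (u, g)))))"
      if "b' \<in> A" "bundle_proj (param c (u, g)) \<in> cdom b'" for b'
      using that pr [OF N(2)] bundle_chartD(2) [OF c] transition_differentiable by blast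
  qed
  then show ?thesis using pr [OF N(2)] by simp
qed

text \<open>The candidate for the descended form: the pullback of \<open>\<kappa>\<close> along the
  fibre coordinate of each chart. The charts agree on it when \<open>\<kappa>\<close> is
  left-invariant.\<close>

definition lift_form :: "(vec3, vec3, 'v::real_normed_vector) form \<Rightarrow> ('m bundle_pt, vec3 \<times> vec3, 'v) form" where
  "lift_form \<kappa> = (\<lambda>c y v. if c \<in> P \<and> y \<in> cimg c then \<kappa> (UNIV, id) (snd y) (\<lambda>i. snd (v i)) else 0)"

lemma lift_form_chart:
  assumes "bundle_chart c d B X" "u \<in> B"
  shows "lift_form \<kappa> c (u, g) v = \<kappa> (UNIV, id) g (\<lambda>i. snd (v i))"
  using bundle_chartD [OF assms(1)] assms(2) by (simp add: lift_form_def)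

text \<open>The hypothesis \<open>inv\<close> is left-invariance of \<open>\<kappa>\<close> in
  coordinates, and it is exactly compatibility under the fibre part of a transition map.\<close>

lemma lift_form_in_forms:
  fixes \<kappa> :: "(vec3, vec3, 'v::real_normed_vector) form"
  assumes alt: "\<And>g. alternating_multilinear k (\<kappa> (UNIV, id) g)"
    and smooth: "\<And>S v. open S \<Longrightarrow> smooth_on S (\<lambda>z::vec3 \<times> vec3. \<kappa> (UNIV, id) (snd z) v)"
    and inv: "\<And>h g v. \<kappa> (UNIV, id) (sol_mult h g) (\<lambda>i. sol_diag (h $ 3) (v i)) = \<kappa> (UNIV, id) g v"
  shows "lift_form \<kappa> \<in> forms P k"
proof -
  have "alternating_multilinear k (\<lambda>v. \<kappa> (UNIV, id) g (\<lambda>i. snd (v i :: vec3 \<times> vec3)))" for g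
  proof -
    have upd: "(\<lambda>j. snd ((v(i := x)) j)) = (\<lambda>j. snd (v j))(i := snd x)" for v :: "nat \<Rightarrow> vec3 \<times> vec3" and i x
      by (simp add: fun_eq_iff)
    have "linear (\<lambda>x. \<kappa> (UNIV, id) g ((\<lambda>j. snd (v j :: vec3 \<times> vec3))(i := snd (x :: vec3 \<times> vec3))))" if "i < k" for v i
    proof -
      have "linear (\<lambda>x. \<kappa> (UNIV, id) g ((\<lambda>j. snd (v j))(i := x)))"
        using alt [of g] that unfolding alternating_multilinear_def by blast
      from linear_compose [OF linear_snd this] show ?thesis by (simp add: comp_def)
    qed
    moreover have "\<kappa> (UNIV, id) g (\<lambda>i. snd (v i)) = \<kappa> (UNIV, id) g (\<lambda>i. snd (w i))"
      if "\<forall>i<k. v i = w i" for v w :: "nat \<Rightarrow> vec3 \<times> vec3"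
    proof -
      show ?thesis by (rule alternating_multilinear_cong [OF alt]) (use that in simp)
    qed
    moreover have "\<kappa> (UNIV, id) g (\<lambda>i. snd (v i)) = 0"
      if "i < k" "j < k" "i \<noteq> j" "v i = v j" for v :: "nat \<Rightarrow> vec3 \<times> vec3" and i j
    proof -
      show ?thesis
        by (rule alternating_multilinear_eq_0 [OF alt that(1-3)]) (simp add: that(4))
    qed
    ultimately show ?thesis by (intro alternating_multilinearI) (simp_all only: upd)
  qed
  moreover have "smooth_on (cimg c) (\<lambda>y. lift_form \<kappa> c y v)" if "c \<in> P" for c v
  proof -
    obtain d B X where c: "bundle_chart c d B X" using \<open>c \<in> P\<close> flat_bundle_iff by blast
    have o: "open (cimg c)" using bundle_chartD(3,5) [OF c] by (simp add: open_Times)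
    have "Ck_on n (cimg c) (\<lambda>z. lift_form \<kappa> c z v)" for n
    proof (rule Ck_on_cong [OF o])
      show "Ck_on n (cimg c) (\<lambda>z. \<kappa> (UNIV, id) (snd z) (\<lambda>i. snd (v i)))"
        using smooth [OF o] unfolding smooth_on_def by blast
    qed (use that in \<open>simp add: lift_form_def\<close>)
    then show ?thesis unfolding smooth_on_def by blast
  qed
  moreover have "lift_form \<kappa> c (coord c p) v =
      lift_form \<kappa> b (coord b p) (\<lambda>i. frechet_derivative (coord b \<circ> param c) (at (coord c p)) (v i))"
    if cb: "c \<in> P" "b \<in> P" and p: "p \<in> cdom c" "p \<in> cdom b" for c b p v
  proof -
    obtain d B X where c: "bundle_chart c d B X" using \<open>c \<in> P\<close> flat_bundle_iff by blast
    obtain d' B' X' where b: "bundle_chart b d' B' X'" using \<open>b \<in> P\<close> flat_bundle_iff by blast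
    obtain u g where ug: "coord c p = (u, g)" by (cases "coord c p")
    have u: "u \<in> B" and pc: "param c (u, g) = p" using bundle_param_coord [OF c p(1)] ug by simp_all
    have m: "param c (u, g) \<in> cdom b" using pc p(2) by simp
    obtain h T where h': "coord b (param c (u, g)) = (coord d' (param d u), sol_mult h g)"
      and T: "((coord b \<circ> param c) has_derivative (\<lambda>w. (T (fst w), sol_diag (h $ 3) (snd w)))) (at (u, g))"
      using bundle_transition_derivative [OF c b u m] .
    have h: "coord b p = (coord d' (param d u), sol_mult h g)" using h' pc by simp
    have fd: "frechet_derivative (coord b \<circ> param c) (at (u, g)) = (\<lambda>w. (T (fst w), sol_diag (h $ 3) (snd w)))"
      using frechet_derivative_at [OF T] by simp
    have "coord d' (param d u) \<in> B'" using bundle_param_coord(2) [OF b p(2)] h by simp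
    then have "lift_form \<kappa> b (coord b p) (\<lambda>i. frechet_derivative (coord b \<circ> param c) (at (coord c p)) (v i)) =
        \<kappa> (UNIV, id) g (\<lambda>i. snd (v i))"
      unfolding ug h fd by (simp add: lift_form_chart [OF b] inv)
    then show ?thesis unfolding ug by (simp add: lift_form_chart [OF c u])
  qed
  moreover have "alternating_multilinear k (lift_form \<kappa> c y)" if "c \<in> P" "y \<in> cimg c" for c y
    using calculation(1) [of "snd y"] that by (simp add: lift_form_def)
  moreover have "lift_form \<kappa> c y v = 0" if "\<not> (c \<in> P \<and> y \<in> cimg c)" for c y v
    using that unfolding lift_form_def by (rule if_not_P)
  ultimately show ?thesis
    unfolding forms_def by blast
qed

text \<open>The chart \<open>c\<close> of the quotient and the chart \<open>e\<close> upstairs have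
  the same coordinates, so the projection \<open>q\<close> reads as the identity. Any choice of
  preimage by \<open>param e\<close> serves, since all that enters is
  \<open>coord e (param e y) = y\<close>.\<close>

lemma cover_chart_param:
  assumes X: "bundle_sheet d B X" and e: "e = (X \<times> UNIV, map_prod (coord d \<circ> endpoint) id)"
    and c: "bundle_chart c d B X" and y: "y \<in> B \<times> UNIV"
  shows "y \<in> cimg e" "snd (param e y) = snd y" "coord c (q (param e y)) = y" "q (param e y) \<in> cdom c"
proof -
  have ce: "coord c (q z) = coord e z" if z: "z \<in> X \<times> UNIV" for z
  proof -
    have "fst z \<in> X" using z by auto
    then obtain b where b: "based b" "fst z = cls b" using sheet_cases [OF X] by blast
    have bX: "cls b \<in> X" using \<open>fst z \<in> X\<close> b(2) by simp
    have zb: "z = (cls b, snd z)" using b(2) by (simp add: prod_eq_iff)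
    have "coord c (q z) = (coord d (pathfinish b), snd z)"
      by (subst zb) (rule bundle_chart_coord [OF c b(1) bX])
    moreover have "coord e z = (coord d (endpoint (fst z)), snd z)"
      unfolding e coord_def by (cases z) simp
    ultimately show ?thesis using based_cls(1) [OF b(1)] b(2) by simp
  qed
  have "y \<in> coord c ` q ` (X \<times> UNIV)"
    using y bundle_chart_cimg [OF c] bundle_chart_cdom [OF c] unfolding cimg_def by simp
  then obtain z where z: "z \<in> X \<times> UNIV" "y = coord c (q z)" by blast
  then have "y \<in> coord e ` (X \<times> UNIV)" using ce by simp
  then show "y \<in> cimg e" unfolding cimg_def cdom_def e by simp
  have pe: "param e y \<in> X \<times> UNIV" "coord e (param e y) = y"
    using \<open>y \<in> coord e ` (X \<times> UNIV)\<close> inv_into_into [of y "coord e" "X \<times> UNIV"]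
      f_inv_into_f [of y "coord e" "X \<times> UNIV"]
    by (simp_all add: param_def cdom_def e)
  then show "coord c (q (param e y)) = y" using ce by simp
  show "q (param e y) \<in> cdom c" using pe bundle_chart_cdom [OF c] by simp
  show "snd (param e y) = snd y"
    using arg_cong [OF pe(2), of snd] unfolding e coord_def by (cases "param e y") (simp add: e)
qed

lemma cover_chart_cimg:
  assumes X: "bundle_sheet d B X" and e: "e = (X \<times> UNIV, map_prod (coord d \<circ> endpoint) id)"
  shows "cimg e \<subseteq> B \<times> UNIV"
proof -
  have "coord d (endpoint x) \<in> B" if x: "x \<in> X" for x
  proof -
    obtain b where b: "based b" "x = cls b" "pathfinish b \<in> param d ` B" using sheet_cases [OF X x] .
    then show ?thesis using bundle_sheetD(6) [OF X] by (simp add: based_cls)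
  qed
  then show ?thesis unfolding cimg_def cdom_def coord_def e by auto
qed

lemma pullback_bundle_quot:
  assumes \<eta>: "\<eta> \<in> forms P k"
    and X: "bundle_sheet d B X" and e: "e = (X \<times> UNIV, map_prod (coord d \<circ> endpoint) id)"
    and c: "bundle_chart c d B X" and y: "y \<in> B \<times> UNIV"
  shows "pullback (cover_bundle A x0) P q \<eta> e y v = \<eta> c y v"
proof -
  note C = cover_chart_param [OF X e c]
  have N: "open (B \<times> (UNIV :: vec3 set))" using bundle_chartD(3) [OF c] by (simp add: open_Times)
  have "((\<lambda>y. coord c (q (param e y))) has_derivative (\<lambda>v. v)) (at y)"
    by (rule has_derivative_transform_within_open [OF has_derivative_ident N y]) (simp add: C)
  moreover have "e \<in> cover_bundle A x0" using cover_bundle_iff X e by blast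
  ultimately have "pullback (cover_bundle A x0) P q \<eta> e y v = \<eta> c (coord c (q (param e y))) (\<lambda>i. v i)"
    using pullback_bundle_chart [OF \<eta> _ C(1) [OF y] c N y, where f = q and E = "cover_bundle A x0"] C(4)
    by blast
  then show ?thesis by (simp add: C(3) [OF y])
qed

lemma pullback_snd:
  assumes X: "bundle_sheet d B X" and e: "e = (X \<times> UNIV, map_prod (coord d \<circ> endpoint) id)"
    and c: "bundle_chart c d B X" and y: "y \<in> B \<times> UNIV"
  shows "pullback (cover_bundle A x0) Sol_atlas snd \<kappa> e y v = \<kappa> (UNIV, id) (snd y) (\<lambda>i. snd (v i))"
proof -
  note C = cover_chart_param [OF X e c]
  have N: "open (B \<times> (UNIV :: vec3 set))" using bundle_chartD(3) [OF c] by (simp add: open_Times)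
  have "((id \<circ> snd \<circ> param e) has_derivative snd) (at y)"
    by (rule has_derivative_transform_within_open [OF has_derivative_snd [OF has_derivative_ident] N y])
      (simp add: C)
  then have fd: "frechet_derivative (id \<circ> snd \<circ> param e) (at y) = snd"
    by (metis frechet_derivative_at)
  have "e \<in> cover_bundle A x0" using cover_bundle_iff X e by blast
  moreover have "(SOME b. b \<in> Sol_atlas \<and> p \<in> cdom b) = (UNIV, id)" for p
    by (rule some_equality) (auto simp: Sol_atlas_def cdom_def)
  moreover have "coord ((UNIV, id) :: (vec3, vec3) chart) = id" by (simp add: coord_def)
  ultimately show ?thesis
    unfolding pullback_def using C(1,2) [OF y] fd by (simp add: Let_def)
qed

text \<open>Existence: upstairs, both forms are \<open>\<kappa>\<close> applied to the fibre
  components. Uniqueness: every bundle chart comes from a chart upstairs with equal coordinates, so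
  the pullback under \<open>q\<close> determines a form.\<close>

lemma descend_eq_lift_form:
  assumes \<kappa>: "lift_form \<kappa> \<in> forms P k"
  shows "descend A x0 \<rho> k (pullback (cover_bundle A x0) Sol_atlas snd \<kappa>) = lift_form \<kappa>"
proof -
  let ?\<theta> = "pullback (cover_bundle A x0) Sol_atlas snd \<kappa>"
  have "pullback (cover_bundle A x0) P q (lift_form \<kappa>) e y v = ?\<theta> e y v" for e y v
  proof (cases "e \<in> cover_bundle A x0 \<and> y \<in> cimg e")
    case True
    then obtain d B X where X: "bundle_sheet d B X" and e: "e = (X \<times> UNIV, map_prod (coord d \<circ> endpoint) id)"
      using cover_bundle_iff by blast
    define c where "c = (q ` (X \<times> UNIV), map_prod (coord d \<circ> endpoint) id \<circ> inv_into (X \<times> UNIV) q)"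
    have c: "bundle_chart c d B X" using X by (simp add: bundle_chart_def c_def)
    have y: "y \<in> B \<times> UNIV" using True cover_chart_cimg [OF X e] by blast
    then have "lift_form \<kappa> c y v = \<kappa> (UNIV, id) (snd y) (\<lambda>i. snd (v i))"
      using lift_form_chart [OF c, of "fst y" \<kappa> "snd y" v] by auto
    then show ?thesis
      by (simp add: pullback_bundle_quot [OF \<kappa> X e c y] pullback_snd [OF X e c y])
  next
    case False
    then show ?thesis unfolding pullback_def by auto
  qed
  then have pb: "pullback (cover_bundle A x0) P q (lift_form \<kappa>) = ?\<theta>" by (intro ext)
  have "\<eta> = lift_form \<kappa>" if \<eta>: "\<eta> \<in> forms P k" "pullback (cover_bundle A x0) P q \<eta> = ?\<theta>" for \<eta>
  proof (intro ext)
    fix c y v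
    show "\<eta> c y v = lift_form \<kappa> c y v"
    proof (cases "c \<in> P \<and> y \<in> cimg c")
      case True
      then obtain d B X where c: "bundle_chart c d B X" using flat_bundle_iff by blast
      then have X: "bundle_sheet d B X" by (simp add: bundle_chart_def)
      have y: "y \<in> B \<times> UNIV" using True bundle_chartD(5) [OF c] by simp
      have "pullback (cover_bundle A x0) P q \<eta> (X \<times> UNIV, map_prod (coord d \<circ> endpoint) id) y v =
         pullback (cover_bundle A x0) P q (lift_form \<kappa>) (X \<times> UNIV, map_prod (coord d \<circ> endpoint) id) y v"
        using \<eta>(2) pb by simp
      then show ?thesis
        unfolding pullback_bundle_quot [OF \<eta>(1) X refl c y] pullback_bundle_quot [OF \<kappa> X refl c y] .
    next
      case False
      then show ?thesis using formsD(4) [OF \<eta>(1)] formsD(4) [OF \<kappa>] by metis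
    qed
  qed
  then show ?thesis
    unfolding descend_def using \<kappa> pb by (intro the_equality) blast+
qed

lemma lift_mc_form: "lift_form mc_form \<in> forms P 1"
proof (rule lift_form_in_forms)
  show "alternating_multilinear 1 (mc_form (UNIV, id) g)" for g
    by (rule alternating_multilinear_1I [where f = "sol_diag (- (g $ 3))"]) (simp_all add: mc_form_eq linear_sol_diag)
  show "smooth_on S (\<lambda>z::vec3 \<times> vec3. mc_form (UNIV, id) (snd z) v)" if S: "open S" for S v
  proof -
    have L: "bounded_linear (\<lambda>z::vec3 \<times> vec3. snd z $ 3)"
      by (intro bounded_linear_compose [OF bounded_linear_vec_nth bounded_linear_snd])
    have L': "bounded_linear (\<lambda>z::vec3 \<times> vec3. - (snd z $ 3))" by (rule bounded_linear_minus [OF L])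
    have "Ck_on n S (\<lambda>z. exp (snd z $ 3) *\<^sub>R (v 0 $ 1 *\<^sub>R X_sol) + exp (- (snd z $ 3)) *\<^sub>R (v 0 $ 2 *\<^sub>R Y_sol)
        + v 0 $ 3 *\<^sub>R Z_sol)" for n
      by (intro Ck_on_add S Ck_on_exp_linear [OF L] Ck_on_exp_linear [OF L'] Ck_on_const)
    then show ?thesis unfolding smooth_on_def mc_form_eq sol_diag_eq by simp
  qed
  show "mc_form (UNIV, id) (sol_mult h g) (\<lambda>i. sol_diag (h $ 3) (v i)) = mc_form (UNIV, id) g v" for h g v
    by (simp add: mc_form_eq sol_diag_add)
qed

lemma lift_vol_Sol: "lift_form vol_Sol \<in> forms P 3"
proof (rule lift_form_in_forms)
  show "alternating_multilinear 3 (vol_Sol (UNIV, id) g)" for g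
  proof -
    have lt: "i < 3 \<longleftrightarrow> i = 0 \<or> i = 1 \<or> i = 2" for i :: nat by auto
    have "linear (\<lambda>x. vol_Sol (UNIV, id) g (v(i := x)))" if "i < 3" for v i
      using that unfolding lt by (elim disjE) (auto intro!: linearI simp: vol_Sol_eq algebra_simps)
    moreover have "vol_Sol (UNIV, id) g v = 0" if "i < 3" "j < 3" "i \<noteq> j" "v i = v j" for v i j
      using that unfolding lt by (elim disjE) (simp_all add: vol_Sol_eq algebra_simps)
    moreover have "vol_Sol (UNIV, id) g v = vol_Sol (UNIV, id) g w" if "\<forall>i<3. v i = w i" for v w
      using that by (simp add: vol_Sol_eq)
    ultimately show ?thesis by (intro alternating_multilinearI)
  qed
  show "smooth_on S (\<lambda>z::vec3 \<times> vec3. vol_Sol (UNIV, id) (snd z) v)" for S v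
    unfolding vol_Sol_eq by (rule smooth_on_const)
  have e: "exp x * a * (exp (- x) * b) = a * b" "exp (- x) * a * (exp x * b) = a * b" for x a b :: real
    by (simp_all add: exp_minus)
  show "vol_Sol (UNIV, id) (sol_mult h g) (\<lambda>i. sol_diag (h $ 3) (v i)) = vol_Sol (UNIV, id) g v" for h g v
    unfolding vol_Sol_eq sol_diag_nth e ..
qed

lemma flat_connection_eq: "flat_connection A x0 \<rho> = lift_form mc_form"
  unfolding flat_connection_def by (rule descend_eq_lift_form [OF lift_mc_form])

lemma vol_bundle_eq: "vol_bundle A x0 \<rho> = lift_form vol_Sol"
  unfolding vol_bundle_def by (rule descend_eq_lift_form [OF lift_vol_Sol])

end

section \<open>Sections and connections\<close>

lemma frechet_derivative_nth:
  fixes f :: "'a::real_normed_vector \<Rightarrow> real ^ 'n"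
  assumes "f differentiable (at y)"
  shows "frechet_derivative (\<lambda>z. f z $ i) (at y) w = frechet_derivative f (at y) w $ i"
proof -
  have "((\<lambda>z. f z $ i) has_derivative (\<lambda>w. frechet_derivative f (at y) w $ i)) (at y)"
    using assms unfolding frechet_derivative_works
    by (rule bounded_linear.has_derivative [OF bounded_linear_vec_nth])
  from frechet_derivative_at [OF this] show ?thesis by metis
qed

lemma ext_d_1:
  assumes "c \<in> A" "y \<in> cimg c" and \<omega>: "\<And>z w. \<omega> c z w = \<omega> c z (\<lambda>_. w 0)"
  shows "ext_d A 1 \<omega> c y v = frechet_derivative (\<lambda>z. \<omega> c z (\<lambda>_. v 1)) (at y) (v 0)
    - frechet_derivative (\<lambda>z. \<omega> c z (\<lambda>_. v 0)) (at y) (v 1)"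
proof -
  have e: "(\<lambda>z. \<omega> c z (\<lambda>j. if j < i then v j else v (Suc j))) =
      (\<lambda>z. \<omega> c z (\<lambda>_. if 0 < i then v 0 else v 1))" for i
    by (rule ext, subst \<omega>) simp
  have "ext_d A 1 \<omega> c y v = (\<Sum>i\<le>1. (-1) ^ i *\<^sub>R
      frechet_derivative (\<lambda>z. \<omega> c z (\<lambda>_. if 0 < i then v 0 else v 1)) (at y) (v i))"
    unfolding ext_d_def e using assms(1,2) by simp
  also have "{..1::nat} = {0, 1}" by auto
  finally show ?thesis by simp
qed

lemma forms_1_eq:
  assumes "\<omega> \<in> forms A 1"
  shows "\<omega> c y w = \<omega> c y (\<lambda>_. w 0)"
proof (cases "c \<in> A \<and> y \<in> cimg c")
  case True
  then show ?thesis using alternating_multilinear_1D(1) [OF formsD(1) [OF assms]] by metis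
next
  case False
  then show ?thesis using formsD(4) [OF assms] by metis
qed

context flat_data
begin

text \<open>The value \<open>s p\<close> is an orbit of pairs of a path class and an element of Sol,
  so the section itself supplies a path from the base point to \<open>p\<close>.\<close>

lemma section_pts:
  assumes s: "smooth_section A x0 \<rho> s" and p: "p \<in> pts A"
  obtains b g where "based b" "s p = q (cls b, g)" "pathfinish b = p"
proof -
  obtain c b O' where cb: "c \<in> A" "b \<in> P" "p \<in> cdom c" "coord c p \<in> O'" "s ` param c ` O' \<subseteq> cdom b"
    using s p unfolding smooth_section_def smooth_map_def by blast
  then have "s (param c (coord c p)) \<in> cdom b" by blast
  then have "s p \<in> cdom b" using cb by simp
  then have "s p \<in> pts P" using cb(2) unfolding pts_def by blast
  then obtain a g where a: "based a" "s p = q (cls a, g)" by (rule bundle_pts_cases)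
  moreover have "bundle_proj (s p) = p" using s p unfolding smooth_section_def by blast
  ultimately show ?thesis using that bundle_proj_quot by simp
qed

lemma section_chart_exists:
  assumes s: "smooth_section A x0 \<rho> s" and d: "d \<in> A" and u: "u \<in> cimg d"
  obtains c B X where "bundle_chart c d B X" "u \<in> B"
proof -
  have "param d u \<in> pts A" using d u cdom_subset [OF d] by auto
  then obtain b g where "based b" "pathfinish b = param d u" using section_pts [OF s] by metis
  then show ?thesis using bundle_chart_over [OF d u] that by metis
qed

text \<open>A bundle chart covers everything over its ball, so it contains the section over the
  whole ball; the section property then fixes the base coordinate.\<close>

lemma section_in_chart:
  assumes s: "smooth_section A x0 \<rho> s" and c: "bundle_chart c d B X" and u: "u \<in> B"
  shows "s (param d u) \<in> cdom c" "fst (coord c (s (param d u))) = u"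
proof -
  have p: "param d u \<in> pts A" using bundle_chartD(2,6) [OF c] u cdom_subset by blast
  obtain b g where b: "based b" "s (param d u) = q (cls b, g)" "pathfinish b = param d u"
    by (rule section_pts [OF s p])
  have "pathfinish b \<in> param d ` B" using b(3) u by blast
  then show m: "s (param d u) \<in> cdom c" using bundle_chart_mem [OF c b(1)] b(2) by simp
  define v where "v = fst (coord c (s (param d u)))"
  have v: "v \<in> B" "param c (v, snd (coord c (s (param d u)))) = s (param d u)"
    using bundle_param_coord [OF c m] by (simp_all add: v_def)
  have "bundle_proj (s (param d u)) = param d v"
    using bundle_chart_proj [OF c v(1), of "snd (coord c (s (param d u)))"] unfolding v(2) .
  then have "param d v = param d u" using s p unfolding smooth_section_def by metis
  then have "coord d (param d v) = coord d (param d u)" by simp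
  then show "fst (coord c (s (param d u))) = u"
    using bundle_chartD(7) [OF c v(1)] bundle_chartD(7) [OF c u] by (simp add: v_def)
qed

text \<open>\<open>smooth_map\<close> speaks of some pair of charts around each point. Transition
  maps on both sides carry differentiability over to the charts \<open>d\<close> and
  \<open>c\<close>.\<close>

lemma section_differentiable:
  assumes s: "smooth_section A x0 \<rho> s" and c: "bundle_chart c d B X" and u: "u \<in> B"
  shows "(\<lambda>u. coord c (s (param d u))) differentiable (at u)"
proof -
  define p where "p = param d u"
  have d: "d \<in> A" and pd: "p \<in> cdom d" "coord d p = u"
    using bundle_chartD(2,6,7) [OF c] u by (simp_all add: p_def)
  have "p \<in> pts A" using pd cdom_subset [OF d] by blast
  then obtain c0 b0 O' where c0: "c0 \<in> A" "p \<in> cdom c0" and b0: "b0 \<in> P"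
    and O': "open O'" "coord c0 p \<in> O'" "O' \<subseteq> cimg c0" "s ` param c0 ` O' \<subseteq> cdom b0"
      "smooth_on O' (coord b0 \<circ> s \<circ> param c0)"
    using s unfolding smooth_section_def smooth_map_def by blast
  obtain d0 B0 X0 where bc0: "bundle_chart b0 d0 B0 X0" using b0 flat_bundle_iff by blast
  have sp: "s p \<in> cdom b0" "s p \<in> cdom c"
  proof -
    have "s (param c0 (coord c0 p)) \<in> cdom b0" using O'(2,4) by blast
    then show "s p \<in> cdom b0" using c0 by simp
    show "s p \<in> cdom c" using section_in_chart(1) [OF s c u] by (simp add: p_def)
  qed
  have 1: "(coord c0 \<circ> param d) differentiable (at u)"
    using transition_differentiable [OF d c0(1) pd(1) c0(2)] pd(2) by simp
  have 2: "(coord b0 \<circ> s \<circ> param c0) differentiable (at ((coord c0 \<circ> param d) u))"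
    using smooth_on_differentiable [OF O'(5,2)] by (simp add: p_def)
  have 3: "(coord c \<circ> param b0) differentiable (at (coord b0 (s p)))"
    by (rule bundle_transition_differentiable [OF bc0 bundle_chartD(1) [OF c] sp])
  have val: "(coord b0 \<circ> s \<circ> param c0) ((coord c0 \<circ> param d) u) = coord b0 (s p)"
    using c0 by (simp add: p_def)
  \<comment> \<open>Here the detour through \<open>c0\<close> and \<open>b0\<close> is defined and
    agrees with the direct expression.\<close>
  define N where "N = coord d ` (cdom d \<inter> cdom c0) \<inter> (coord c0 \<circ> param d) -` O'"
  have N: "open N"
    unfolding N_def
  proof (rule continuous_open_preimage)
    show "continuous_on (coord d ` (cdom d \<inter> cdom c0)) (coord c0 \<circ> param d)"
      using d c0(1) coord_in [OF d]
      by (intro continuous_on_compose continuous_on_subset [OF continuous_param]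
            continuous_on_subset [OF continuous_coord]) auto
    show "open (coord d ` (cdom d \<inter> cdom c0))" by (rule open_overlap [OF d c0(1)])
  qed (fact O')
  have "u = coord d p" "p \<in> cdom d \<inter> cdom c0" "(coord c0 \<circ> param d) u \<in> O'"
    using pd c0(2) O'(2) by (simp_all add: p_def)
  then have uN: "u \<in> N" unfolding N_def by blast
  obtain D1 where D1: "((coord c0 \<circ> param d) has_derivative D1) (at u)"
    using 1 unfolding differentiable_def by blast
  obtain D2 where D2: "((coord b0 \<circ> s \<circ> param c0) has_derivative D2) (at ((coord c0 \<circ> param d) u))"
    using 2 unfolding differentiable_def by blast
  obtain D3 where D3: "((coord c \<circ> param b0) has_derivative D3)
      (at ((coord b0 \<circ> s \<circ> param c0) ((coord c0 \<circ> param d) u)))"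
    using 3 unfolding differentiable_def val by blast
  have "((\<lambda>v. (coord c \<circ> param b0) ((coord b0 \<circ> s \<circ> param c0) ((coord c0 \<circ> param d) v)))
      has_derivative (\<lambda>w. D3 (D2 (D1 w)))) (at u)"
    by (rule has_derivative_compose [OF has_derivative_compose [OF D1 D2] D3])
  then have "((\<lambda>u. coord c (s (param d u))) has_derivative (\<lambda>w. D3 (D2 (D1 w)))) (at u)"
  proof (rule has_derivative_transform_within_open [OF _ N uN])
    fix v assume "v \<in> N"
    then obtain p' where p': "v = coord d p'" "p' \<in> cdom d" "p' \<in> cdom c0" "coord c0 (param d v) \<in> O'"
      unfolding N_def by auto
    have e: "param c0 (coord c0 (param d v)) = param d v" using p' d c0(1) by simp
    then have "s (param d v) \<in> cdom b0" using O'(4) p'(4) by (metis image_eqI subsetD)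
    then have "param b0 (coord b0 (s (param d v))) = s (param d v)"
      by (rule bundle_param_coord(1) [OF bc0])
    then show "(coord c \<circ> param b0) ((coord b0 \<circ> s \<circ> param c0) ((coord c0 \<circ> param d) v)) =
        coord c (s (param d v))"
      using e by simp
  qed
  then show ?thesis unfolding differentiable_def by blast
qed

text \<open>The local map G into Sol whose graph is the section in the chart
  \<open>c\<close>.\<close>

definition fibre_coord ::
  "('m bundle_pt, vec3 \<times> vec3) chart \<Rightarrow> ('m, vec3) chart \<Rightarrow> ('m \<Rightarrow> 'm bundle_pt) \<Rightarrow> vec3 \<Rightarrow> vec3" where
  "fibre_coord c d s u = snd (coord c (s (param d u)))"

definition fibre_deriv ::
  "('m bundle_pt, vec3 \<times> vec3) chart \<Rightarrow> ('m, vec3) chart \<Rightarrow> ('m \<Rightarrow> 'm bundle_pt) \<Rightarrow> vec3 \<Rightarrow> vec3 \<Rightarrow> vec3" where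
  "fibre_deriv c d s u = frechet_derivative (fibre_coord c d s) (at u)"

lemma section_coord:
  assumes "smooth_section A x0 \<rho> s" "bundle_chart c d B X" "u \<in> B"
  shows "coord c (s (param d u)) = (u, fibre_coord c d s u)"
  using section_in_chart(2) [OF assms] by (simp add: fibre_coord_def prod_eq_iff)

lemma fibre_coord_has_derivative:
  assumes "smooth_section A x0 \<rho> s" "bundle_chart c d B X" "u \<in> B"
  shows "(fibre_coord c d s has_derivative fibre_deriv c d s u) (at u)"
proof -
  obtain D where D: "((\<lambda>u. coord c (s (param d u))) has_derivative D) (at u)"
    using section_differentiable [OF assms] unfolding differentiable_def by blast
  have "(fibre_coord c d s has_derivative (\<lambda>v. snd (D v))) (at u)"
    unfolding fibre_coord_def [abs_def] by (rule has_derivative_snd [OF D])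
  then show ?thesis
    unfolding fibre_deriv_def using frechet_derivative_at by metis
qed

lemma pullback_section:
  assumes \<eta>: "\<eta> \<in> forms P k" and s: "smooth_section A x0 \<rho> s"
    and c: "bundle_chart c d B X" and u: "u \<in> B"
  shows "pullback A P s \<eta> d u v = \<eta> c (u, fibre_coord c d s u) (\<lambda>i. (v i, fibre_deriv c d s u (v i)))"
proof -
  have "((\<lambda>u. (u, fibre_coord c d s u)) has_derivative (\<lambda>v. (v, fibre_deriv c d s u v))) (at u)"
    by (rule has_derivative_Pair [OF has_derivative_ident fibre_coord_has_derivative [OF s c u]])
  then have "((\<lambda>u. coord c (s (param d u))) has_derivative (\<lambda>v. (v, fibre_deriv c d s u v))) (at u)"
    by (rule has_derivative_transform_within_open [OF _ bundle_chartD(3) [OF c] u])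
      (simp add: section_coord [OF s c])
  moreover have "u \<in> cimg d" using bundle_chartD(4) [OF c] u by blast
  ultimately show ?thesis
    using pullback_bundle_chart [OF \<eta> bundle_chartD(2) [OF c] _ c bundle_chartD(3) [OF c] u, where f = s]
      section_in_chart(1) [OF s c] section_coord [OF s c u] by simp
qed

text \<open>A vertical vector at (u, g) is a fundamental vector, on which a connection is
  prescribed; passing to its generator does not change the third component.\<close>

lemma connection_vertical:
  assumes \<omega>: "is_connection A x0 \<rho> \<omega>" and c: "bundle_chart c d B X" and u: "u \<in> B"
  shows "\<omega> c (u, g) (\<lambda>_. (0, w)) $ 3 = w $ 3"
proof -
  have \<omega>f: "\<omega> \<in> forms P 1" using \<omega> unfolding is_connection_def by blast
  define p where "p = param c (u, g)"
  \<comment> \<open>The orbit map at (u, g) is left translation by \<open>g\<close>, with derivative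
    \<open>sol_diag (g $ 3)\<close>; the generator of \<open>w\<close> is obtained by inverting
    it.\<close>
  define \<xi> where "\<xi> = sol_diag (- (g $ 3)) w"
  have e: "param (UNIV, id) h = h" for h :: vec3
    by (simp add: param_def cdom_def coord_def inv_id [unfolded id_def])
  have ra: "right_act (param (UNIV, id) h) p = param c (u, sol_mult g h)" for h
    unfolding e p_def by (rule bundle_chart_right_act [OF c u])
  have p: "p \<in> pts P"
    using coord_bundle_param(2) [OF c u] bundle_chartD(1) [OF c] unfolding p_def pts_def by blast
  have "((\<lambda>h. (u, sol_mult g h)) has_derivative (\<lambda>v. (0, sol_diag (g $ 3) v))) (at 0)"
    by (rule has_derivative_Pair [OF has_derivative_const left_translation_has_derivative])
  then have "((\<lambda>h. coord c (right_act (param (UNIV, id) h) p)) has_derivative (\<lambda>v. (0, sol_diag (g $ 3) v))) (at 0)"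
    unfolding ra coord_bundle_param(1) [OF c u] .
  then have "pullback Sol_atlas P (\<lambda>h. right_act h p) \<omega> (UNIV, id) 0 (\<lambda>_. \<xi>) =
      \<omega> c (coord c (right_act (param (UNIV, id) 0) p)) (\<lambda>_. (0, sol_diag (g $ 3) \<xi>))"
  proof (rule pullback_bundle_chart [OF \<omega>f _ _ c open_UNIV UNIV_I, where f = "\<lambda>h. right_act h p", rotated 3])
    show "(UNIV, id) \<in> Sol_atlas" by (simp add: Sol_atlas_def)
    show "(0 :: vec3) \<in> cimg (UNIV, id)" by (simp add: cimg_def cdom_def coord_def)
    show "right_act (param (UNIV, id) h) p \<in> cdom c" for h
      unfolding ra by (rule coord_bundle_param(2) [OF c u])
  qed
  moreover have "pullback Sol_atlas P (\<lambda>h. right_act h p) \<omega> (UNIV, id) 0 (\<lambda>_. \<xi>) = \<xi>"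
    using \<omega> p unfolding is_connection_def by blast
  ultimately have "\<omega> c (u, g) (\<lambda>_. (0, w)) = \<xi>"
    unfolding ra coord_bundle_param(1) [OF c u] by (simp add: \<xi>_def)
  then show ?thesis by (simp add: \<xi>_def)
qed

text \<open>Right translation by \<open>h\<close> takes (u, 0) to (u, h) and keeps the vector (v,
  0). Equivariance then introduces only \<open>Ad\<close>, which preserves third components.\<close>

lemma connection_horizontal:
  assumes \<omega>: "is_connection A x0 \<rho> \<omega>" and c: "bundle_chart c d B X" and u: "u \<in> B"
  shows "\<omega> c (u, h) (\<lambda>_. (v, 0)) $ 3 = \<omega> c (u, 0) (\<lambda>_. (v, 0)) $ 3"
proof -
  have \<omega>f: "\<omega> \<in> forms P 1" using \<omega> unfolding is_connection_def by blast
  obtain R where R: "((\<lambda>g. sol_mult g h) has_derivative R) (at (0 :: vec3))"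
    using right_translation_differentiable unfolding differentiable_def by blast
  have R0: "R 0 = 0" using has_derivative_linear [OF R] by (rule linear_0)
  have N: "open (B \<times> (UNIV :: vec3 set))" "(u, 0) \<in> B \<times> UNIV"
    using bundle_chartD(3) [OF c] u by (simp_all add: open_Times)
  have ra: "right_act h (param c y) = param c (fst y, sol_mult (snd y) h)" if "y \<in> B \<times> UNIV" for y
    using bundle_chart_right_act [OF c, of "fst y" h "snd y"] that by auto
  have "((\<lambda>y. (fst y, sol_mult (snd y) h)) has_derivative (\<lambda>v. (fst v, R (snd v)))) (at (u, 0))"
    by (rule has_derivative_prod_split) (simp_all add: R)
  then have "((\<lambda>y. coord c (right_act h (param c y))) has_derivative (\<lambda>v. (fst v, R (snd v)))) (at (u, 0))"
  proof (rule has_derivative_transform_within_open [OF _ N])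
    show "(fst y, sol_mult (snd y) h) = coord c (right_act h (param c y))" if "y \<in> B \<times> UNIV" for y
      using that coord_bundle_param(1) [OF c, of "fst y"] by (auto simp: ra)
  qed
  then have "pullback P P (right_act h) \<omega> c (u, 0) (\<lambda>_. (v, 0)) =
      \<omega> c (coord c (right_act h (param c (u, 0)))) (\<lambda>_. (fst (v, 0::vec3), R (snd (v, 0))))"
  proof (rule pullback_bundle_chart [OF \<omega>f _ _ c N, rotated 3])
    show "c \<in> P" "(u, 0) \<in> cimg c" using bundle_chartD(1,5) [OF c] u by simp_all
    show "right_act h (param c y) \<in> cdom c" if "y \<in> B \<times> UNIV" for y
      unfolding ra [OF that] using that coord_bundle_param(2) [OF c, of "fst y"] by auto
  qed
  moreover have "coord c (right_act h (param c (u, 0))) = (u, h)"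
    unfolding ra [OF N(2)] using coord_bundle_param(1) [OF c u] by simp
  moreover have "pullback P P (right_act h) \<omega> = (\<lambda>c y v. Ad (m_inv Sol h) (\<omega> c y v))"
    using \<omega> unfolding is_connection_def by blast
  ultimately have "\<omega> c (u, h) (\<lambda>_. (v, 0)) = Ad (m_inv Sol h) (\<omega> c (u, 0) (\<lambda>_. (v, 0)))"
    by (simp add: R0)
  then show ?thesis by (simp add: Ad_nth3)
qed

text \<open>In a chart, the Z-component of any connection is a form on the base plus the third fibre
  component. The second summand is common to all connections and drops out of differences.\<close>

lemma connection_nth3:
  assumes \<omega>: "is_connection A x0 \<rho> \<omega>" and c: "bundle_chart c d B X" and u: "u \<in> B"
  shows "\<omega> c (u, g) w $ 3 = \<omega> c (u, 0) (\<lambda>_. (fst (w 0), 0)) $ 3 + snd (w 0) $ 3"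
proof -
  have \<omega>f: "\<omega> \<in> forms P 1" using \<omega> unfolding is_connection_def by blast
  have "(u, g) \<in> cimg c" using bundle_chartD(5) [OF c] u by simp
  then have L: "linear (\<lambda>x. \<omega> c (u, g) (\<lambda>_. x))"
    using alternating_multilinear_1D(2) [OF formsD(1) [OF \<omega>f bundle_chartD(1) [OF c]]] by blast
  have "w 0 = (fst (w 0), 0) + (0, snd (w 0))" by simp
  then have "\<omega> c (u, g) w = \<omega> c (u, g) (\<lambda>_. (fst (w 0), 0) + (0, snd (w 0)))"
    using forms_1_eq [OF \<omega>f, of c "(u, g)" w] by simp
  also have "\<dots> = \<omega> c (u, g) (\<lambda>_. (fst (w 0), 0)) + \<omega> c (u, g) (\<lambda>_. (0, snd (w 0)))"
    by (rule linear_add [OF L])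
  finally show ?thesis
    using connection_vertical [OF \<omega> c u] connection_horizontal [OF \<omega> c u] by simp
qed

end


section \<open>The Chern--Simons form\<close>

lemma wedge_by_p_form:
  "wedge_by (p_form r) k l \<alpha> \<beta> c y v =
     r * wedge_by (*) k l (\<lambda>c y v. \<alpha> c y v $ 3) (\<lambda>c y v. \<beta> c y v $ 3) c y v"
  unfolding wedge_by_def p_form_def by (simp add: sum_distrib_left algebra_simps)

lemma wedge_by_lie_bracket_nth3: "wedge_by lie_bracket k l \<alpha> \<beta> c y v $ 3 = 0"
  unfolding wedge_by_def lie_bracket_def X_sol_def Y_sol_def
  by (simp add: axis_def)

lemma wedge_by_zero_right:
  assumes "\<And>v. \<beta> c y v = 0"
  shows "wedge_by ((*) :: real \<Rightarrow> real \<Rightarrow> real) k l \<alpha> \<beta> c y v = 0"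
  unfolding wedge_by_def assms by simp

text \<open>Third components of brackets vanish, which removes the cubic term, the bracket in the
  covariant derivative and the bracket in the curvature; the hypothesis removes the rest of the
  curvature.\<close>

lemma CS_total_p_form:
  assumes "\<And>v. ext_d Q 1 \<omega>0 c y v $ 3 = 0"
  shows "CS_total Q (p_form r) \<omega>1 \<omega>0 c y v =
    r * wedge_by (*) 1 2 (\<lambda>c y v. (\<omega>1 c y v - \<omega>0 c y v) $ 3)
      (\<lambda>c y v. ext_d Q 1 (\<lambda>c y v. \<omega>1 c y v - \<omega>0 c y v) c y v $ 3) c y v"
proof -
  have 2: "wedge_by (*) 1 2 \<alpha> (\<lambda>c y v. wedge_by lie_bracket 1 1 a a c y v $ 3) c y v = 0" for \<alpha> a
    by (rule wedge_by_zero_right) (rule wedge_by_lie_bracket_nth3)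
  have 3: "wedge_by (*) 1 2 \<alpha> (\<lambda>c y v. curvature Q \<omega>0 c y v $ 3) c y v = 0" for \<alpha>
    by (rule wedge_by_zero_right) (simp add: curvature_def assms [unfolded One_nat_def] wedge_by_lie_bracket_nth3)
  show ?thesis
    unfolding CS_total_def Let_def wedge_by_p_form 2 3
    by (simp add: wedge_by_lie_bracket_nth3)
qed

text \<open>A multiple of \<alpha> \<and> \<beta> \<and> \<gamma>, needed for the existence half of
  \<open>CS\<close>. Evaluating the 1-forms on constant tuples makes alternation a polynomial
  identity.\<close>

lemma det_form_in_forms:
  fixes \<alpha> \<beta> \<gamma> :: "('a, 'e::euclidean_space, real) form"
  assumes o: "\<And>c. c \<in> A \<Longrightarrow> open (cimg c)"
    and \<alpha>: "\<alpha> \<in> forms A 1" and \<beta>: "\<beta> \<in> forms A 1" and \<gamma>: "\<gamma> \<in> forms A 1"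
  shows "(\<lambda>c y v. r * (
      (\<alpha> c y (\<lambda>_. v 0) * \<beta> c y (\<lambda>_. v 1) - \<alpha> c y (\<lambda>_. v 1) * \<beta> c y (\<lambda>_. v 0)) * \<gamma> c y (\<lambda>_. v 2)
    - (\<alpha> c y (\<lambda>_. v 0) * \<beta> c y (\<lambda>_. v 2) - \<alpha> c y (\<lambda>_. v 2) * \<beta> c y (\<lambda>_. v 0)) * \<gamma> c y (\<lambda>_. v 1)
    + (\<alpha> c y (\<lambda>_. v 1) * \<beta> c y (\<lambda>_. v 2) - \<alpha> c y (\<lambda>_. v 2) * \<beta> c y (\<lambda>_. v 1)) * \<gamma> c y (\<lambda>_. v 0)))
    \<in> forms A 3" (is "?\<Delta> \<in> _")
proof -
  have "alternating_multilinear 3 (?\<Delta> c y)" if cy: "c \<in> A" "y \<in> cimg c" for c y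
  proof (rule alternating_multilinearI)
    have L: "linear (\<lambda>x. \<alpha> c y (\<lambda>_. x))" "linear (\<lambda>x. \<beta> c y (\<lambda>_. x))" "linear (\<lambda>x. \<gamma> c y (\<lambda>_. x))"
      using alternating_multilinear_1D(2) [OF formsD(1) [OF \<alpha> cy]]
        alternating_multilinear_1D(2) [OF formsD(1) [OF \<beta> cy]]
        alternating_multilinear_1D(2) [OF formsD(1) [OF \<gamma> cy]] by blast+
    note S = linear_add [OF L(1)] linear_add [OF L(2)] linear_add [OF L(3)]
      linear_scale [OF L(1)] linear_scale [OF L(2)] linear_scale [OF L(3)]
    have lt: "i < 3 \<longleftrightarrow> i = 0 \<or> i = 1 \<or> i = 2" for i :: nat by auto
    show "linear (\<lambda>x. ?\<Delta> c y (v(i := x)))" if "i < 3" for v i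
      using that unfolding lt by (elim disjE) (simp_all add: linear_iff S algebra_simps)
    show "?\<Delta> c y v = 0" if "i < 3" "j < 3" "i \<noteq> j" "v i = v j" for v i j
      using that unfolding lt by (elim disjE) (simp_all add: algebra_simps)
    show "?\<Delta> c y v = ?\<Delta> c y w" if "\<forall>i<3. v i = w i" for v w
      using that by simp
  qed
  moreover have "smooth_on (cimg c) (\<lambda>y. ?\<Delta> c y v)" if c: "c \<in> A" for c v
    by (intro smooth_on_add smooth_on_diff smooth_on_mult smooth_on_const o c
        formsD(2) [OF \<alpha> c] formsD(2) [OF \<beta> c] formsD(2) [OF \<gamma> c])
  moreover have "?\<Delta> c (coord c p) v =
      ?\<Delta> b (coord b p) (\<lambda>i. frechet_derivative (coord b \<circ> param c) (at (coord c p)) (v i))"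
    if "c \<in> A" "b \<in> A" "p \<in> cdom c" "p \<in> cdom b" for c b p v
    using formsD(3) [OF \<alpha> that] formsD(3) [OF \<beta> that] formsD(3) [OF \<gamma> that] by simp
  moreover have "?\<Delta> c y v = 0" if "\<not> (c \<in> A \<and> y \<in> cimg c)" for c y v
    using formsD(4) [OF \<gamma> that] by simp
  ultimately show ?thesis unfolding forms_def by blast
qed

locale aux_connection_data = flat_data A x0 \<rho>
  for A :: "('m::topological_space, vec3) atlas" and x0 :: 'm and \<rho> :: "'m cover_pt \<Rightarrow> vec3" +
  fixes s :: "'m \<Rightarrow> 'm bundle_pt"
    and \<omega>s :: "('m bundle_pt, vec3 \<times> vec3, vec3) form"
    and \<alpha> \<beta> \<gamma> :: "('m, vec3, real) form"
  assumes s: "smooth_section A x0 \<rho> s"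
    and conn: "is_connection A x0 \<rho> \<omega>s"
    and coframe: "\<alpha> \<in> forms A 1" "\<beta> \<in> forms A 1" "\<gamma> \<in> forms A 1"
    and pullback_flat: "pullback A (flat_bundle A x0 \<rho>) s (flat_connection A x0 \<rho>) =
      (\<lambda>c y v. \<alpha> c y v *\<^sub>R X_sol + \<beta> c y v *\<^sub>R Y_sol + \<gamma> c y v *\<^sub>R Z_sol)"
    and pullback_aux: "pullback A (flat_bundle A x0 \<rho>) s \<omega>s = (\<lambda>c y v. (\<alpha> c y v + \<beta> c y v) *\<^sub>R Z_sol)"
begin

section \<open>Local computation with the pulled-back coframe\<close>

abbreviation \<theta> :: "('m bundle_pt, vec3 \<times> vec3, vec3) form" where
  "\<theta> \<equiv> flat_connection A x0 \<rho>"

definition \<delta> :: "('m, vec3) chart \<Rightarrow> vec3 \<Rightarrow> vec3 \<Rightarrow> real" where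
  "\<delta> d u x = \<alpha> d u (\<lambda>_. x) + \<beta> d u (\<lambda>_. x) - \<gamma> d u (\<lambda>_. x)"

text \<open>The form \<alpha> \<and> \<beta> \<and> \<gamma>, as a 3 by 3 determinant expanded along
  \<gamma>.\<close>

definition coframe_det :: "('m, vec3, real) form" where
  "coframe_det d u v =
      (\<alpha> d u (\<lambda>_. v 0) * \<beta> d u (\<lambda>_. v 1) - \<alpha> d u (\<lambda>_. v 1) * \<beta> d u (\<lambda>_. v 0)) * \<gamma> d u (\<lambda>_. v 2)
    - (\<alpha> d u (\<lambda>_. v 0) * \<beta> d u (\<lambda>_. v 2) - \<alpha> d u (\<lambda>_. v 2) * \<beta> d u (\<lambda>_. v 0)) * \<gamma> d u (\<lambda>_. v 1)
    + (\<alpha> d u (\<lambda>_. v 1) * \<beta> d u (\<lambda>_. v 2) - \<alpha> d u (\<lambda>_. v 2) * \<beta> d u (\<lambda>_. v 1)) * \<gamma> d u (\<lambda>_. v 0)"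

lemma flat_connection_chart:
  assumes "bundle_chart c d B X" "u \<in> B"
  shows "\<theta> c (u, g) w = sol_diag (- (g $ 3)) (snd (w 0))"
  unfolding flat_connection_eq lift_form_chart [OF assms] mc_form_eq ..

lemma flat_connection_in_forms: "\<theta> \<in> forms P 1"
  unfolding flat_connection_eq by (rule lift_mc_form)

lemma conn_in_forms: "\<omega>s \<in> forms P 1"
  using conn unfolding is_connection_def by blast

lemma coframe_chart:
  assumes c: "bundle_chart c d B X" and u: "u \<in> B"
  shows "\<alpha> d u v = exp (fibre_coord c d s u $ 3) * fibre_deriv c d s u (v 0) $ 1"
    and "\<beta> d u v = exp (- (fibre_coord c d s u $ 3)) * fibre_deriv c d s u (v 0) $ 2"
    and "\<gamma> d u v = fibre_deriv c d s u (v 0) $ 3"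
proof -
  have "\<alpha> d u v *\<^sub>R X_sol + \<beta> d u v *\<^sub>R Y_sol + \<gamma> d u v *\<^sub>R Z_sol =
      sol_diag (- (fibre_coord c d s u $ 3)) (fibre_deriv c d s u (v 0))"
    using fun_cong [OF fun_cong [OF fun_cong [OF pullback_flat, of d], of u], of v]
      pullback_section [OF flat_connection_in_forms s c u, of v]
    by (simp add: flat_connection_chart [OF c u])
  note e = this [unfolded vec_eq_iff forall_3 X_sol_def Y_sol_def Z_sol_def]
  show "\<alpha> d u v = exp (fibre_coord c d s u $ 3) * fibre_deriv c d s u (v 0) $ 1"
    "\<beta> d u v = exp (- (fibre_coord c d s u $ 3)) * fibre_deriv c d s u (v 0) $ 2"
    "\<gamma> d u v = fibre_deriv c d s u (v 0) $ 3"
    using e by (simp_all add: axis_def)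
qed

text \<open>By \<open>connection_nth3\<close> the left side depends on neither \<open>g\<close> nor
  the vertical part of \<open>w\<close>, so it can be evaluated on the image of the section, where
  \<open>pullback_aux\<close> and \<open>coframe_chart\<close> give its value.\<close>

lemma connection_difference:
  assumes c: "bundle_chart c d B X" and u: "u \<in> B"
  shows "(\<omega>s c (u, g) w - \<theta> c (u, g) w) $ 3 = \<delta> d u (fst (w 0))"
proof -
  have "\<omega>s c (u, fibre_coord c d s u) (\<lambda>_. (fst (w 0), fibre_deriv c d s u (fst (w 0)))) =
      (\<alpha> d u (\<lambda>_. fst (w 0)) + \<beta> d u (\<lambda>_. fst (w 0))) *\<^sub>R Z_sol"
    using fun_cong [OF fun_cong [OF fun_cong [OF pullback_aux, of d], of u], of "\<lambda>_. fst (w 0)"]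
      pullback_section [OF conn_in_forms s c u, of "\<lambda>_. fst (w 0)"] by simp
  then have "\<omega>s c (u, fibre_coord c d s u) (\<lambda>_. (fst (w 0), fibre_deriv c d s u (fst (w 0)))) $ 3 =
      \<alpha> d u (\<lambda>_. fst (w 0)) + \<beta> d u (\<lambda>_. fst (w 0))"
    by (simp add: Z_sol_def axis_def)
  then show ?thesis
    using coframe_chart(3) [OF c u, of "\<lambda>_. fst (w 0)"]
      connection_nth3 [OF conn c u, of g w]
      connection_nth3 [OF conn c u, of "fibre_coord c d s u" "\<lambda>_. (fst (w 0), fibre_deriv c d s u (fst (w 0)))"]
    by (simp add: \<delta>_def flat_connection_chart [OF c u])
qed

text \<open>The Maurer--Cartan equations \<open>d\<alpha> = - \<alpha> \<and> \<gamma>\<close>, \<open>d\<beta> = \<beta> \<and> \<gamma>\<close> and \<open>d\<gamma> = 0\<close> enter here.\<close>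

lemma ext_d_coframe:
  assumes d: "d \<in> A" and u: "u \<in> cimg d"
  shows "frechet_derivative (\<lambda>u. \<delta> d u y) (at u) x - frechet_derivative (\<lambda>u. \<delta> d u x) (at u) y =
    \<gamma> d u (\<lambda>_. x) * \<alpha> d u (\<lambda>_. y) - \<gamma> d u (\<lambda>_. y) * \<alpha> d u (\<lambda>_. x)
    - (\<gamma> d u (\<lambda>_. x) * \<beta> d u (\<lambda>_. y) - \<gamma> d u (\<lambda>_. y) * \<beta> d u (\<lambda>_. x))"
proof -
  obtain c B X where c: "bundle_chart c d B X" and uB: "u \<in> B" by (rule section_chart_exists [OF s d u])
  define G where "G = fibre_coord c d s"
  define DG where "DG = fibre_deriv c d s"
  have B: "open B" by (rule bundle_chartD(3) [OF c])
  have G: "((\<lambda>u. G u $ i) has_derivative (\<lambda>x. DG v x $ i)) (at v)" if "v \<in> B" for v i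
    unfolding G_def DG_def
    by (rule bounded_linear.has_derivative [OF bounded_linear_vec_nth fibre_coord_has_derivative [OF s c that]])
  note cf = coframe_chart [OF c, folded G_def DG_def]
  have diff: "(\<lambda>u. \<omega> d u (\<lambda>_. x)) differentiable (at u)" if "\<omega> \<in> forms A 1" for \<omega> :: "('m, vec3, real) form" and x
    by (rule smooth_on_differentiable [OF formsD(2) [OF that d] u])
  note da = diff [OF coframe(1)] and db = diff [OF coframe(2)] and dc = diff [OF coframe(3)]
  \<comment> \<open>\<alpha> = exp(G3) dG1, so k = 1; for \<beta> = exp(-G3) dG2 below, k =
    -1.\<close>
  have a: "frechet_derivative (\<lambda>u. \<alpha> d u (\<lambda>_. y)) (at u) x - frechet_derivative (\<lambda>u. \<alpha> d u (\<lambda>_. x)) (at u) y =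
      1 * (\<gamma> d u (\<lambda>_. x) * \<alpha> d u (\<lambda>_. y) - \<gamma> d u (\<lambda>_. y) * \<alpha> d u (\<lambda>_. x))"
    unfolding cf(3) [OF uB]
    by (rule exterior_derivative_exp_mult [where f = "\<lambda>u. G u $ 1" and Df = "\<lambda>u x. DG u x $ 1" and z = "\<lambda>u. G u $ 3",
          OF B uB G G [OF uB] _ da]) (simp_all add: cf)
  have b: "frechet_derivative (\<lambda>u. \<beta> d u (\<lambda>_. y)) (at u) x - frechet_derivative (\<lambda>u. \<beta> d u (\<lambda>_. x)) (at u) y =
      (-1) * (\<gamma> d u (\<lambda>_. x) * \<beta> d u (\<lambda>_. y) - \<gamma> d u (\<lambda>_. y) * \<beta> d u (\<lambda>_. x))"
    unfolding cf(3) [OF uB]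
    by (rule exterior_derivative_exp_mult [where f = "\<lambda>u. G u $ 2" and Df = "\<lambda>u x. DG u x $ 2" and z = "\<lambda>u. G u $ 3",
          OF B uB G G [OF uB] _ db]) (simp_all add: cf)
  \<comment> \<open>With k = 0 the same lemma says that \<gamma> = dG3 is closed.\<close>
  have g: "frechet_derivative (\<lambda>u. \<gamma> d u (\<lambda>_. y)) (at u) x - frechet_derivative (\<lambda>u. \<gamma> d u (\<lambda>_. x)) (at u) y =
      0 * (DG u x $ 3 * \<gamma> d u (\<lambda>_. y) - DG u y $ 3 * \<gamma> d u (\<lambda>_. x))"
    by (rule exterior_derivative_exp_mult [where f = "\<lambda>u. G u $ 3" and Df = "\<lambda>u x. DG u x $ 3" and z = "\<lambda>u. G u $ 3",
          OF B uB G G [OF uB] _ dc]) (simp_all add: cf)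
  have "frechet_derivative (\<lambda>u. \<delta> d u y) (at u) x = frechet_derivative (\<lambda>u. \<alpha> d u (\<lambda>_. y)) (at u) x
      + frechet_derivative (\<lambda>u. \<beta> d u (\<lambda>_. y)) (at u) x - frechet_derivative (\<lambda>u. \<gamma> d u (\<lambda>_. y)) (at u) x" for x y
  proof -
    have "((\<lambda>u. \<delta> d u y) has_derivative (\<lambda>x. frechet_derivative (\<lambda>u. \<alpha> d u (\<lambda>_. y)) (at u) x
      + frechet_derivative (\<lambda>u. \<beta> d u (\<lambda>_. y)) (at u) x - frechet_derivative (\<lambda>u. \<gamma> d u (\<lambda>_. y)) (at u) x)) (at u)"
      unfolding \<delta>_def using da [of y] db [of y] dc [of y] unfolding frechet_derivative_works
      by (intro has_derivative_diff has_derivative_add)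
    from fun_cong [OF frechet_derivative_at [OF this], of x] show ?thesis by (rule sym)
  qed
  then show ?thesis using a b g by simp
qed

lemma delta_differentiable:
  assumes d: "d \<in> A" and u: "u \<in> cimg d"
  shows "(\<lambda>u. \<delta> d u x) differentiable (at u)"
  unfolding \<delta>_def
  by (intro differentiable_add differentiable_diff smooth_on_differentiable [OF _ u]
      formsD(2) [OF coframe(1) d] formsD(2) [OF coframe(2) d] formsD(2) [OF coframe(3) d])

lemma CS_total_chart:
  assumes c: "bundle_chart c d B X" and u: "u \<in> B"
  shows "CS_total P (p_form r) \<omega>s \<theta> c (u, g) v = 2 * r * coframe_det d u (\<lambda>i. fst (v i))"
proof -
  let ?a = "\<lambda>c y v. \<omega>s c y v - \<theta> c y v"
  have cP: "c \<in> P" "(u, g) \<in> cimg c" "d \<in> A" "u \<in> cimg d"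
    using bundle_chartD(1,2,4,5) [OF c] u by auto
  have N: "open (B \<times> (UNIV :: vec3 set))" "(u, g) \<in> B \<times> UNIV"
    using bundle_chartD(3) [OF c] u by (simp_all add: open_Times)
  have diff: "(\<lambda>z. \<omega> c z w) differentiable (at (u, g))" if "\<omega> \<in> forms P 1"
    for \<omega> :: "('m bundle_pt, vec3 \<times> vec3, vec3) form" and w
    by (rule smooth_on_differentiable [OF formsD(2) [OF that cP(1)] cP(2)])
  note dt = diff [OF flat_connection_in_forms]
  have da: "(\<lambda>z. ?a c z w) differentiable (at (u, g))" for w
    by (rule differentiable_diff [OF diff [OF conn_in_forms] dt])
  \<comment> \<open>In the chart the Z-component of \<theta> is the third fibre component of the
    vector alone, constant in the point.\<close>
  have "frechet_derivative (\<lambda>z. \<theta> c z w) (at (u, g)) x $ 3 = 0" for w x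
  proof -
    have "((\<lambda>z. \<theta> c z w $ 3) has_derivative (\<lambda>_. 0)) (at (u, g))"
      by (rule has_derivative_transform_within_open [OF has_derivative_const [of "snd (w 0) $ 3"] N])
        (auto simp: flat_connection_chart [OF c])
    from fun_cong [OF frechet_derivative_at [OF this], of x] show ?thesis
      unfolding frechet_derivative_nth [OF dt, symmetric] by (rule sym)
  qed
  then have curv: "ext_d P 1 \<theta> c (u, g) w $ 3 = 0" for w
    using ext_d_1 [OF cP(1,2), of \<theta> w] forms_1_eq [OF flat_connection_in_forms] by simp
  \<comment> \<open>The Z-component of the difference depends on the base coordinate only, so its
    exterior derivative is that of \<delta>.\<close>
  have D: "frechet_derivative (\<lambda>z. ?a c z (\<lambda>_. w)) (at (u, g)) x $ 3 =
      frechet_derivative (\<lambda>u. \<delta> d u (fst w)) (at u) (fst x)" for w x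
  proof -
    have \<delta>': "((\<lambda>u. \<delta> d u (fst w)) has_derivative frechet_derivative (\<lambda>u. \<delta> d u (fst w)) (at u)) (at (fst (u, g)))"
      using delta_differentiable [OF cP(3,4)] unfolding frechet_derivative_works by simp
    have "((\<lambda>z. \<delta> d (fst z) (fst w)) has_derivative
        (\<lambda>x. frechet_derivative (\<lambda>u. \<delta> d u (fst w)) (at u) (fst x))) (at (u, g))"
      by (rule has_derivative_compose [OF has_derivative_fst [OF has_derivative_ident] \<delta>'])
    then have "((\<lambda>z. ?a c z (\<lambda>_. w) $ 3) has_derivative
        (\<lambda>x. frechet_derivative (\<lambda>u. \<delta> d u (fst w)) (at u) (fst x))) (at (u, g))"
    proof (rule has_derivative_transform_within_open [OF _ N])
      show "\<delta> d (fst z) (fst w) = ?a c z (\<lambda>_. w) $ 3" if "z \<in> B \<times> UNIV" for z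
        using connection_difference [OF c, of "fst z" "snd z" "\<lambda>_. w"] that by auto
    qed
    from fun_cong [OF frechet_derivative_at [OF this], of x] show ?thesis
      unfolding frechet_derivative_nth [OF da, symmetric] by (rule sym)
  qed
  have aeq: "?a c z w = ?a c z (\<lambda>_. w 0)" for z w
    using forms_1_eq [OF conn_in_forms, of c z w] forms_1_eq [OF flat_connection_in_forms, of c z w] by simp
  let ?E = "\<lambda>x y. \<gamma> d u (\<lambda>_. x) * \<alpha> d u (\<lambda>_. y) - \<gamma> d u (\<lambda>_. y) * \<alpha> d u (\<lambda>_. x)
    - (\<gamma> d u (\<lambda>_. x) * \<beta> d u (\<lambda>_. y) - \<gamma> d u (\<lambda>_. y) * \<beta> d u (\<lambda>_. x))"
  have ext: "ext_d P 1 ?a c (u, g) w $ 3 = ?E (fst (w 0)) (fst (w 1))" for w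
    unfolding ext_d_1 [where \<omega> = ?a, OF cP(1,2) aeq] vector_minus_component D ext_d_coframe [OF cP(3,4)] ..
  have "CS_total P (p_form r) \<omega>s \<theta> c (u, g) v =
    r * wedge_by (*) 1 2 (\<lambda>c y v. ?a c y v $ 3) (\<lambda>c y v. ext_d P 1 ?a c y v $ 3) c (u, g) v"
    by (rule CS_total_p_form [OF curv])
  also have "wedge_by (*) 1 2 (\<lambda>c y v. ?a c y v $ 3) (\<lambda>c y v. ext_d P 1 ?a c y v $ 3) c (u, g) v =
      2 * coframe_det d u (\<lambda>i. fst (v i))"
    unfolding wedge_by_1_2 [where \<alpha> = "\<lambda>c y v. ?a c y v $ 3" and \<beta> = "\<lambda>c y v. ext_d P 1 ?a c y v $ 3" and c = c and y = "(u, g)"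
        and a = "\<lambda>x. \<delta> d u (fst x)" and
        b = "\<lambda>x y. ?E (fst x) (fst y)",
        OF connection_difference [OF c u] ext]
    \<comment> \<open>This is \<delta> \<and> d\<delta>: products with a repeated factor cancel, and
      \<alpha> \<and> d\<beta> and \<beta> \<and> d\<alpha> each give the determinant.\<close>
    unfolding \<delta>_def coframe_det_def
    by (simp add: field_simps)
  finally show ?thesis by simp
qed

text \<open>The left side is the determinant of the derivative of G. The coframe rescales its first
  two rows by exp(G3) and exp(-G3), which cancel.\<close>

lemma pullback_vol:
  assumes d: "d \<in> A" and u: "u \<in> cimg d"
  shows "pullback A P s (vol_bundle A x0 \<rho>) d u v = coframe_det d u v"
proof -
  obtain c B X where c: "bundle_chart c d B X" and uB: "u \<in> B" by (rule section_chart_exists [OF s d u])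
  have e: "exp x * a * (exp (- x) * b) = a * b" for x a b :: real by (simp add: exp_minus)
  have V: "vol_bundle A x0 \<rho> \<in> forms P 3" unfolding vol_bundle_eq by (rule lift_vol_Sol)
  have "pullback A P s (vol_bundle A x0 \<rho>) d u v =
      vol_Sol (UNIV, id) (fibre_coord c d s u) (\<lambda>i. fibre_deriv c d s u (v i))"
    unfolding pullback_section [OF V s c uB] unfolding vol_bundle_eq lift_form_chart [OF c uB] by simp
  also have "\<dots> = coframe_det d u v"
    unfolding vol_Sol_eq coframe_det_def coframe_chart [OF c uB] e ..
  finally show ?thesis .
qed

lemma pullback_vol_eq: "(\<lambda>d y v. r * pullback A P s (vol_bundle A x0 \<rho>) d y v) = (\<lambda>d y v. r * coframe_det d y v)"
proof (intro ext)
  show "r * pullback A P s (vol_bundle A x0 \<rho>) d y v = r * coframe_det d y v" for d y v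
  proof (cases "d \<in> A \<and> y \<in> cimg d")
    case True
    then show ?thesis using pullback_vol by simp
  next
    case False
    \<comment> \<open>Equality as functions includes the points off the chart images; the default
      value 0 of \<gamma> already annihilates each term of the determinant.\<close>
    then have "\<gamma> d y w = 0" for w by (rule formsD(4) [OF coframe(3)])
    then have "coframe_det d y v = 0" by (simp add: coframe_det_def)
    moreover have "pullback A P s (vol_bundle A x0 \<rho>) d y v = 0"
      unfolding pullback_def using False by (rule if_not_P)
    ultimately show ?thesis by simp
  qed
qed

lemma coframe_det_in_forms: "(\<lambda>d y v. r * coframe_det d y v) \<in> forms A 3"
  unfolding coframe_det_def by (rule det_form_in_forms [OF open_cimg coframe])

text \<open>Existence is \<open>CS_total_chart\<close>. For uniqueness, pullback along the
  projection must lose nothing: every base point lies under a bundle chart, provided by the section,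
  and every base vector lifts.\<close>

lemma CS_eq:
  "CS A x0 \<rho> (p_form r) \<omega>s \<theta> = (\<lambda>d y v. 2 * r * coframe_det d y v)"
proof -
  let ?\<eta> = "\<lambda>d y v. 2 * r * coframe_det d y v"
  have "pullback P A bundle_proj ?\<eta> c y v = CS_total P (p_form r) \<omega>s \<theta> c y v" for c y v
  proof (cases "c \<in> P \<and> y \<in> cimg c")
    case True
    then obtain d B X where c: "bundle_chart c d B X" using flat_bundle_iff by blast
    then have y: "fst y \<in> B" using True bundle_chartD(5) [OF c] by auto
    show ?thesis
      using pullback_bundle_proj [OF coframe_det_in_forms c y, of "2 * r" "snd y" v]
        CS_total_chart [OF c y, of r "snd y" v] by simp
  next
    case False
    \<comment> \<open>Each term of \<open>CS_total\<close> contains the difference of the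
      connections as a factor, and it is 0 here.\<close>
    then have "\<omega>s c y w = 0" "\<theta> c y w = 0" for w
      using formsD(4) [OF conn_in_forms] formsD(4) [OF flat_connection_in_forms] by blast+
    then have "CS_total P (p_form r) \<omega>s \<theta> c y v = 0"
      by (simp add: CS_total_def Let_def wedge_by_def p_form_def)
    moreover have "pullback P A bundle_proj ?\<eta> c y v = 0"
      using False unfolding pullback_def by (rule if_not_P)
    ultimately show ?thesis by simp
  qed
  then have pb: "pullback P A bundle_proj ?\<eta> = CS_total P (p_form r) \<omega>s \<theta>" by (intro ext)
  have "\<eta> = ?\<eta>" if \<eta>: "\<eta> \<in> forms A 3" "pullback P A bundle_proj \<eta> = CS_total P (p_form r) \<omega>s \<theta>" for \<eta>
  proof (intro ext)
    fix d u v
    show "\<eta> d u v = ?\<eta> d u v"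
    proof (cases "d \<in> A \<and> u \<in> cimg d")
      case True
      then obtain c B X where c: "bundle_chart c d B X" and u: "u \<in> B"
        using section_chart_exists [OF s, of d u] by blast
      \<comment> \<open>The lift of \<open>v\<close> with zero fibre components, at the identity of
        the fibre; any other lift would do.\<close>
      have "\<eta> d u v = pullback P A bundle_proj \<eta> c (u, 0) (\<lambda>i. (v i, 0))"
        using pullback_bundle_proj [OF \<eta>(1) c u] by simp
      also have "\<dots> = pullback P A bundle_proj ?\<eta> c (u, 0) (\<lambda>i. (v i, 0))"
        unfolding \<eta>(2) pb ..
      also have "\<dots> = ?\<eta> d u v"
        using pullback_bundle_proj [OF coframe_det_in_forms c u] by simp
      finally show ?thesis .
    next
      case False
      then show ?thesis
        using formsD(4) [OF \<eta>(1) False] formsD(4) [OF coframe_det_in_forms False, of "2 * r"] by metis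
    qed
  qed
  then show ?thesis
    unfolding CS_def using coframe_det_in_forms [of "2 * r"] pb by (intro the_equality) blast+
qed

end

theorem proposition4p2:
  fixes A :: "('m::topological_space, real^3) atlas"
    and x0 :: 'm
    and \<rho> :: "(real \<Rightarrow> 'm) set \<Rightarrow> real^3"
    and c :: real
    and s :: "'m \<Rightarrow> 'm bundle_pt"
    and \<omega>s :: "('m bundle_pt, vec3 \<times> vec3, real^3) form"
  assumes "closed_oriented_3manifold A"
    and "connected (pts A)"
    and "x0 \<in> pts A"
    and "\<rho> \<in> hom (fundamental_group (pts A) x0) Sol"
    and "smooth_section A x0 \<rho> s"
    and "is_aux_connection A x0 \<rho> s \<omega>s"
  shows "CS A x0 \<rho> (p_form c) \<omega>s (flat_connection A x0 \<rho>) \<in> forms A 3 \<and>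
         CS A x0 \<rho> (p_form c) \<omega>s (flat_connection A x0 \<rho>) =
           (\<lambda>d y v. 2 * c * pullback A (flat_bundle A x0 \<rho>) s (vol_bundle A x0 \<rho>) d y v)"
proof -
  obtain \<alpha> \<beta> \<gamma> where cf: "\<alpha> \<in> forms A 1" "\<beta> \<in> forms A 1" "\<gamma> \<in> forms A 1"
    "pullback A (flat_bundle A x0 \<rho>) s (flat_connection A x0 \<rho>) =
      (\<lambda>c y v. \<alpha> c y v *\<^sub>R X_sol + \<beta> c y v *\<^sub>R Y_sol + \<gamma> c y v *\<^sub>R Z_sol)"
    "pullback A (flat_bundle A x0 \<rho>) s \<omega>s = (\<lambda>c y v. (\<alpha> c y v + \<beta> c y v) *\<^sub>R Z_sol)"
    and conn: "is_connection A x0 \<rho> \<omega>s"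
    using assms(6) unfolding is_aux_connection_def by blast
  interpret aux_connection_data A x0 \<rho> s \<omega>s \<alpha> \<beta> \<gamma>
    by unfold_locales (fact assms cf conn)+
  show ?thesis
    unfolding pullback_vol_eq using CS_eq coframe_det_in_forms by simp
qed

end
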